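(* Let $\mathcal{E},\mathcal{E}'$ be abelian categories with enough injectives, let $R\in\mathcal{E}$, $R'\in\mathcal{E}'$ be objects of finite injective dimension, and suppose $(\mathcal{E},R)$ and $(\mathcal{E}',R')$ are derived Morita equivalent via $F:D^+(\mathcal{E})\to D^+(\mathcal{E}')$. Then $F$ preserves the ethic t-structure: for every $A^\bullet\in D^+(\mathcal{E})$, $$A^\bullet\in D^+(\mathcal{E})^{\le 0}\iff F(A^\bullet)\in D^+(\mathcal{E}')^{\le 0},\qquad A^\bullet\in D^+(\mathcal{E})^{\ge 0}\iff F(A^\bullet)\in D^+(\mathcal{E}')^{\ge 0}.$$ In particular, $F$ restricts to an equivalence of the hearts $D^+(\mathcal{E})^{\le 0}\cap D^+(\mathcal{E})^{\ge 0}\simeq D^+(\mathcal{E}')^{\le 0}\cap D^+(\mathcal{E}')^{\ge 0}$.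
   Context: For an abelian category $\mathcal{E}$ with enough injectives and $R\in\mathcal{E}$, put $\mathbf{D}=\mathbf{R}\!\operatorname{Hom}_{\mathcal{E}}(-,R)$, with $H^i\mathbf{D}(A^\bullet)=\operatorname{Ext}^i_{\mathcal{E}}(A^\bullet,R)$. The ethic t-structure is the pair of full subcategories $D^+(\mathcal{E})^{\le 0}=\{A^\bullet: H^i\mathbf{D}(A^\bullet)=0\ \forall i>1\}$ and $D^+(\mathcal{E})^{\ge 0}=\{A^\bullet: H^i\mathbf{D}(A^\bullet)=0\ \forall i<0\}$; the subcategories for $(\mathcal{E}',R')$ are defined the same way using $\mathbf{D}'=\mathbf{R}\!\operatorname{Hom}_{\mathcal{E}'}(-,R')$. Derived Morita equivalence: $(\mathcal{E},R)$ and $(\mathcal{E}',R')$ are derived Morita equivalent if there is a triangulated equivalence $F:D^+(\mathcal{E})\to D^+(\mathcal{E}')$ with quasi-inverse $G$, an isomorphism $F(R)\simeq R'$, and a natural isomorphism $\mathbf{R}\!\operatorname{Hom}_{\mathcal{E}'}(-,R')\simeq\mathbf{R}\!\operatorname{Hom}_{\mathcal{E}}(-,R)\circ G$ (equivalently $\mathbf{R}\!\operatorname{Hom}_{\mathcal{E}'}(F(-),R')\simeq\mathbf{R}\!\operatorname{Hom}_{\mathcal{E}}(-,R)$). *)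

theory Defs
  imports "HOL-Algebra.Group"
begin

section \<open>Categories and functors\<close>

text \<open>Arrows carry their domain and codomain. \<open>g \<cdot>\<^bsub>C\<^esub> f\<close> means \<open>g\<close> after \<open>f\<close>.\<close>

record ('o, 'm) cat =
  Obj :: "'o set"
  Arr :: "'m set"
  Dom :: "'m \<Rightarrow> 'o"
  Cod :: "'m \<Rightarrow> 'o"
  Ident :: "'o \<Rightarrow> 'm"
  Comp :: "'m \<Rightarrow> 'm \<Rightarrow> 'm"  (infixr "\<cdot>\<index>" 70)

definition Mor :: "('o, 'm, 'z) cat_scheme \<Rightarrow> 'o \<Rightarrow> 'o \<Rightarrow> 'm set" where
  "Mor C A B = {f \<in> Arr C. Dom C f = A \<and> Cod C f = B}"

locale category =
  fixes C (structure)
  assumes dom_obj: "f \<in> Arr C \<Longrightarrow> Dom C f \<in> Obj C"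
    and cod_obj: "f \<in> Arr C \<Longrightarrow> Cod C f \<in> Obj C"
    and ident_mor: "A \<in> Obj C \<Longrightarrow> Ident C A \<in> Mor C A A"
    and comp_mor: "\<lbrakk>f \<in> Mor C A B; g \<in> Mor C B B'\<rbrakk> \<Longrightarrow> g \<cdot> f \<in> Mor C A B'"
    and comp_assoc:
      "\<lbrakk>f \<in> Mor C A B; g \<in> Mor C B B'; h \<in> Mor C B' B''\<rbrakk> \<Longrightarrow> (h \<cdot> g) \<cdot> f = h \<cdot> (g \<cdot> f)"
    and ident_right: "f \<in> Mor C A B \<Longrightarrow> f \<cdot> Ident C A = f"
    and ident_left: "f \<in> Mor C A B \<Longrightarrow> Ident C B \<cdot> f = f"

definition inverse_arrows :: "('o, 'm, 'z) cat_scheme \<Rightarrow> 'm \<Rightarrow> 'm \<Rightarrow> bool" where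
  "inverse_arrows C f g \<longleftrightarrow>
     f \<in> Arr C \<and> g \<in> Mor C (Cod C f) (Dom C f) \<and>
     g \<cdot>\<^bsub>C\<^esub> f = Ident C (Dom C f) \<and> f \<cdot>\<^bsub>C\<^esub> g = Ident C (Cod C f)"

definition is_iso :: "('o, 'm, 'z) cat_scheme \<Rightarrow> 'm \<Rightarrow> bool" where
  "is_iso C f \<longleftrightarrow> (\<exists>g. inverse_arrows C f g)"

definition inv_arr :: "('o, 'm, 'z) cat_scheme \<Rightarrow> 'm \<Rightarrow> 'm" where
  "inv_arr C f = (THE g. inverse_arrows C f g)"

definition isomorphic :: "('o, 'm, 'z) cat_scheme \<Rightarrow> 'o \<Rightarrow> 'o \<Rightarrow> bool" where
  "isomorphic C A B \<longleftrightarrow> (\<exists>f \<in> Mor C A B. is_iso C f)"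

definition op_cat :: "('o, 'm, 'z) cat_scheme \<Rightarrow> ('o, 'm) cat" where
  "op_cat C = \<lparr>Obj = Obj C, Arr = Arr C, Dom = Cod C, Cod = Dom C,
     Ident = Ident C, Comp = (\<lambda>g f. f \<cdot>\<^bsub>C\<^esub> g)\<rparr>"

definition full_subcat :: "('o, 'm, 'z) cat_scheme \<Rightarrow> 'o set \<Rightarrow> ('o, 'm) cat" where
  "full_subcat C S = \<lparr>Obj = Obj C \<inter> S, Arr = {f \<in> Arr C. Dom C f \<in> S \<and> Cod C f \<in> S},
     Dom = Dom C, Cod = Cod C, Ident = Ident C, Comp = Comp C\<rparr>"

record ('o, 'm, 'p, 'n) ftor =
  on_obj :: "'o \<Rightarrow> 'p"
  on_arr :: "'m \<Rightarrow> 'n"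

definition is_functor ::
    "('o, 'm, 'y) cat_scheme \<Rightarrow> ('p, 'n, 'z) cat_scheme \<Rightarrow> ('o, 'm, 'p, 'n) ftor \<Rightarrow> bool" where
  "is_functor C D F \<longleftrightarrow> category C \<and> category D \<and>
     (\<forall>A \<in> Obj C. on_obj F A \<in> Obj D) \<and>
     (\<forall>A B. \<forall>f \<in> Mor C A B. on_arr F f \<in> Mor D (on_obj F A) (on_obj F B)) \<and>
     (\<forall>A \<in> Obj C. on_arr F (Ident C A) = Ident D (on_obj F A)) \<and>
     (\<forall>A B B'. \<forall>f \<in> Mor C A B. \<forall>g \<in> Mor C B B'.
        on_arr F (g \<cdot>\<^bsub>C\<^esub> f) = on_arr F g \<cdot>\<^bsub>D\<^esub> on_arr F f)"

definition id_ftor :: "('o, 'm, 'o, 'm) ftor" where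
  "id_ftor = \<lparr>on_obj = (\<lambda>A. A), on_arr = (\<lambda>f. f)\<rparr>"

definition comp_ftor ::
    "('p, 'n, 'q, 'k) ftor \<Rightarrow> ('o, 'm, 'p, 'n) ftor \<Rightarrow> ('o, 'm, 'q, 'k) ftor" where
  "comp_ftor G F = \<lparr>on_obj = on_obj G \<circ> on_obj F, on_arr = on_arr G \<circ> on_arr F\<rparr>"

definition nat_iso ::
    "('o, 'm, 'y) cat_scheme \<Rightarrow> ('p, 'n, 'z) cat_scheme \<Rightarrow>
     ('o, 'm, 'p, 'n) ftor \<Rightarrow> ('o, 'm, 'p, 'n) ftor \<Rightarrow> ('o \<Rightarrow> 'n) \<Rightarrow> bool" where
  "nat_iso C D F G \<eta> \<longleftrightarrow> is_functor C D F \<and> is_functor C D G \<and>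
     (\<forall>A \<in> Obj C. \<eta> A \<in> Mor D (on_obj F A) (on_obj G A) \<and> is_iso D (\<eta> A)) \<and>
     (\<forall>A B. \<forall>f \<in> Mor C A B. \<eta> B \<cdot>\<^bsub>D\<^esub> on_arr F f = on_arr G f \<cdot>\<^bsub>D\<^esub> \<eta> A)"

definition quasi_inverse ::
    "('o, 'm, 'y) cat_scheme \<Rightarrow> ('p, 'n, 'z) cat_scheme \<Rightarrow>
     ('o, 'm, 'p, 'n) ftor \<Rightarrow> ('p, 'n, 'o, 'm) ftor \<Rightarrow> bool" where
  "quasi_inverse C D F G \<longleftrightarrow> is_functor C D F \<and> is_functor D C G \<and>
     (\<exists>\<eta>. nat_iso C C id_ftor (comp_ftor G F) \<eta>) \<and>
     (\<exists>\<epsilon>. nat_iso D D (comp_ftor F G) id_ftor \<epsilon>)"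

definition is_equivalence ::
    "('o, 'm, 'y) cat_scheme \<Rightarrow> ('p, 'n, 'z) cat_scheme \<Rightarrow> ('o, 'm, 'p, 'n) ftor \<Rightarrow> bool" where
  "is_equivalence C D F \<longleftrightarrow> (\<exists>G. quasi_inverse C D F G)"


section \<open>Additive and abelian categories\<close>

record ('o, 'm) addcat = "('o, 'm) cat" +
  Add :: "'m \<Rightarrow> 'm \<Rightarrow> 'm"  (infixl "\<oplus>\<index>" 65)
  Zero :: "'o \<Rightarrow> 'o \<Rightarrow> 'm"

definition mor_group :: "('o, 'm, 'z) addcat_scheme \<Rightarrow> 'o \<Rightarrow> 'o \<Rightarrow> 'm monoid" where
  "mor_group C A B = \<lparr>carrier = Mor C A B, mult = Add C, one = Zero C A B\<rparr>"

definition Neg :: "('o, 'm, 'z) addcat_scheme \<Rightarrow> 'm \<Rightarrow> 'm" where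
  "Neg C f = inv\<^bsub>mor_group C (Dom C f) (Cod C f)\<^esub> f"

locale preadditive_category = category C for C (structure) +
  assumes mor_group: "\<lbrakk>A \<in> Obj C; B \<in> Obj C\<rbrakk> \<Longrightarrow> comm_group (mor_group C A B)"
    and comp_add: "\<lbrakk>f \<in> Mor C A B; f' \<in> Mor C A B; g \<in> Mor C B B'\<rbrakk>
           \<Longrightarrow> g \<cdot> (f \<oplus> f') = (g \<cdot> f) \<oplus> (g \<cdot> f')"
    and add_comp: "\<lbrakk>f \<in> Mor C A B; g \<in> Mor C B B'; g' \<in> Mor C B B'\<rbrakk>
           \<Longrightarrow> (g \<oplus> g') \<cdot> f = (g \<cdot> f) \<oplus> (g' \<cdot> f)"

definition is_zero_obj :: "('o, 'm, 'z) cat_scheme \<Rightarrow> 'o \<Rightarrow> bool" where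
  "is_zero_obj C Z \<longleftrightarrow> Z \<in> Obj C \<and>
     (\<forall>A \<in> Obj C. (\<exists>!f. f \<in> Mor C A Z) \<and> (\<exists>!f. f \<in> Mor C Z A))"

record ('o, 'm) biprod =
  bob :: 'o
  inl :: 'm
  inr :: 'm
  prl :: 'm
  prr :: 'm

definition is_biprod :: "('o, 'm, 'z) addcat_scheme \<Rightarrow> 'o \<Rightarrow> 'o \<Rightarrow> ('o, 'm) biprod \<Rightarrow> bool" where
  "is_biprod C A B P \<longleftrightarrow>
     inl P \<in> Mor C A (bob P) \<and> inr P \<in> Mor C B (bob P) \<and>
     prl P \<in> Mor C (bob P) A \<and> prr P \<in> Mor C (bob P) B \<and>
     prl P \<cdot>\<^bsub>C\<^esub> inl P = Ident C A \<and> prr P \<cdot>\<^bsub>C\<^esub> inr P = Ident C B \<and>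
     prl P \<cdot>\<^bsub>C\<^esub> inr P = Zero C B A \<and> prr P \<cdot>\<^bsub>C\<^esub> inl P = Zero C A B \<and>
     (inl P \<cdot>\<^bsub>C\<^esub> prl P) \<oplus>\<^bsub>C\<^esub> (inr P \<cdot>\<^bsub>C\<^esub> prr P) = Ident C (bob P)"

locale additive_category = preadditive_category C for C (structure) +
  assumes ex_zero_obj: "\<exists>Z. is_zero_obj C Z"
    and ex_biprod: "\<lbrakk>A \<in> Obj C; B \<in> Obj C\<rbrakk> \<Longrightarrow> \<exists>P. is_biprod C A B P"

definition zero_obj :: "('o, 'm, 'z) cat_scheme \<Rightarrow> 'o" where
  "zero_obj C = (SOME Z. is_zero_obj C Z)"

definition biprod :: "('o, 'm, 'z) addcat_scheme \<Rightarrow> 'o \<Rightarrow> 'o \<Rightarrow> ('o, 'm) biprod" where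
  "biprod C A B = (SOME P. is_biprod C A B P)"

definition is_mono :: "('o, 'm, 'z) cat_scheme \<Rightarrow> 'm \<Rightarrow> bool" where
  "is_mono C f \<longleftrightarrow> f \<in> Arr C \<and>
     (\<forall>A. \<forall>g \<in> Mor C A (Dom C f). \<forall>h \<in> Mor C A (Dom C f).
        f \<cdot>\<^bsub>C\<^esub> g = f \<cdot>\<^bsub>C\<^esub> h \<longrightarrow> g = h)"

definition is_epi :: "('o, 'm, 'z) cat_scheme \<Rightarrow> 'm \<Rightarrow> bool" where
  "is_epi C f \<longleftrightarrow> f \<in> Arr C \<and>
     (\<forall>A. \<forall>g \<in> Mor C (Cod C f) A. \<forall>h \<in> Mor C (Cod C f) A.
        g \<cdot>\<^bsub>C\<^esub> f = h \<cdot>\<^bsub>C\<^esub> f \<longrightarrow> g = h)"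

definition is_kernel :: "('o, 'm, 'z) addcat_scheme \<Rightarrow> 'm \<Rightarrow> 'm \<Rightarrow> bool" where
  "is_kernel C f k \<longleftrightarrow> f \<in> Arr C \<and> k \<in> Arr C \<and> Cod C k = Dom C f \<and>
     f \<cdot>\<^bsub>C\<^esub> k = Zero C (Dom C k) (Cod C f) \<and>
     (\<forall>A. \<forall>h \<in> Mor C A (Dom C f). f \<cdot>\<^bsub>C\<^esub> h = Zero C A (Cod C f) \<longrightarrow>
        (\<exists>!u. u \<in> Mor C A (Dom C k) \<and> k \<cdot>\<^bsub>C\<^esub> u = h))"

definition is_cokernel :: "('o, 'm, 'z) addcat_scheme \<Rightarrow> 'm \<Rightarrow> 'm \<Rightarrow> bool" where
  "is_cokernel C f q \<longleftrightarrow> f \<in> Arr C \<and> q \<in> Arr C \<and> Dom C q = Cod C f \<and>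
     q \<cdot>\<^bsub>C\<^esub> f = Zero C (Dom C f) (Cod C q) \<and>
     (\<forall>A. \<forall>h \<in> Mor C (Cod C f) A. h \<cdot>\<^bsub>C\<^esub> f = Zero C (Dom C f) A \<longrightarrow>
        (\<exists>!u. u \<in> Mor C (Cod C q) A \<and> u \<cdot>\<^bsub>C\<^esub> q = h))"

locale abelian_category = additive_category C for C (structure) +
  assumes ex_kernel: "f \<in> Arr C \<Longrightarrow> \<exists>k. is_kernel C f k"
    and ex_cokernel: "f \<in> Arr C \<Longrightarrow> \<exists>q. is_cokernel C f q"
    and mono_kernel: "is_mono C m \<Longrightarrow> \<exists>f. is_kernel C f m"
    and epi_cokernel: "is_epi C e \<Longrightarrow> \<exists>f. is_cokernel C f e"

definition is_injective :: "('o, 'm, 'z) cat_scheme \<Rightarrow> 'o \<Rightarrow> bool" where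
  "is_injective C I \<longleftrightarrow> I \<in> Obj C \<and>
     (\<forall>m. is_mono C m \<longrightarrow>
        (\<forall>f \<in> Mor C (Dom C m) I. \<exists>g \<in> Mor C (Cod C m) I. g \<cdot>\<^bsub>C\<^esub> m = f))"

definition enough_injectives :: "('o, 'm, 'z) cat_scheme \<Rightarrow> bool" where
  "enough_injectives C \<longleftrightarrow>
     (\<forall>A \<in> Obj C. \<exists>m. is_mono C m \<and> Dom C m = A \<and> is_injective C (Cod C m))"


section \<open>Complexes and the homotopy category\<close>

text \<open>Cochain complexes indexed by the integers; \<open>cdif X n\<close> is the differential out of degree \<open>n\<close>.\<close>

record ('o, 'm) cpx =
  cobj :: "int \<Rightarrow> 'o"
  cdif :: "int \<Rightarrow> 'm"

definition is_cpx :: "('o, 'm, 'z) addcat_scheme \<Rightarrow> ('o, 'm) cpx \<Rightarrow> bool" where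
  "is_cpx C X \<longleftrightarrow> (\<forall>n. cobj X n \<in> Obj C \<and> cdif X n \<in> Mor C (cobj X n) (cobj X (n + 1)) \<and>
     cdif X (n + 1) \<cdot>\<^bsub>C\<^esub> cdif X n = Zero C (cobj X n) (cobj X (n + 2)))"

definition complexes :: "('o, 'm, 'z) addcat_scheme \<Rightarrow> ('o, 'm) cpx set" where
  "complexes C = {X. is_cpx C X}"

definition bb_complexes :: "('o, 'm, 'z) addcat_scheme \<Rightarrow> ('o, 'm) cpx set" where
  "bb_complexes C = {X. is_cpx C X \<and> (\<exists>N. \<forall>n < N. is_zero_obj C (cobj X n))}"

definition stalk_cpx :: "('o, 'm, 'z) addcat_scheme \<Rightarrow> 'o \<Rightarrow> ('o, 'm) cpx" where
  "stalk_cpx C A =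
     (let X = (\<lambda>n :: int. if n = 0 then A else zero_obj C)
      in \<lparr>cobj = X, cdif = (\<lambda>n. Zero C (X n) (X (n + 1)))\<rparr>)"

definition chain_map ::
    "('o, 'm, 'z) addcat_scheme \<Rightarrow> ('o, 'm) cpx \<Rightarrow> ('o, 'm) cpx \<Rightarrow> (int \<Rightarrow> 'm) \<Rightarrow> bool" where
  "chain_map C X Y f \<longleftrightarrow> (\<forall>n. f n \<in> Mor C (cobj X n) (cobj Y n) \<and>
     cdif Y n \<cdot>\<^bsub>C\<^esub> f n = f (n + 1) \<cdot>\<^bsub>C\<^esub> cdif X n)"

definition homotopic ::
    "('o, 'm, 'z) addcat_scheme \<Rightarrow> ('o, 'm) cpx \<Rightarrow> ('o, 'm) cpx \<Rightarrow>
     (int \<Rightarrow> 'm) \<Rightarrow> (int \<Rightarrow> 'm) \<Rightarrow> bool" where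
  "homotopic C X Y f g \<longleftrightarrow> (\<exists>h. \<forall>n. h n \<in> Mor C (cobj X n) (cobj Y (n - 1)) \<and>
     f n = g n \<oplus>\<^bsub>C\<^esub> ((cdif Y (n - 1) \<cdot>\<^bsub>C\<^esub> h n) \<oplus>\<^bsub>C\<^esub> (h (n + 1) \<cdot>\<^bsub>C\<^esub> cdif X n)))"

text \<open>An arrow of the homotopy category is a triple of domain, codomain and homotopy class.\<close>

type_synonym ('o, 'm) harr = "('o, 'm) cpx \<times> ('o, 'm) cpx \<times> (int \<Rightarrow> 'm) set"

definition hclass ::
    "('o, 'm, 'z) addcat_scheme \<Rightarrow> ('o, 'm) cpx \<Rightarrow> ('o, 'm) cpx \<Rightarrow> (int \<Rightarrow> 'm) \<Rightarrow> ('o, 'm) harr"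
  where
  "hclass C X Y f = (X, Y, {g. chain_map C X Y g \<and> homotopic C X Y f g})"

definition hrep :: "('o, 'm) harr \<Rightarrow> int \<Rightarrow> 'm" where
  "hrep a = (SOME f. f \<in> snd (snd a))"

text \<open>The homotopy category of the complexes in \<open>S\<close>.\<close>

definition K_cat ::
    "('o, 'm, 'z) addcat_scheme \<Rightarrow> ('o, 'm) cpx set \<Rightarrow> (('o, 'm) cpx, ('o, 'm) harr) addcat" where
  "K_cat C S = \<lparr>
     Obj = S,
     Arr = {hclass C X Y f |X Y f. X \<in> S \<and> Y \<in> S \<and> chain_map C X Y f},
     Dom = (\<lambda>a. fst a),
     Cod = (\<lambda>a. fst (snd a)),
     Ident = (\<lambda>X. hclass C X X (\<lambda>n. Ident C (cobj X n))),
     Comp = (\<lambda>b a. hclass C (fst a) (fst (snd b)) (\<lambda>n. hrep b n \<cdot>\<^bsub>C\<^esub> hrep a n)),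
     Add = (\<lambda>a b. hclass C (fst a) (fst (snd a)) (\<lambda>n. hrep a n \<oplus>\<^bsub>C\<^esub> hrep b n)),
     Zero = (\<lambda>X Y. hclass C X Y (\<lambda>n. Zero C (cobj X n) (cobj Y n)))\<rparr>"


section \<open>Cohomology and quasi-isomorphisms\<close>

text \<open>
  The cohomology of \<open>X\<close> in degree \<open>n\<close> is the cokernel \<open>q\<close> of the map \<open>b\<close> from \<open>cobj X (n - 1)\<close> to the
  cocycles through which the differential factors, \<open>k\<close> being the inclusion of the cocycles.
\<close>

definition is_cohomology ::
    "('o, 'm, 'z) addcat_scheme \<Rightarrow> int \<Rightarrow> ('o, 'm) cpx \<Rightarrow> 'm \<times> 'm \<Rightarrow> bool" where
  "is_cohomology C n X = (\<lambda>(k, q). is_kernel C (cdif X n) k \<and>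
     (\<exists>b \<in> Mor C (cobj X (n - 1)) (Dom C k).
        k \<cdot>\<^bsub>C\<^esub> b = cdif X (n - 1) \<and> is_cokernel C b q))"

definition cohomology :: "('o, 'm, 'z) addcat_scheme \<Rightarrow> int \<Rightarrow> ('o, 'm) cpx \<Rightarrow> 'm \<times> 'm" where
  "cohomology C n X = (SOME kq. is_cohomology C n X kq)"

definition H_obj :: "('o, 'm, 'z) addcat_scheme \<Rightarrow> int \<Rightarrow> ('o, 'm) cpx \<Rightarrow> 'o" where
  "H_obj C n X = Cod C (snd (cohomology C n X))"

definition H_map ::
    "('o, 'm, 'z) addcat_scheme \<Rightarrow> int \<Rightarrow> ('o, 'm) cpx \<Rightarrow> ('o, 'm) cpx \<Rightarrow> (int \<Rightarrow> 'm) \<Rightarrow> 'm" where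
  "H_map C n X Y f =
     (let (k, q) = cohomology C n X; (k', q') = cohomology C n Y
      in THE h. h \<in> Mor C (H_obj C n X) (H_obj C n Y) \<and>
           (\<exists>z \<in> Mor C (Dom C k) (Dom C k').
              k' \<cdot>\<^bsub>C\<^esub> z = f n \<cdot>\<^bsub>C\<^esub> k \<and> h \<cdot>\<^bsub>C\<^esub> q = q' \<cdot>\<^bsub>C\<^esub> z))"

definition quasi_iso ::
    "('o, 'm, 'z) addcat_scheme \<Rightarrow> ('o, 'm) cpx \<Rightarrow> ('o, 'm) cpx \<Rightarrow> (int \<Rightarrow> 'm) \<Rightarrow> bool" where
  "quasi_iso C X Y f \<longleftrightarrow> chain_map C X Y f \<and> (\<forall>n. is_iso C (H_map C n X Y f))"

definition qis :: "('o, 'm, 'z) addcat_scheme \<Rightarrow> ('o, 'm) cpx set \<Rightarrow> ('o, 'm) harr set" where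
  "qis C S = {hclass C X Y f |X Y f. X \<in> S \<and> Y \<in> S \<and> quasi_iso C X Y f}"


section \<open>Localization by roofs\<close>

text \<open>
  The category of fractions of \<open>C\<close> at a multiplicative system \<open>W\<close>. A roof \<open>(s, f)\<close> from \<open>A\<close> to \<open>B\<close>
  is \<open>A \<leftarrow> A' \<rightarrow> B\<close> with \<open>s : A' \<rightarrow> A\<close> in \<open>W\<close>, and stands for \<open>f\<close> after the inverse of \<open>s\<close>. An arrow
  is a triple of domain, codomain and equivalence class of roofs.
\<close>

type_synonym ('o, 'm) larr = "'o \<times> 'o \<times> ('m \<times> 'm) set"

definition is_roof :: "('o, 'm, 'z) cat_scheme \<Rightarrow> 'm set \<Rightarrow> 'o \<Rightarrow> 'o \<Rightarrow> 'm \<times> 'm \<Rightarrow> bool" where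
  "is_roof C W A B = (\<lambda>(s, f). s \<in> W \<and> s \<in> Mor C (Dom C f) A \<and> f \<in> Mor C (Dom C f) B)"

definition roof_equiv :: "('o, 'm, 'z) cat_scheme \<Rightarrow> 'm set \<Rightarrow> 'm \<times> 'm \<Rightarrow> 'm \<times> 'm \<Rightarrow> bool" where
  "roof_equiv C W = (\<lambda>(s, f) (t, g).
     \<exists>A. \<exists>u \<in> Mor C A (Dom C s). \<exists>v \<in> Mor C A (Dom C t).
       s \<cdot>\<^bsub>C\<^esub> u \<in> W \<and> s \<cdot>\<^bsub>C\<^esub> u = t \<cdot>\<^bsub>C\<^esub> v \<and> f \<cdot>\<^bsub>C\<^esub> u = g \<cdot>\<^bsub>C\<^esub> v)"

definition roof_class ::
    "('o, 'm, 'z) cat_scheme \<Rightarrow> 'm set \<Rightarrow> 'o \<Rightarrow> 'o \<Rightarrow> 'm \<times> 'm \<Rightarrow> ('o, 'm) larr" where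
  "roof_class C W A B r = (A, B, {r'. is_roof C W A B r' \<and> roof_equiv C W r r'})"

definition loc_map :: "('o, 'm, 'z) cat_scheme \<Rightarrow> 'm set \<Rightarrow> 'm \<Rightarrow> ('o, 'm) larr" where
  "loc_map C W f = roof_class C W (Dom C f) (Cod C f) (Ident C (Dom C f), f)"

text \<open>
  Roofs \<open>(s, f)\<close> and \<open>(t, g)\<close> are composed by completing \<open>f\<close> and \<open>t\<close> to a commutative square with
  \<open>t' \<in> W\<close> opposite to \<open>t\<close>; they are added after choosing representatives with a common denominator.
  The results are equivalence classes because \<open>W\<close> is assumed to be a multiplicative system.
\<close>

definition loc_comp ::
    "('o, 'm, 'z) cat_scheme \<Rightarrow> 'm set \<Rightarrow> ('o, 'm) larr \<Rightarrow> ('o, 'm) larr \<Rightarrow> ('o, 'm) larr" where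
  "loc_comp C W = (\<lambda>(B, B', \<Psi>) (A, _, \<Phi>).
     (A, B', {r. is_roof C W A B' r \<and>
        (\<exists>(s, f) \<in> \<Phi>. \<exists>(t, g) \<in> \<Psi>. \<exists>A'. \<exists>t' \<in> W \<inter> Mor C A' (Dom C f). \<exists>f' \<in> Mor C A' (Dom C t).
           f \<cdot>\<^bsub>C\<^esub> t' = t \<cdot>\<^bsub>C\<^esub> f' \<and> roof_equiv C W (s \<cdot>\<^bsub>C\<^esub> t', g \<cdot>\<^bsub>C\<^esub> f') r)}))"

definition loc_add ::
    "('o, 'm, 'z) addcat_scheme \<Rightarrow> 'm set \<Rightarrow> ('o, 'm) larr \<Rightarrow> ('o, 'm) larr \<Rightarrow> ('o, 'm) larr" where
  "loc_add C W = (\<lambda>(A, B, \<Phi>) (_, _, \<Psi>).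
     (A, B, {r. is_roof C W A B r \<and>
        (\<exists>s f g. (s, f) \<in> \<Phi> \<and> (s, g) \<in> \<Psi> \<and> roof_equiv C W (s, f \<oplus>\<^bsub>C\<^esub> g) r)}))"

definition localization ::
    "('o, 'm, 'z) addcat_scheme \<Rightarrow> 'm set \<Rightarrow> ('o, ('o, 'm) larr) addcat" where
  "localization C W = \<lparr>
     Obj = Obj C,
     Arr = {roof_class C W A B r |A B r. A \<in> Obj C \<and> B \<in> Obj C \<and> is_roof C W A B r},
     Dom = (\<lambda>\<phi>. fst \<phi>),
     Cod = (\<lambda>\<phi>. fst (snd \<phi>)),
     Ident = (\<lambda>A. loc_map C W (Ident C A)),
     Comp = loc_comp C W,
     Add = loc_add C W,
     Zero = (\<lambda>A B. loc_map C W (Zero C A B))\<rparr>"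


section \<open>Derived categories\<close>

type_synonym ('o, 'm) darr = "(('o, 'm) cpx, ('o, 'm) harr) larr"

definition D_cat ::
    "('o, 'm, 'z) addcat_scheme \<Rightarrow> ('o, 'm) cpx set \<Rightarrow> (('o, 'm) cpx, ('o, 'm) darr) addcat" where
  "D_cat C S = localization (K_cat C S) (qis C S)"

definition D_class ::
    "('o, 'm, 'z) addcat_scheme \<Rightarrow> ('o, 'm) cpx set \<Rightarrow>
     ('o, 'm) cpx \<Rightarrow> ('o, 'm) cpx \<Rightarrow> (int \<Rightarrow> 'm) \<Rightarrow> ('o, 'm) darr" where
  "D_class C S X Y f = loc_map (K_cat C S) (qis C S) (hclass C X Y f)"

text \<open>
  The translation functor. On arrows no signs occur, so it maps homotopy classes and classes of roofs
  elementwise.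
\<close>

definition shift_cpx :: "('o, 'm, 'z) addcat_scheme \<Rightarrow> ('o, 'm) cpx \<Rightarrow> ('o, 'm) cpx" where
  "shift_cpx C X = \<lparr>cobj = (\<lambda>n. cobj X (n + 1)), cdif = (\<lambda>n. Neg C (cdif X (n + 1)))\<rparr>"

definition shift_harr :: "('o, 'm, 'z) addcat_scheme \<Rightarrow> ('o, 'm) harr \<Rightarrow> ('o, 'm) harr" where
  "shift_harr C = (\<lambda>(X, Y, \<Phi>). (shift_cpx C X, shift_cpx C Y, (\<lambda>f n. f (n + 1)) ` \<Phi>))"

definition shift_darr :: "('o, 'm, 'z) addcat_scheme \<Rightarrow> ('o, 'm) darr \<Rightarrow> ('o, 'm) darr" where
  "shift_darr C = (\<lambda>(X, Y, \<Phi>).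
     (shift_cpx C X, shift_cpx C Y, (\<lambda>(s, f). (shift_harr C s, shift_harr C f)) ` \<Phi>))"

definition shift_ftor ::
    "('o, 'm, 'z) addcat_scheme \<Rightarrow>
     (('o, 'm) cpx, ('o, 'm) darr, ('o, 'm) cpx, ('o, 'm) darr) ftor" where
  "shift_ftor C = \<lparr>on_obj = shift_cpx C, on_arr = shift_darr C\<rparr>"

text \<open>
  The mapping cone of \<open>f : X \<rightarrow> Y\<close> is \<open>X[1] \<oplus> Y\<close> with differential \<open>(x, y) \<mapsto> (- d x, f x + d y)\<close>.
\<close>

definition cone :: "('o, 'm, 'z) addcat_scheme \<Rightarrow>
    ('o, 'm) cpx \<Rightarrow> ('o, 'm) cpx \<Rightarrow> (int \<Rightarrow> 'm) \<Rightarrow> ('o, 'm) cpx" where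
  "cone C X Y f =
     (let P = (\<lambda>n. biprod C (cobj X (n + 1)) (cobj Y n))
      in \<lparr>cobj = (\<lambda>n. bob (P n)),
          cdif = (\<lambda>n.
            (inl (P (n + 1)) \<cdot>\<^bsub>C\<^esub> (Neg C (cdif X (n + 1)) \<cdot>\<^bsub>C\<^esub> prl (P n))) \<oplus>\<^bsub>C\<^esub>
            (inr (P (n + 1)) \<cdot>\<^bsub>C\<^esub>
               ((f (n + 1) \<cdot>\<^bsub>C\<^esub> prl (P n)) \<oplus>\<^bsub>C\<^esub> (cdif Y n \<cdot>\<^bsub>C\<^esub> prr (P n)))))\<rparr>)"

definition cone_in :: "('o, 'm, 'z) addcat_scheme \<Rightarrow> ('o, 'm) cpx \<Rightarrow> ('o, 'm) cpx \<Rightarrow> int \<Rightarrow> 'm" where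
  "cone_in C X Y = (\<lambda>n. inr (biprod C (cobj X (n + 1)) (cobj Y n)))"

definition cone_out :: "('o, 'm, 'z) addcat_scheme \<Rightarrow> ('o, 'm) cpx \<Rightarrow> ('o, 'm) cpx \<Rightarrow> int \<Rightarrow> 'm" where
  "cone_out C X Y = (\<lambda>n. prl (biprod C (cobj X (n + 1)) (cobj Y n)))"

text \<open>Distinguished triangles: those isomorphic to \<open>X \<rightarrow> Y \<rightarrow> cone f \<rightarrow> X[1]\<close> for a chain map \<open>f\<close>.\<close>

definition D_triangles ::
    "('o, 'm, 'z) addcat_scheme \<Rightarrow> ('o, 'm) cpx set \<Rightarrow>
     (('o, 'm) darr \<times> ('o, 'm) darr \<times> ('o, 'm) darr) set" where
  "D_triangles C S = {(u, v, w).
     \<exists>A B Z X Y f a b c.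
       X \<in> S \<and> Y \<in> S \<and> chain_map C X Y f \<and>
       u \<in> Mor (D_cat C S) A B \<and> v \<in> Mor (D_cat C S) B Z \<and> w \<in> Mor (D_cat C S) Z (shift_cpx C A) \<and>
       a \<in> Mor (D_cat C S) A X \<and> b \<in> Mor (D_cat C S) B Y \<and> c \<in> Mor (D_cat C S) Z (cone C X Y f) \<and>
       is_iso (D_cat C S) a \<and> is_iso (D_cat C S) b \<and> is_iso (D_cat C S) c \<and>
       b \<cdot>\<^bsub>D_cat C S\<^esub> u = D_class C S X Y f \<cdot>\<^bsub>D_cat C S\<^esub> a \<and>
       c \<cdot>\<^bsub>D_cat C S\<^esub> v = D_class C S Y (cone C X Y f) (cone_in C X Y) \<cdot>\<^bsub>D_cat C S\<^esub> b \<and>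
       shift_darr C a \<cdot>\<^bsub>D_cat C S\<^esub> w =
         D_class C S (cone C X Y f) (shift_cpx C X) (cone_out C X Y) \<cdot>\<^bsub>D_cat C S\<^esub> c}"

record ('o, 'm) tricat = "('o, 'm) addcat" +
  Shift :: "('o, 'm, 'o, 'm) ftor"
  Triangles :: "('m \<times> 'm \<times> 'm) set"

definition D_plus :: "('o, 'm, 'z) addcat_scheme \<Rightarrow> (('o, 'm) cpx, ('o, 'm) darr) tricat" where
  "D_plus C = addcat.extend (D_cat C (bb_complexes C))
     \<lparr>Shift = shift_ftor C, Triangles = D_triangles C (bb_complexes C)\<rparr>"

definition is_triangulated_functor ::
    "('o, 'm, 'y) tricat_scheme \<Rightarrow> ('p, 'n, 'z) tricat_scheme \<Rightarrow>
     ('o, 'm, 'p, 'n) ftor \<Rightarrow> ('o \<Rightarrow> 'n) \<Rightarrow> bool" where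
  "is_triangulated_functor C D F \<sigma> \<longleftrightarrow> is_functor C D F \<and>
     (\<forall>A B. \<forall>f \<in> Mor C A B. \<forall>g \<in> Mor C A B.
        on_arr F (f \<oplus>\<^bsub>C\<^esub> g) = on_arr F f \<oplus>\<^bsub>D\<^esub> on_arr F g) \<and>
     nat_iso C D (comp_ftor F (Shift C)) (comp_ftor (Shift D) F) \<sigma> \<and>
     (\<forall>(u, v, w) \<in> Triangles C.
        (on_arr F u, on_arr F v, \<sigma> (Dom C u) \<cdot>\<^bsub>D\<^esub> on_arr F w) \<in> Triangles D)"


section \<open>Abelian groups\<close>

text \<open>
  The category of the abelian groups whose elements are taken from the type \<open>'u\<close>, which plays the role
  of a universe. An arrow is a triple of domain, codomain and underlying function, the latter being
  \<open>undefined\<close> outside the carrier.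
\<close>

type_synonym 'u abarr = "'u monoid \<times> 'u monoid \<times> ('u \<Rightarrow> 'u)"

definition Ab :: "('u monoid, 'u abarr) addcat" where
  "Ab = \<lparr>
     Obj = {G. comm_group G},
     Arr = {(G, H, f). comm_group G \<and> comm_group H \<and> f \<in> hom G H \<inter> extensional (carrier G)},
     Dom = (\<lambda>a. fst a),
     Cod = (\<lambda>a. fst (snd a)),
     Ident = (\<lambda>G. (G, G, \<lambda>x \<in> carrier G. x)),
     Comp = (\<lambda>(_, K, g) (G, _, f). (G, K, compose (carrier G) g f)),
     Add = (\<lambda>(G, H, f) (_, _, g). (G, H, \<lambda>x \<in> carrier G. f x \<otimes>\<^bsub>H\<^esub> g x)),
     Zero = (\<lambda>G H. (G, H, \<lambda>x \<in> carrier G. \<one>\<^bsub>H\<^esub>))\<rparr>"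

abbreviation D_Ab :: "(('u monoid, 'u abarr) cpx, ('u monoid, 'u abarr) darr) addcat" where
  "D_Ab \<equiv> D_cat Ab (complexes Ab)"

text \<open>Transport of a group, or of a map of groups, along an injection \<open>\<iota>\<close> of types.\<close>

definition tr_group :: "('a \<Rightarrow> 'u) \<Rightarrow> 'a monoid \<Rightarrow> 'u monoid" where
  "tr_group \<iota> G = \<lparr>carrier = \<iota> ` carrier G,
     mult = (\<lambda>x y. \<iota> (inv_into UNIV \<iota> x \<otimes>\<^bsub>G\<^esub> inv_into UNIV \<iota> y)),
     one = \<iota> \<one>\<^bsub>G\<^esub>\<rparr>"

definition tr_map :: "('a \<Rightarrow> 'u) \<Rightarrow> 'a monoid \<Rightarrow> 'a monoid \<Rightarrow> ('a \<Rightarrow> 'a) \<Rightarrow> 'u abarr" where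
  "tr_map \<iota> G H f =
     (tr_group \<iota> G, tr_group \<iota> H, \<lambda>x \<in> \<iota> ` carrier G. \<iota> (f (inv_into UNIV \<iota> x)))"


section \<open>The functor RHom\<close>

text \<open>
  In degree \<open>n\<close> the complex \<open>Hom(X, Y)\<close> is the product over \<open>p\<close> of the groups \<open>Hom(X\<^sup>p, Y\<^sup>p\<^sup>+\<^sup>n)\<close>, with
  differential \<open>\<phi> \<mapsto> d \<circ> \<phi> - (-1)\<^sup>n \<phi> \<circ> d\<close>. An injection \<open>\<iota>\<close> of the families of arrows into \<open>'u\<close> makes it a
  complex in \<open>Ab\<close> over the universe \<open>'u\<close>.
\<close>

definition hom_group ::
    "('o, 'm, 'z) addcat_scheme \<Rightarrow> ('o, 'm) cpx \<Rightarrow> ('o, 'm) cpx \<Rightarrow> int \<Rightarrow> (int \<Rightarrow> 'm) monoid" where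
  "hom_group C X Y n = \<lparr>
     carrier = {\<phi>. \<forall>p. \<phi> p \<in> Mor C (cobj X p) (cobj Y (p + n))},
     mult = (\<lambda>\<phi> \<psi> p. \<phi> p \<oplus>\<^bsub>C\<^esub> \<psi> p),
     one = (\<lambda>p. Zero C (cobj X p) (cobj Y (p + n)))\<rparr>"

definition hom_dif ::
    "('o, 'm, 'z) addcat_scheme \<Rightarrow> ('o, 'm) cpx \<Rightarrow> ('o, 'm) cpx \<Rightarrow> int \<Rightarrow> (int \<Rightarrow> 'm) \<Rightarrow> int \<Rightarrow> 'm" where
  "hom_dif C X Y n \<phi> p =
     (let t = \<phi> (p + 1) \<cdot>\<^bsub>C\<^esub> cdif X p
      in (cdif Y (p + n) \<cdot>\<^bsub>C\<^esub> \<phi> p) \<oplus>\<^bsub>C\<^esub> (if even n then Neg C t else t))"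

definition hom_cpx ::
    "((int \<Rightarrow> 'm) \<Rightarrow> 'u) \<Rightarrow> ('o, 'm, 'z) addcat_scheme \<Rightarrow> ('o, 'm) cpx \<Rightarrow> ('o, 'm) cpx \<Rightarrow>
     ('u monoid, 'u abarr) cpx" where
  "hom_cpx \<iota> C X Y = \<lparr>
     cobj = (\<lambda>n. tr_group \<iota> (hom_group C X Y n)),
     cdif = (\<lambda>n. tr_map \<iota> (hom_group C X Y n) (hom_group C X Y (n + 1)) (hom_dif C X Y n))\<rparr>"

text \<open>Precomposition with \<open>f : X \<rightarrow> X'\<close>, a chain map from \<open>Hom(X', Y)\<close> to \<open>Hom(X, Y)\<close>.\<close>

definition hom_pre ::
    "((int \<Rightarrow> 'm) \<Rightarrow> 'u) \<Rightarrow> ('o, 'm, 'z) addcat_scheme \<Rightarrow>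
     ('o, 'm) cpx \<Rightarrow> ('o, 'm) cpx \<Rightarrow> ('o, 'm) cpx \<Rightarrow> (int \<Rightarrow> 'm) \<Rightarrow> int \<Rightarrow> 'u abarr" where
  "hom_pre \<iota> C X X' Y f n =
     tr_map \<iota> (hom_group C X' Y n) (hom_group C X Y n) (\<lambda>\<phi> p. \<phi> p \<cdot>\<^bsub>C\<^esub> f p)"

definition D_hom_pre ::
    "((int \<Rightarrow> 'm) \<Rightarrow> 'u) \<Rightarrow> ('o, 'm, 'z) addcat_scheme \<Rightarrow> ('o, 'm) cpx \<Rightarrow>
     ('o, 'm) harr \<Rightarrow> ('u monoid, 'u abarr) darr" where
  "D_hom_pre \<iota> C Y a =
     D_class Ab (complexes Ab) (hom_cpx \<iota> C (fst (snd a)) Y) (hom_cpx \<iota> C (fst a) Y)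
       (hom_pre \<iota> C (fst a) (fst (snd a)) Y (hrep a))"

definition is_injective_resolution ::
    "('o, 'm, 'z) addcat_scheme \<Rightarrow> 'o \<Rightarrow> ('o, 'm) cpx \<Rightarrow> bool" where
  "is_injective_resolution C R I \<longleftrightarrow> is_cpx C I \<and>
     (\<forall>n. is_injective C (cobj I n)) \<and> (\<forall>n < 0. is_zero_obj C (cobj I n)) \<and>
     (\<exists>e. quasi_iso C (stalk_cpx C R) I e)"

definition finite_injective_dimension :: "('o, 'm, 'z) addcat_scheme \<Rightarrow> 'o \<Rightarrow> bool" where
  "finite_injective_dimension C R \<longleftrightarrow>
     (\<exists>I m. is_injective_resolution C R I \<and> (\<forall>n > m. is_zero_obj C (cobj I n)))"

definition injective_resolution :: "('o, 'm, 'z) addcat_scheme \<Rightarrow> 'o \<Rightarrow> ('o, 'm) cpx" where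
  "injective_resolution C R = (SOME I. is_injective_resolution C R I)"

text \<open>
  The contravariant functor \<open>RHom(-, R) = Hom(-, I)\<close>, where \<open>I\<close> is an injective resolution of \<open>R\<close>. The class
  of a roof \<open>(s, f)\<close> is mapped to the inverse of \<open>s\<^sup>*\<close> after \<open>f\<^sup>*\<close>; here \<open>s\<^sup>*\<close> is invertible in the
  derived category because \<open>I\<close> is a bounded below complex of injectives.
\<close>

definition RHom ::
    "((int \<Rightarrow> 'm) \<Rightarrow> 'u) \<Rightarrow> ('o, 'm, 'z) addcat_scheme \<Rightarrow> 'o \<Rightarrow>
     (('o, 'm) cpx, ('o, 'm) darr, ('u monoid, 'u abarr) cpx, ('u monoid, 'u abarr) darr) ftor" where
  "RHom \<iota> C R =
     (let I = injective_resolution C R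
      in \<lparr>on_obj = (\<lambda>X. hom_cpx \<iota> C X I),
          on_arr = (\<lambda>\<phi>.
            let (s, f) = SOME r. r \<in> snd (snd \<phi>)
            in inv_arr D_Ab (D_hom_pre \<iota> C I s) \<cdot>\<^bsub>D_Ab\<^esub> D_hom_pre \<iota> C I f)\<rparr>)"

definition Ext ::
    "((int \<Rightarrow> 'm) \<Rightarrow> 'u) \<Rightarrow> ('o, 'm, 'z) addcat_scheme \<Rightarrow> int \<Rightarrow> ('o, 'm) cpx \<Rightarrow> 'o \<Rightarrow> 'u monoid" where
  "Ext \<iota> C i X R = H_obj Ab i (on_obj (RHom \<iota> C R) X)"


section \<open>The ethic t-structure and derived Morita equivalence\<close>

definition ethic_le0 ::
    "((int \<Rightarrow> 'm) \<Rightarrow> 'u) \<Rightarrow> ('o, 'm, 'z) addcat_scheme \<Rightarrow> 'o \<Rightarrow> ('o, 'm) cpx set" where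
  "ethic_le0 \<iota> C R = {X \<in> Obj (D_plus C). \<forall>i > 1. is_zero_obj Ab (Ext \<iota> C i X R)}"

definition ethic_ge0 ::
    "((int \<Rightarrow> 'm) \<Rightarrow> 'u) \<Rightarrow> ('o, 'm, 'z) addcat_scheme \<Rightarrow> 'o \<Rightarrow> ('o, 'm) cpx set" where
  "ethic_ge0 \<iota> C R = {X \<in> Obj (D_plus C). \<forall>i < 0. is_zero_obj Ab (Ext \<iota> C i X R)}"

definition ethic_heart ::
    "((int \<Rightarrow> 'm) \<Rightarrow> 'u) \<Rightarrow> ('o, 'm, 'z) addcat_scheme \<Rightarrow> 'o \<Rightarrow> (('o, 'm) cpx, ('o, 'm) darr) cat" where
  "ethic_heart \<iota> C R = full_subcat (D_plus C) (ethic_le0 \<iota> C R \<inter> ethic_ge0 \<iota> C R)"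

definition derived_Morita_via ::
    "((int \<Rightarrow> 'm) \<Rightarrow> 'u) \<Rightarrow> ((int \<Rightarrow> 'n) \<Rightarrow> 'u) \<Rightarrow>
     ('o, 'm, 'y) addcat_scheme \<Rightarrow> 'o \<Rightarrow> ('p, 'n, 'z) addcat_scheme \<Rightarrow> 'p \<Rightarrow>
     (('o, 'm) cpx, ('o, 'm) darr, ('p, 'n) cpx, ('p, 'n) darr) ftor \<Rightarrow> bool" where
  "derived_Morita_via \<iota> \<iota>' C R C' R' F \<longleftrightarrow> (\<exists>G \<sigma> \<eta>.
     is_triangulated_functor (D_plus C) (D_plus C') F \<sigma> \<and>
     quasi_inverse (D_plus C) (D_plus C') F G \<and>
     isomorphic (D_plus C') (on_obj F (stalk_cpx C R)) (stalk_cpx C' R') \<and>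
     nat_iso (op_cat (D_plus C')) D_Ab (RHom \<iota>' C' R') (comp_ftor (RHom \<iota> C R) G) \<eta>)"

end

theory Submission
  imports Defs
begin

text \<open>
  Membership in either half of the ethic t-structure is the vanishing of some of the groups
  \<open>Ext\<^sup>i(-, R) = H\<^sup>i(RHom(-, R))\<close>, so it suffices that \<open>Ext\<^sup>i(A, R)\<close> and \<open>Ext\<^sup>i(F A, R')\<close> vanish
  simultaneously. The chain \<open>RHom(F A, R') \<cong> RHom(G F A, R)\<close> in \<open>D(Ab)\<close> and \<open>G F A \<cong> A\<close> in \<open>D\<^sup>+(E)\<close>
  links them, the first isomorphism coming from the natural isomorphism in the definition of a derived
  Morita equivalence, the second from the quasi-inverse \<open>G\<close>. The first link also shows that \<open>G\<close> maps
  the heart on the right to the heart on the left, so \<open>F\<close> and \<open>G\<close> restrict to quasi-inverse functors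
  between the hearts.

  It remains to see that isomorphisms in the two derived categories preserve vanishing. Both cases
  rest on what an isomorphism \<open>A \<cong> B\<close> in a category of fractions provides
  (\<open>isomorphic_D_catE\<close>): quasi-isomorphisms \<open>v : M \<rightarrow> A\<close> and \<open>t : B' \<rightarrow> B\<close> such that \<open>v\<close> is homotopic
  to a composite \<open>M \<rightarrow> B' \<rightarrow> A\<close>. If \<open>B\<close> has no cohomology in some degree, then neither has \<open>B'\<close>, the map
  \<open>v\<close> induces zero in that degree, and so \<open>A\<close> has no cohomology there; for complexes of
  abelian groups this is \<open>exact_at_isomorphic\<close>, proved with elements.

  For the argument of \<open>RHom\<close>, vanishing of \<open>Ext\<^sup>i(X, R)\<close> means that every chain map from \<open>X\<close> to \<open>T\<close> is
  null-homotopic, where \<open>T\<close> is the injective resolution of \<open>R\<close> shifted by \<open>i\<close> (\<open>Ext_zero_iff\<close>). The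
  same argument applies once composition with a quasi-isomorphism \<open>s : X' \<rightarrow> X\<close> is known to be bijective
  on homotopy classes of maps to \<open>T\<close>. This follows from \<open>cone_map_null_homotopic\<close>: every map from the
  mapping cone of \<open>s\<close> to a bounded below complex of injectives is null-homotopic. The homotopy is built
  degree by degree, using that \<open>Hom(-, J)\<close> makes the cone exact for an injective object \<open>J\<close>
  (\<open>quasi_iso_cone_exact\<close>). Maps from the cone are written as pairs of maps from \<open>X'\<close> and \<open>X\<close>, so
  that no direct sums occur.
\<close>

section \<open>Calculating in preadditive categories\<close>

text \<open>
  The axioms of categories are restated in terms of domains and codomains. Their premises then contain
  no objects that unification would have to invent, so that they can be used as rewrite rules.
\<close>

context category
begin

lemma comp_arr [simp]:
  assumes "f \<in> Arr C" "g \<in> Arr C" "Dom C g = Cod C f"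
  shows "g \<cdot> f \<in> Arr C" "Dom C (g \<cdot> f) = Dom C f" "Cod C (g \<cdot> f) = Cod C g"
  using comp_mor[of f "Dom C f" "Cod C f" g "Cod C g"] assms by (auto simp: Mor_def)

lemma comp_assoc_arr [simp]:
  "\<lbrakk>f \<in> Arr C; g \<in> Arr C; h \<in> Arr C; Dom C g = Cod C f; Dom C h = Cod C g\<rbrakk>
    \<Longrightarrow> (h \<cdot> g) \<cdot> f = h \<cdot> (g \<cdot> f)"
  using comp_assoc[of f "Dom C f" "Cod C f" g "Cod C g" h "Cod C h"] by (auto simp: Mor_def)

lemma ident_arr [simp]:
  assumes "A \<in> Obj C"
  shows "Ident C A \<in> Arr C" "Dom C (Ident C A) = A" "Cod C (Ident C A) = A"
  using ident_mor[OF assms] by (auto simp: Mor_def)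

lemma ident_comp [simp]:
  "\<lbrakk>f \<in> Arr C; Cod C f = B\<rbrakk> \<Longrightarrow> Ident C B \<cdot> f = f"
  "\<lbrakk>f \<in> Arr C; Dom C f = A\<rbrakk> \<Longrightarrow> f \<cdot> Ident C A = f"
  using ident_left[of f "Dom C f" "Cod C f"] ident_right[of f "Dom C f" "Cod C f"]
  by (auto simp: Mor_def)

lemmas dom_cod_obj [simp] = dom_obj cod_obj

end

context preadditive_category
begin

lemma add_arr [simp]:
  assumes "f \<in> Arr C" "g \<in> Arr C" "Dom C g = Dom C f" "Cod C g = Cod C f"
  shows "f \<oplus> g \<in> Arr C" "Dom C (f \<oplus> g) = Dom C f" "Cod C (f \<oplus> g) = Cod C f"
proof -
  interpret G: comm_group "mor_group C (Dom C f) (Cod C f)"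
    using assms by (intro mor_group) auto
  have "f \<oplus> g \<in> Mor C (Dom C f) (Cod C f)"
    using G.m_closed[of f g] assms by (auto simp: mor_group_def Mor_def)
  then show "f \<oplus> g \<in> Arr C" "Dom C (f \<oplus> g) = Dom C f" "Cod C (f \<oplus> g) = Cod C f"
    by (auto simp: Mor_def)
qed

lemma zero_arr [simp]:
  assumes "A \<in> Obj C" "B \<in> Obj C"
  shows "Zero C A B \<in> Arr C" "Dom C (Zero C A B) = A" "Cod C (Zero C A B) = B"
proof -
  interpret G: comm_group "mor_group C A B"
    using assms by (intro mor_group) auto
  show "Zero C A B \<in> Arr C" "Dom C (Zero C A B) = A" "Cod C (Zero C A B) = B"
    using G.one_closed by (auto simp: mor_group_def Mor_def)
qed

lemma neg_arr [simp]:
  assumes "f \<in> Arr C"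
  shows "Neg C f \<in> Arr C" "Dom C (Neg C f) = Dom C f" "Cod C (Neg C f) = Cod C f"
proof -
  interpret G: comm_group "mor_group C (Dom C f) (Cod C f)"
    using assms by (intro mor_group) auto
  have "Neg C f \<in> Mor C (Dom C f) (Cod C f)"
    using G.inv_closed[of f] assms by (auto simp: mor_group_def Mor_def Neg_def)
  then show "Neg C f \<in> Arr C" "Dom C (Neg C f) = Dom C f" "Cod C (Neg C f) = Cod C f"
    by (auto simp: Mor_def)
qed

lemma add_zero [simp]:
  assumes "f \<in> Arr C" "Dom C f = A" "Cod C f = B"
  shows "f \<oplus> Zero C A B = f" "Zero C A B \<oplus> f = f"
proof -
  interpret G: comm_group "mor_group C A B"
    using assms by (intro mor_group) auto
  show "f \<oplus> Zero C A B = f" "Zero C A B \<oplus> f = f"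
    using G.r_one[of f] G.l_one[of f] assms by (auto simp: mor_group_def Mor_def)
qed

lemma add_neg [simp]:
  assumes "f \<in> Arr C"
  shows "f \<oplus> Neg C f = Zero C (Dom C f) (Cod C f)" "Neg C f \<oplus> f = Zero C (Dom C f) (Cod C f)"
proof -
  interpret G: comm_group "mor_group C (Dom C f) (Cod C f)"
    using assms by (intro mor_group) auto
  show "f \<oplus> Neg C f = Zero C (Dom C f) (Cod C f)" "Neg C f \<oplus> f = Zero C (Dom C f) (Cod C f)"
    using G.r_inv[of f] G.l_inv[of f] assms by (auto simp: mor_group_def Mor_def Neg_def)
qed

lemma add_assoc:
  assumes "f \<in> Arr C" "g \<in> Arr C" "h \<in> Arr C" "Dom C g = Dom C f" "Cod C g = Cod C f"
    "Dom C h = Dom C f" "Cod C h = Cod C f"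
  shows "f \<oplus> g \<oplus> h = f \<oplus> (g \<oplus> h)"
proof -
  interpret G: comm_group "mor_group C (Dom C f) (Cod C f)"
    using assms by (intro mor_group) auto
  show ?thesis
    using G.m_assoc[of f g h] assms by (auto simp: mor_group_def Mor_def)
qed

lemma add_commute:
  assumes "f \<in> Arr C" "g \<in> Arr C" "Dom C g = Dom C f" "Cod C g = Cod C f"
  shows "f \<oplus> g = g \<oplus> f"
proof -
  interpret G: comm_group "mor_group C (Dom C f) (Cod C f)"
    using assms by (intro mor_group) auto
  show ?thesis
    using G.m_comm[of f g] assms by (auto simp: mor_group_def Mor_def)
qed

lemma add_left_commute:
  assumes "f \<in> Arr C" "g \<in> Arr C" "h \<in> Arr C" "Dom C g = Dom C f" "Cod C g = Cod C f"
    "Dom C h = Dom C f" "Cod C h = Cod C f"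
  shows "f \<oplus> (g \<oplus> h) = g \<oplus> (f \<oplus> h)"
  using assms add_assoc[of f g h] add_assoc[of g f h] add_commute[of f g] by simp

lemmas add_ac = add_assoc add_commute add_left_commute

lemma add_left_cancel:
  assumes "f \<in> Arr C" "g \<in> Arr C" "h \<in> Arr C" "Dom C g = Dom C f" "Cod C g = Cod C f"
    "Dom C h = Dom C f" "Cod C h = Cod C f"
  shows "f \<oplus> g = f \<oplus> h \<longleftrightarrow> g = h"
proof -
  interpret G: comm_group "mor_group C (Dom C f) (Cod C f)"
    using assms by (intro mor_group) auto
  show ?thesis
    using G.Units_l_cancel[of f g h, unfolded G.Units_eq] assms by (auto simp: mor_group_def Mor_def)
qed

lemma add_neg_cancel [simp]:
  assumes "f \<in> Arr C" "g \<in> Arr C" "Dom C g = Dom C f" "Cod C g = Cod C f"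
  shows "f \<oplus> (Neg C f \<oplus> g) = g" "Neg C f \<oplus> (f \<oplus> g) = g"
  using assms add_assoc[of f "Neg C f" g] add_assoc[of "Neg C f" f g] by auto

lemma neg_unique:
  assumes "f \<in> Arr C" "g \<in> Arr C" "Dom C g = Dom C f" "Cod C g = Cod C f"
    "f \<oplus> g = Zero C (Dom C f) (Cod C f)"
  shows "g = Neg C f"
  using assms add_left_cancel[of f g "Neg C f"] by simp

lemma neg_neg [simp]: "f \<in> Arr C \<Longrightarrow> Neg C (Neg C f) = f"
  using neg_unique[of "Neg C f" f] by simp

lemma neg_zero [simp]: "\<lbrakk>A \<in> Obj C; B \<in> Obj C\<rbrakk> \<Longrightarrow> Neg C (Zero C A B) = Zero C A B"
  using neg_unique[of "Zero C A B" "Zero C A B"] by simp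

lemma neg_add [simp]:
  assumes "f \<in> Arr C" "g \<in> Arr C" "Dom C g = Dom C f" "Cod C g = Cod C f"
  shows "Neg C (f \<oplus> g) = Neg C f \<oplus> Neg C g"
  using neg_unique[of "f \<oplus> g" "Neg C f \<oplus> Neg C g"] assms by (simp add: add_ac)

lemma comp_add_arr [simp]:
  assumes "f \<in> Arr C" "f' \<in> Arr C" "g \<in> Arr C" "Dom C f' = Dom C f" "Cod C f' = Cod C f"
    "Dom C g = Cod C f"
  shows "g \<cdot> (f \<oplus> f') = g \<cdot> f \<oplus> g \<cdot> f'"
  using comp_add[of f "Dom C f" "Cod C f" f' g "Cod C g"] assms by (auto simp: Mor_def)

lemma add_comp_arr [simp]:
  assumes "f \<in> Arr C" "g \<in> Arr C" "g' \<in> Arr C" "Dom C g = Cod C f" "Dom C g' = Cod C f"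
    "Cod C g' = Cod C g"
  shows "(g \<oplus> g') \<cdot> f = g \<cdot> f \<oplus> g' \<cdot> f"
  using add_comp[of f "Dom C f" "Cod C f" g "Cod C g" g'] assms by (auto simp: Mor_def)

lemma comp_zero [simp]:
  assumes "g \<in> Arr C" "A \<in> Obj C" "Dom C g = B"
  shows "g \<cdot> Zero C A B = Zero C A (Cod C g)"
proof -
  have B: "B \<in> Obj C"
    using assms by auto
  have "g \<cdot> Zero C A B \<oplus> g \<cdot> Zero C A B = g \<cdot> Zero C A B \<oplus> Zero C A (Cod C g)"
    using assms B comp_add_arr[of "Zero C A B" "Zero C A B" g, symmetric] by simp
  then show ?thesis
    using assms B by (subst (asm) add_left_cancel) auto
qed

lemma zero_comp [simp]:
  assumes "f \<in> Arr C" "B \<in> Obj C" "Cod C f = A"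
  shows "Zero C A B \<cdot> f = Zero C (Dom C f) B"
proof -
  have A: "A \<in> Obj C"
    using assms by auto
  have "Zero C A B \<cdot> f \<oplus> Zero C A B \<cdot> f = Zero C A B \<cdot> f \<oplus> Zero C (Dom C f) B"
    using assms A add_comp_arr[of f "Zero C A B" "Zero C A B", symmetric] by simp
  then show ?thesis
    using assms A by (subst (asm) add_left_cancel) auto
qed

lemma comp_neg [simp]:
  assumes "f \<in> Arr C" "g \<in> Arr C" "Dom C g = Cod C f"
  shows "g \<cdot> Neg C f = Neg C (g \<cdot> f)" "Neg C g \<cdot> f = Neg C (g \<cdot> f)"
  using assms neg_unique[of "g \<cdot> f" "g \<cdot> Neg C f"] neg_unique[of "g \<cdot> f" "Neg C g \<cdot> f"]
    comp_add_arr[of f "Neg C f" g, symmetric] add_comp_arr[of f g "Neg C g", symmetric]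
  by auto

lemma eq_if_diff_zero:
  assumes "f \<in> Arr C" "g \<in> Arr C" "Dom C g = Dom C f" "Cod C g = Cod C f"
    "f \<oplus> Neg C g = Zero C (Dom C f) (Cod C f)"
  shows "f = g"
  using assms neg_unique[of "Neg C g" f] by (simp add: add_commute)

section \<open>Homotopies\<close>

lemma cpxD:
  assumes "is_cpx C X"
  shows "cobj X n \<in> Obj C" "cdif X n \<in> Arr C" "Dom C (cdif X n) = cobj X n"
    "Cod C (cdif X n) = cobj X (n + 1)"
    "cdif X (n + 1) \<cdot> cdif X n = Zero C (cobj X n) (cobj X (n + 2))"
  using assms by (auto simp: is_cpx_def Mor_def)

lemma cdif_cdif:
  assumes "is_cpx C X" "f \<in> Arr C" "Cod C f = cobj X n" "m = n + 1" 
  shows "cdif X m \<cdot> (cdif X n \<cdot> f) = Zero C (Dom C f) (cobj X (n + 2))"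
proof -
  have "(cdif X m \<cdot> cdif X n) \<cdot> f = Zero C (Dom C f) (cobj X (n + 2))"
    unfolding assms(4) cpxD(5)[OF assms(1)] using assms(2,3) cpxD(1)[OF assms(1)] by simp
  then show ?thesis
    using assms cpxD(1-4)[OF assms(1)] by simp
qed

lemma chain_mapD:
  assumes "chain_map C X Y f"
  shows "f n \<in> Arr C" "Dom C (f n) = cobj X n" "Cod C (f n) = cobj Y n"
    "cdif Y n \<cdot> f n = f (n + 1) \<cdot> cdif X n"
  using assms by (auto simp: chain_map_def Mor_def)

lemma chain_map_comp:
  assumes "is_cpx C X" "is_cpx C Y" "is_cpx C Z" "chain_map C X Y f" "chain_map C Y Z g"
  shows "chain_map C X Z (\<lambda>n. g n \<cdot> f n)"
proof -
  note D = cpxD[OF assms(1)] cpxD[OF assms(2)] cpxD[OF assms(3)] 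
    chain_mapD(1-3)[OF assms(4)] chain_mapD(1-3)[OF assms(5)]
  have "cdif Z n \<cdot> (g n \<cdot> f n) = (g (n + 1) \<cdot> f (n + 1)) \<cdot> cdif X n" for n
  proof -
    have "cdif Z n \<cdot> (g n \<cdot> f n) = (cdif Z n \<cdot> g n) \<cdot> f n"
      by (simp add: D)
    also have "\<dots> = g (n + 1) \<cdot> (cdif Y n \<cdot> f n)"
      unfolding chain_mapD(4)[OF assms(5)] by (simp add: D)
    also have "\<dots> = (g (n + 1) \<cdot> f (n + 1)) \<cdot> cdif X n"
      unfolding chain_mapD(4)[OF assms(4)] by (simp add: D)
    finally show ?thesis .
  qed
  then show ?thesis
    unfolding chain_map_def by (simp add: Mor_def D)
qed

lemma chain_map_ident: "is_cpx C X \<Longrightarrow> chain_map C X X (\<lambda>n. Ident C (cobj X n))"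
  using cpxD[of X] by (simp add: chain_map_def Mor_def)

lemma homotopicI:
  assumes "\<And>n. h n \<in> Arr C" "\<And>n. Dom C (h n) = cobj X n" "\<And>n. Cod C (h n) = cobj Y (n - 1)"
    "\<And>n. f n = g n \<oplus> (cdif Y (n - 1) \<cdot> h n \<oplus> h (n + 1) \<cdot> cdif X n)"
  shows "homotopic C X Y f g"
  using assms unfolding homotopic_def Mor_def by blast

lemma homotopicE:
  assumes "homotopic C X Y f g"
  obtains h where "\<And>n. h n \<in> Arr C" "\<And>n. Dom C (h n) = cobj X n"
    "\<And>n. Cod C (h n) = cobj Y (n - 1)"
    "\<And>n. f n = g n \<oplus> (cdif Y (n - 1) \<cdot> h n \<oplus> h (n + 1) \<cdot> cdif X n)"
  using assms unfolding homotopic_def Mor_def by blast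

context
  fixes X Y
  assumes X: "is_cpx C X" and Y: "is_cpx C Y"
begin

lemma homotopic_refl: "chain_map C X Y f \<Longrightarrow> homotopic C X Y f f"
  by (rule homotopicI[where h = "\<lambda>n. Zero C (cobj X n) (cobj Y (n - 1))"])
    (simp_all add: cpxD[OF X] cpxD[OF Y] chain_mapD)

lemma homotopic_sym:
  assumes "chain_map C X Y f" "chain_map C X Y g" "homotopic C X Y f g"
  shows "homotopic C X Y g f"
proof -
  obtain h where h: "\<And>n. h n \<in> Arr C" "\<And>n. Dom C (h n) = cobj X n"
    "\<And>n. Cod C (h n) = cobj Y (n - 1)"
    "\<And>n. f n = g n \<oplus> (cdif Y (n - 1) \<cdot> h n \<oplus> h (n + 1) \<cdot> cdif X n)"
    using assms(3) by (rule homotopicE) (rule that)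
  note D = cpxD(1-4)[OF X] cpxD(1-4)[OF Y] chain_mapD(1-3)[OF assms(1)] chain_mapD(1-3)[OF assms(2)] h(1-3)
  show ?thesis
    by (rule homotopicI[where h = "\<lambda>n. Neg C (h n)"])
      (simp_all add: D h(4) add_ac)
qed

lemma homotopic_trans:
  assumes "chain_map C X Y e" "chain_map C X Y f" "chain_map C X Y g" 
    "homotopic C X Y e f" "homotopic C X Y f g"
  shows "homotopic C X Y e g"
proof -
  obtain h where h: "\<And>n. h n \<in> Arr C" "\<And>n. Dom C (h n) = cobj X n"
    "\<And>n. Cod C (h n) = cobj Y (n - 1)"
    "\<And>n. e n = f n \<oplus> (cdif Y (n - 1) \<cdot> h n \<oplus> h (n + 1) \<cdot> cdif X n)"
    using assms(4) by (rule homotopicE) (rule that)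
  obtain k where k: "\<And>n. k n \<in> Arr C" "\<And>n. Dom C (k n) = cobj X n"
    "\<And>n. Cod C (k n) = cobj Y (n - 1)"
    "\<And>n. f n = g n \<oplus> (cdif Y (n - 1) \<cdot> k n \<oplus> k (n + 1) \<cdot> cdif X n)"
    using assms(5) by (rule homotopicE) (rule that)
  note D = cpxD(1-4)[OF X] cpxD(1-4)[OF Y] chain_mapD(1-3)[OF assms(1)] chain_mapD(1-3)[OF assms(2)] 
    chain_mapD(1-3)[OF assms(3)] h(1-3) k(1-3)
  show ?thesis
    by (rule homotopicI[where h = "\<lambda>n. h n \<oplus> k n"])
      (simp_all add: D h(4) k(4) add_ac)
qed

end

lemma homotopic_comp_left:
  assumes "is_cpx C X" "is_cpx C Y" "is_cpx C Z" "chain_map C X Y f" "chain_map C X Y f'"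
    "chain_map C Y Z g" "homotopic C X Y f f'"
  shows "homotopic C X Z (\<lambda>n. g n \<cdot> f n) (\<lambda>n. g n \<cdot> f' n)"
proof -
  obtain h where h: "\<And>n. h n \<in> Arr C" "\<And>n. Dom C (h n) = cobj X n"
    "\<And>n. Cod C (h n) = cobj Y (n - 1)"
    "\<And>n. f n = f' n \<oplus> (cdif Y (n - 1) \<cdot> h n \<oplus> h (n + 1) \<cdot> cdif X n)"
    using assms(7) by (rule homotopicE) (rule that)
  note D = cpxD(1-4)[OF assms(1)] cpxD(1-4)[OF assms(2)] cpxD(1-4)[OF assms(3)] 
    chain_mapD(1-3)[OF assms(4)] chain_mapD(1-3)[OF assms(5)] chain_mapD(1-3)[OF assms(6)] h(1-3)
  have "g n \<cdot> (cdif Y (n - 1) \<cdot> h n) = cdif Z (n - 1) \<cdot> (g (n - 1) \<cdot> h n)" for n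
  proof -
    have "(g n \<cdot> cdif Y (n - 1)) \<cdot> h n = (cdif Z (n - 1) \<cdot> g (n - 1)) \<cdot> h n"
      using chain_mapD(4)[OF assms(6), of "n - 1"] by simp
    then show ?thesis
      by (simp add: D)
  qed
  then show ?thesis
    by (intro homotopicI[where h = "\<lambda>n. g (n - 1) \<cdot> h n"]) (simp_all add: D h(4))
qed

lemma homotopic_comp_right:
  assumes "is_cpx C X" "is_cpx C Y" "is_cpx C Z" "chain_map C X Y f"
    "chain_map C Y Z g" "chain_map C Y Z g'" "homotopic C Y Z g g'"
  shows "homotopic C X Z (\<lambda>n. g n \<cdot> f n) (\<lambda>n. g' n \<cdot> f n)"
proof -
  obtain h where h: "\<And>n. h n \<in> Arr C" "\<And>n. Dom C (h n) = cobj Y n"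
    "\<And>n. Cod C (h n) = cobj Z (n - 1)"
    "\<And>n. g n = g' n \<oplus> (cdif Z (n - 1) \<cdot> h n \<oplus> h (n + 1) \<cdot> cdif Y n)"
    using assms(7) by (rule homotopicE) (rule that)
  note D = cpxD(1-4)[OF assms(1)] cpxD(1-4)[OF assms(2)] cpxD(1-4)[OF assms(3)] 
    chain_mapD[OF assms(4)] chain_mapD(1-3)[OF assms(5)] chain_mapD(1-3)[OF assms(6)] h(1-3)
  show ?thesis
    by (intro homotopicI[where h = "\<lambda>n. h n \<cdot> f n"]) (simp_all add: D h(4))
qed

lemma hclass_eq_iff:
  assumes "is_cpx C X" "is_cpx C Y" "chain_map C X Y f" "chain_map C X Y g"
  shows "hclass C X Y f = hclass C X Y g \<longleftrightarrow> homotopic C X Y f g"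
proof
  assume "hclass C X Y f = hclass C X Y g"
  then show "homotopic C X Y f g"
    using homotopic_refl[OF assms(1,2,4)] assms(4) by (auto simp: hclass_def)
next
  assume "homotopic C X Y f g"
  then show "hclass C X Y f = hclass C X Y g"
    using homotopic_sym[OF assms] homotopic_trans[OF assms(1,2,3,4)]
      homotopic_trans[OF assms(1,2,4,3)] by (auto simp: hclass_def)
qed

lemma hrep_hclass:
  assumes "is_cpx C X" "is_cpx C Y" "chain_map C X Y f"
  shows "chain_map C X Y (hrep (hclass C X Y f))" "homotopic C X Y f (hrep (hclass C X Y f))"
proof -
  have "hrep (hclass C X Y f) \<in> {g. chain_map C X Y g \<and> homotopic C X Y f g}"
    unfolding hrep_def hclass_def snd_conv
    by (rule someI[of _ f]) (use homotopic_refl[OF assms] assms(3) in auto)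
  then show "chain_map C X Y (hrep (hclass C X Y f))" "homotopic C X Y f (hrep (hclass C X Y f))"
    by auto
qed

text \<open>
  Composition in the homotopy category is defined by chosen representatives. This lemma, which holds
  because homotopy is compatible with composition, allows any others to be used.
\<close>

lemma K_comp_hclass:
  assumes "is_cpx C X" "is_cpx C Y" "is_cpx C Z" "chain_map C X Y f" "chain_map C Y Z g"
  shows "hclass C Y Z g \<cdot>\<^bsub>K_cat C S\<^esub> hclass C X Y f = hclass C X Z (\<lambda>n. g n \<cdot> f n)"
proof -
  let ?f = "hrep (hclass C X Y f)" and ?g = "hrep (hclass C Y Z g)"
  note f = hrep_hclass[OF assms(1,2,4)] and g = hrep_hclass[OF assms(2,3,5)]
  have "homotopic C X Z (\<lambda>n. g n \<cdot> f n) (\<lambda>n. g n \<cdot> ?f n)"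
    using assms f by (intro homotopic_comp_left[of X Y Z]) auto
  moreover have "homotopic C X Z (\<lambda>n. g n \<cdot> ?f n) (\<lambda>n. ?g n \<cdot> ?f n)"
    using assms f g by (intro homotopic_comp_right[of X Y Z]) auto
  ultimately have "homotopic C X Z (\<lambda>n. g n \<cdot> f n) (\<lambda>n. ?g n \<cdot> ?f n)"
    using assms f g by (blast intro: homotopic_trans chain_map_comp)
  then have "hclass C X Z (\<lambda>n. g n \<cdot> f n) = hclass C X Z (\<lambda>n. ?g n \<cdot> ?f n)"
    using assms f g by (subst hclass_eq_iff) (auto intro: chain_map_comp)
  then show ?thesis
    by (simp add: K_cat_def hclass_def)
qed

lemma K_Mor:
  "Mor (K_cat C S) X Y = (if X \<in> S \<and> Y \<in> S then {hclass C X Y f |f. chain_map C X Y f} else {})"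
  by (auto simp: Mor_def K_cat_def hclass_def)

end

section \<open>Kernels, cokernels and cohomology\<close>

lemma ex1_eq: "\<lbrakk>\<exists>!x. P x; P a; P b\<rbrakk> \<Longrightarrow> a = b"
  by blast

context preadditive_category
begin

lemma kernelD:
  assumes "is_kernel C f k"
  shows "f \<in> Arr C" "k \<in> Arr C" "Cod C k = Dom C f" "f \<cdot> k = Zero C (Dom C k) (Cod C f)"
  using assms by (auto simp: is_kernel_def)

lemma kernel_ex1:
  assumes "is_kernel C f k" "h \<in> Mor C A (Dom C f)" "f \<cdot> h = Zero C A (Cod C f)"
  shows "\<exists>!u. u \<in> Mor C A (Dom C k) \<and> k \<cdot> u = h"
proof -
  have "\<forall>A. \<forall>h \<in> Mor C A (Dom C f). f \<cdot> h = Zero C A (Cod C f) \<longrightarrow>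
      (\<exists>!u. u \<in> Mor C A (Dom C k) \<and> k \<cdot> u = h)"
    using assms(1) unfolding is_kernel_def by (elim conjE)
  from this[rule_format, OF assms(2,3)] show ?thesis .
qed

lemma kernel_factor:
  assumes "is_kernel C f k" "h \<in> Arr C" "Cod C h = Dom C f" "f \<cdot> h = Zero C (Dom C h) (Cod C f)"
  shows "\<exists>u. u \<in> Arr C \<and> Dom C u = Dom C h \<and> Cod C u = Dom C k \<and> k \<cdot> u = h"
proof -
  have "h \<in> Mor C (Dom C h) (Dom C f)"
    using assms by (simp add: Mor_def)
  then have "\<exists>!u. u \<in> Mor C (Dom C h) (Dom C k) \<and> k \<cdot> u = h"
    using kernel_ex1 assms by simp
  then show ?thesis
    by (elim ex1E) (auto simp: Mor_def)
qed

lemma kernel_cancel: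
  assumes "is_kernel C f k" "u \<in> Arr C" "v \<in> Arr C" "Cod C u = Dom C k" "Cod C v = Dom C k"
    "Dom C v = Dom C u" "k \<cdot> u = k \<cdot> v"
  shows "u = v"
proof -
  note k = kernelD[OF assms(1)]
  have "f \<cdot> (k \<cdot> u) = (f \<cdot> k) \<cdot> u"
    using assms k(1-3) by simp
  also have "\<dots> = Zero C (Dom C u) (Cod C f)"
    unfolding k(4) using assms k by simp
  finally have "f \<cdot> (k \<cdot> u) = Zero C (Dom C u) (Cod C f)" .
  moreover have "k \<cdot> u \<in> Mor C (Dom C u) (Dom C f)"
    using assms k by (simp add: Mor_def)
  ultimately have "\<exists>!w. w \<in> Mor C (Dom C u) (Dom C k) \<and> k \<cdot> w = k \<cdot> u"
    using kernel_ex1 assms(1) by simp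
  then show ?thesis
    by (rule ex1_eq) (use assms(2-7) in \<open>simp_all add: Mor_def\<close>)
qed

lemma cokernelD:
  assumes "is_cokernel C f q"
  shows "f \<in> Arr C" "q \<in> Arr C" "Dom C q = Cod C f" "q \<cdot> f = Zero C (Dom C f) (Cod C q)"
  using assms by (auto simp: is_cokernel_def)

lemma cokernel_ex1:
  assumes "is_cokernel C f q" "h \<in> Mor C (Cod C f) A" "h \<cdot> f = Zero C (Dom C f) A"
  shows "\<exists>!u. u \<in> Mor C (Cod C q) A \<and> u \<cdot> q = h"
proof -
  have "\<forall>A. \<forall>h \<in> Mor C (Cod C f) A. h \<cdot> f = Zero C (Dom C f) A \<longrightarrow>
      (\<exists>!u. u \<in> Mor C (Cod C q) A \<and> u \<cdot> q = h)"
    using assms(1) unfolding is_cokernel_def by (elim conjE)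
  from this[rule_format, OF assms(2,3)] show ?thesis .
qed

lemma cokernel_factor:
  assumes "is_cokernel C f q" "h \<in> Arr C" "Dom C h = Cod C f" "h \<cdot> f = Zero C (Dom C f) (Cod C h)"
  shows "\<exists>u. u \<in> Arr C \<and> Dom C u = Cod C q \<and> Cod C u = Cod C h \<and> u \<cdot> q = h"
proof -
  have "h \<in> Mor C (Cod C f) (Cod C h)"
    using assms by (simp add: Mor_def)
  then have "\<exists>!u. u \<in> Mor C (Cod C q) (Cod C h) \<and> u \<cdot> q = h"
    using cokernel_ex1 assms by simp
  then show ?thesis
    by (elim ex1E) (auto simp: Mor_def)
qed

lemma cokernel_cancel:
  assumes "is_cokernel C f q" "u \<in> Arr C" "v \<in> Arr C" "Dom C u = Cod C q" "Dom C v = Cod C q"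
    "Cod C v = Cod C u" "u \<cdot> q = v \<cdot> q"
  shows "u = v"
proof -
  note q = cokernelD[OF assms(1)]
  have "(u \<cdot> q) \<cdot> f = u \<cdot> (q \<cdot> f)"
    using assms(2,4) q(1-3) by simp
  also have "\<dots> = Zero C (Dom C f) (Cod C u)"
    unfolding q(4) using assms q by simp
  finally have "(u \<cdot> q) \<cdot> f = Zero C (Dom C f) (Cod C u)" .
  moreover have "u \<cdot> q \<in> Mor C (Cod C f) (Cod C u)"
    using assms q by (simp add: Mor_def)
  ultimately have "\<exists>!w. w \<in> Mor C (Cod C q) (Cod C u) \<and> w \<cdot> q = u \<cdot> q"
    using cokernel_ex1 assms(1) by simp
  then show ?thesis
    by (rule ex1_eq) (use assms(2-7) in \<open>simp_all add: Mor_def\<close>)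
qed

lemma cohomologyE:
  assumes "is_cpx C X" "is_cohomology C n X (k, q)"
  obtains b where "is_kernel C (cdif X n) k" "is_cokernel C b q" "k \<cdot> b = cdif X (n - 1)"
    "k \<in> Arr C" "Cod C k = cobj X n" "b \<in> Arr C" "Dom C b = cobj X (n - 1)" "Cod C b = Dom C k"
    "q \<in> Arr C" "Dom C q = Dom C k" "cdif X n \<cdot> k = Zero C (Dom C k) (cobj X (n + 1))"
    "q \<cdot> b = Zero C (cobj X (n - 1)) (Cod C q)"
proof -
  obtain b where b: "is_kernel C (cdif X n) k" "b \<in> Mor C (cobj X (n - 1)) (Dom C k)"
    "k \<cdot> b = cdif X (n - 1)" "is_cokernel C b q"
    using assms(2) by (auto simp: is_cohomology_def)
  show ?thesis
    by (rule that[of b])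
      (use b kernelD[OF b(1)] cokernelD[OF b(4)] cpxD[OF assms(1)] in \<open>auto simp: Mor_def\<close>)
qed

end

text \<open>
  Cohomology and its functoriality are developed from kernels and cokernels, so that they apply both
  to an abelian category and to the category of abelian groups.
\<close>

locale kernel_cokernel_category = preadditive_category C for C (structure) +
  assumes kernel_exists: "f \<in> Arr C \<Longrightarrow> \<exists>k. is_kernel C f k"
    and cokernel_exists: "f \<in> Arr C \<Longrightarrow> \<exists>q. is_cokernel C f q"
begin

lemma is_cohomology_cohomology:
  assumes "is_cpx C X"
  shows "is_cohomology C n X (cohomology C n X)"
proof -
  note X = cpxD[OF assms]
  obtain k where k: "is_kernel C (cdif X n) k"
    using kernel_exists X by blast
  have "cdif X n \<cdot> cdif X (n - 1) = Zero C (cobj X (n - 1)) (cobj X (n + 1))"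
    using X(5)[of "n - 1"] by (simp add: algebra_simps)
  then obtain b where b: "b \<in> Arr C" "Dom C b = cobj X (n - 1)" "Cod C b = Dom C k"
    "k \<cdot> b = cdif X (n - 1)"
    using X kernel_factor[OF k, of "cdif X (n - 1)"] by auto
  obtain q where "is_cokernel C b q"
    using cokernel_exists b by blast
  then have "is_cohomology C n X (k, q)"
    using k b by (auto simp: is_cohomology_def Mor_def)
  then show ?thesis
    unfolding cohomology_def by (rule someI)
qed

text \<open>
  A chain map takes cocycles to cocycles and coboundaries to coboundaries, hence induces a map on
  cohomology; it is unique because \<open>k'\<close> is monic and \<open>q\<close> is epic. So the definite description in
  \<open>H_map\<close> denotes this map.
\<close>

lemma H_map_ex1:
  assumes "is_cpx C X" "is_cpx C Y" "chain_map C X Y f"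
    "is_cohomology C n X (k, q)" "is_cohomology C n Y (k', q')"
  shows "\<exists>!h. h \<in> Mor C (Cod C q) (Cod C q') \<and>
    (\<exists>z \<in> Mor C (Dom C k) (Dom C k'). k' \<cdot> z = f n \<cdot> k \<and> h \<cdot> q = q' \<cdot> z)"
proof -
  obtain b where b: "is_kernel C (cdif X n) k" "is_cokernel C b q" "k \<cdot> b = cdif X (n - 1)"
    "k \<in> Arr C" "Cod C k = cobj X n" "b \<in> Arr C" "Dom C b = cobj X (n - 1)" "Cod C b = Dom C k"
    "q \<in> Arr C" "Dom C q = Dom C k" "cdif X n \<cdot> k = Zero C (Dom C k) (cobj X (n + 1))"
    using assms(1,4) by (rule cohomologyE) (rule that)
  obtain b' where b': "is_kernel C (cdif Y n) k'" "is_cokernel C b' q'" "k' \<cdot> b' = cdif Y (n - 1)"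
    "k' \<in> Arr C" "Cod C k' = cobj Y n" "b' \<in> Arr C" "Dom C b' = cobj Y (n - 1)" "Cod C b' = Dom C k'"
    "q' \<in> Arr C" "Dom C q' = Dom C k'" "q' \<cdot> b' = Zero C (cobj Y (n - 1)) (Cod C q')"
    using assms(2,5) by (rule cohomologyE) (rule that)
  note D = b(4-10) b'(4-10) cpxD(1-4)[OF assms(1)] cpxD(1-4)[OF assms(2)] chain_mapD(1-3)[OF assms(3)]
  have "cdif Y n \<cdot> (f n \<cdot> k) = (cdif Y n \<cdot> f n) \<cdot> k"
    by (simp add: D)
  also have "\<dots> = f (n + 1) \<cdot> (cdif X n \<cdot> k)"
    unfolding chain_mapD(4)[OF assms(3)] by (simp add: D)
  also have "\<dots> = Zero C (Dom C k) (cobj Y (n + 1))"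
    unfolding b(11) by (simp add: D)
  finally have "cdif Y n \<cdot> (f n \<cdot> k) = Zero C (Dom C k) (cobj Y (n + 1))" .
  then have "\<exists>z. z \<in> Arr C \<and> Dom C z = Dom C k \<and> Cod C z = Dom C k' \<and> k' \<cdot> z = f n \<cdot> k"
    using kernel_factor[OF b'(1), of "f n \<cdot> k"] by (simp add: D)
  then obtain z where z: "z \<in> Arr C" "Dom C z = Dom C k" "Cod C z = Dom C k'" "k' \<cdot> z = f n \<cdot> k"
    by blast
  have "k' \<cdot> (z \<cdot> b) = (k' \<cdot> z) \<cdot> b"
    by (simp add: D z(1-3))
  also have "\<dots> = f n \<cdot> (k \<cdot> b)"
    unfolding z(4) by (simp add: D)
  also have "\<dots> = cdif Y (n - 1) \<cdot> f (n - 1)"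
    unfolding b(3) using chain_mapD(4)[OF assms(3), of "n - 1"] by simp
  also have "\<dots> = k' \<cdot> (b' \<cdot> f (n - 1))"
    unfolding b'(3)[symmetric] by (simp add: D)
  finally have "k' \<cdot> (z \<cdot> b) = k' \<cdot> (b' \<cdot> f (n - 1))" .
  then have zb: "z \<cdot> b = b' \<cdot> f (n - 1)"
    by - (rule kernel_cancel[OF b'(1)], simp_all add: D z(1-3))
  have "(q' \<cdot> z) \<cdot> b = (q' \<cdot> b') \<cdot> f (n - 1)"
    by (simp add: D z(1-3) zb)
  also have "\<dots> = Zero C (cobj X (n - 1)) (Cod C q')"
    unfolding b'(11) by (simp add: D)
  finally have "(q' \<cdot> z) \<cdot> b = Zero C (cobj X (n - 1)) (Cod C q')" .
  then have "\<exists>h. h \<in> Arr C \<and> Dom C h = Cod C q \<and> Cod C h = Cod C q' \<and> h \<cdot> q = q' \<cdot> z"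
    using cokernel_factor[OF b(2), of "q' \<cdot> z"] by (simp add: D z(1-3))
  then obtain h where h: "h \<in> Arr C" "Dom C h = Cod C q" "Cod C h = Cod C q'" "h \<cdot> q = q' \<cdot> z"
    by blast
  show ?thesis
  proof (rule ex1I[of _ h])
    show "h \<in> Mor C (Cod C q) (Cod C q') \<and>
      (\<exists>z \<in> Mor C (Dom C k) (Dom C k'). k' \<cdot> z = f n \<cdot> k \<and> h \<cdot> q = q' \<cdot> z)"
      using h z by (auto simp: Mor_def)
  next
    fix h' assume "h' \<in> Mor C (Cod C q) (Cod C q') \<and>
      (\<exists>z \<in> Mor C (Dom C k) (Dom C k'). k' \<cdot> z = f n \<cdot> k \<and> h' \<cdot> q = q' \<cdot> z)"
    then obtain z' where z': "h' \<in> Mor C (Cod C q) (Cod C q')" "z' \<in> Mor C (Dom C k) (Dom C k')"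
      "k' \<cdot> z' = f n \<cdot> k" "h' \<cdot> q = q' \<cdot> z'"
      by blast
    have "z' = z"
      using z z' by - (rule kernel_cancel[OF b'(1)], auto simp: Mor_def D)
    show "h' = h"
      using z' h \<open>z' = z\<close> by - (rule cokernel_cancel[OF b(2)], auto simp: Mor_def D)
  qed
qed

lemma quasi_isoE:
  assumes "is_cpx C X" "is_cpx C Y" "quasi_iso C X Y f"
  obtains k q k' q' z h where "is_cohomology C n X (k, q)" "is_cohomology C n Y (k', q')"
    "z \<in> Arr C" "Dom C z = Dom C k" "Cod C z = Dom C k'" "k' \<cdot> z = f n \<cdot> k"
    "h \<in> Arr C" "Dom C h = Cod C q" "Cod C h = Cod C q'" "h \<cdot> q = q' \<cdot> z" "is_iso C h"
proof -
  obtain k q where kq: "cohomology C n X = (k, q)"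
    by (cases "cohomology C n X")
  obtain k' q' where kq': "cohomology C n Y = (k', q')"
    by (cases "cohomology C n Y")
  note coh = is_cohomology_cohomology[OF assms(1), of n, unfolded kq]
    is_cohomology_cohomology[OF assms(2), of n, unfolded kq']
  let ?P = "\<lambda>h. h \<in> Mor C (Cod C q) (Cod C q') \<and>
    (\<exists>z \<in> Mor C (Dom C k) (Dom C k'). k' \<cdot> z = f n \<cdot> k \<and> h \<cdot> q = q' \<cdot> z)"
  have "H_map C n X Y f = (THE h. ?P h)"
    by (simp add: H_map_def H_obj_def kq kq')
  moreover have "?P (THE h. ?P h)"
    by (rule theI'[OF H_map_ex1[OF assms(1,2) _ coh]]) (use assms(3) in \<open>simp add: quasi_iso_def\<close>)
  ultimately have "?P (H_map C n X Y f)"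
    by simp
  then obtain z where z: "z \<in> Mor C (Dom C k) (Dom C k')" "k' \<cdot> z = f n \<cdot> k"
    "H_map C n X Y f \<cdot> q = q' \<cdot> z" "H_map C n X Y f \<in> Mor C (Cod C q) (Cod C q')"
    by blast
  show ?thesis
    by (rule that[OF coh, of z "H_map C n X Y f"])
      (use z assms(3) in \<open>simp_all add: quasi_iso_def Mor_def\<close>)
qed

lemma quasi_iso_ident:
  assumes "is_cpx C X"
  shows "quasi_iso C X X (\<lambda>n. Ident C (cobj X n))"
proof -
  note X = chain_map_ident[OF assms]
  have "is_iso C (H_map C n X X (\<lambda>n. Ident C (cobj X n)))" for n
  proof -
    obtain k q where kq: "cohomology C n X = (k, q)"
      by (cases "cohomology C n X")
    note coh = is_cohomology_cohomology[OF assms, of n, unfolded kq]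
    have b: "k \<in> Arr C" "Cod C k = cobj X n" "q \<in> Arr C" "Dom C q = Dom C k"
      by (rule cohomologyE[OF assms coh], assumption)+
    let ?P = "\<lambda>h. h \<in> Mor C (Cod C q) (Cod C q) \<and>
      (\<exists>z \<in> Mor C (Dom C k) (Dom C k). k \<cdot> z = Ident C (cobj X n) \<cdot> k \<and> h \<cdot> q = q \<cdot> z)"
    have "H_map C n X X (\<lambda>n. Ident C (cobj X n)) = (THE h. ?P h)"
      by (simp add: H_map_def H_obj_def kq)
    also have "\<dots> = Ident C (Cod C q)"
      using H_map_ex1[OF assms assms X coh coh]
    proof (rule the1_equality)
      show "?P (Ident C (Cod C q))"
        using b by (auto simp: Mor_def intro!: exI[of _ "Ident C (Dom C k)"])
    qed
    finally show ?thesis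
      using b by (auto simp: is_iso_def inverse_arrows_def Mor_def intro!: exI[of _ "Ident C (Cod C q)"])
  qed
  then show ?thesis
    using X by (simp add: quasi_iso_def)
qed

section \<open>Isomorphisms in the derived category\<close>

text \<open>
  Let the roof \<open>B \<leftarrow> B' \<rightarrow> A\<close> represent the inverse of an isomorphism from \<open>A\<close> to \<open>B\<close>. Composing the two
  gives the identity of \<open>A\<close>, and equality of roof classes means that after passing to some \<open>M\<close> the
  numerator of the composite roof, which factors through \<open>B'\<close>, becomes a quasi-isomorphism.
\<close>

lemma isomorphic_D_catE:
  assumes S: "S \<subseteq> complexes C" and iso: "isomorphic (D_cat C S) A B" and A: "A \<in> S"
  obtains M B' v w t g where "M \<in> S" "B' \<in> S" "quasi_iso C M A v" "chain_map C M B' w"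
    "chain_map C B' A g" "quasi_iso C B' B t" "homotopic C M A v (\<lambda>n. g n \<cdot> w n)"
proof -
  let ?K = "K_cat C S" and ?W = "qis C S" and ?D = "D_cat C S"
  have cpx: "is_cpx C X" if "X \<in> S" for X
    using that S by (auto simp: complexes_def)
  obtain \<phi> \<psi> where \<phi>: "\<phi> \<in> Mor ?D A B" and \<psi>: "\<psi> \<in> Mor ?D B A" and \<psi>\<phi>: "\<psi> \<cdot>\<^bsub>?D\<^esub> \<phi> = Ident ?D A"
    using iso by (auto simp: isomorphic_def is_iso_def inverse_arrows_def Mor_def)
  let ?e = "hclass C A A (\<lambda>n. Ident C (cobj A n))"
  have eMor: "?e \<in> Mor ?K A A"
    using A cpx by (auto simp: K_Mor intro: chain_map_ident)
  have e_comp: "?e \<cdot>\<^bsub>?K\<^esub> a = a" if a: "a \<in> Mor ?K X A" for a X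
  proof -
    obtain f where f: "X \<in> S" "chain_map C X A f" "a = hclass C X A f"
      using a by (auto simp: K_Mor split: if_splits)
    have "(\<lambda>n. Ident C (cobj A n) \<cdot> f n) = f"
      using chain_mapD[OF f(2)] by auto
    then show ?thesis
      using f A cpx by (simp add: K_comp_hclass chain_map_ident)
  qed
  have eW: "?e \<in> ?W"
    using A cpx quasi_iso_ident[of A] by (auto simp: qis_def)
  have e_eq: "Ident ?K A = ?e" "Dom ?K ?e = A" "Cod ?K ?e = A"
    using eMor by (auto simp: K_cat_def hclass_def)
  have eR: "is_roof ?K ?W A A (?e, ?e)"
    using eMor eW by (simp add: is_roof_def e_eq)
  have "roof_equiv ?K ?W (?e, ?e) (?e, ?e)"
    unfolding roof_equiv_def prod.case
    by (rule exI[of _ A], rule bexI[of _ ?e], rule bexI[of _ ?e]) 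
      (use eMor eW in \<open>auto simp: e_eq e_comp[OF eMor]\<close>)
  with eR have "(?e, ?e) \<in> snd (snd (Ident ?D A))"
    by (simp add: D_cat_def localization_def loc_map_def roof_class_def e_eq)
  then have mem: "(?e, ?e) \<in> snd (snd (loc_comp ?K ?W \<psi> \<phi>))"
    using \<psi>\<phi> by (simp add: D_cat_def localization_def)
  obtain \<Phi> where \<Phi>: "\<phi> = (A, B, \<Phi>)"
    using \<phi> by (cases \<phi>) (auto simp: Mor_def D_cat_def localization_def)
  obtain \<Psi> where \<Psi>: "\<psi> = (B, A, \<Psi>)" 
    using \<psi> by (cases \<psi>) (auto simp: Mor_def D_cat_def localization_def)
  have \<Psi>_roof: "is_roof ?K ?W B A r" if "r \<in> \<Psi>" for r
    using \<psi> that by (auto simp: \<Psi> Mor_def D_cat_def localization_def roof_class_def)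
  obtain s f t g A' t' f' where st: "(s, f) \<in> \<Phi>" "(t, g) \<in> \<Psi>" 
    "t' \<in> ?W \<inter> Mor ?K A' (Dom ?K f)" "f' \<in> Mor ?K A' (Dom ?K t)"
    "roof_equiv ?K ?W (s \<cdot>\<^bsub>?K\<^esub> t', g \<cdot>\<^bsub>?K\<^esub> f') (?e, ?e)"
    using mem unfolding \<Phi> \<Psi> loc_comp_def prod.case snd_conv by blast
  obtain M u v where uv: "u \<in> Mor ?K M (Dom ?K (s \<cdot>\<^bsub>?K\<^esub> t'))" "v \<in> Mor ?K M A"
    "(s \<cdot>\<^bsub>?K\<^esub> t') \<cdot>\<^bsub>?K\<^esub> u \<in> ?W" "(s \<cdot>\<^bsub>?K\<^esub> t') \<cdot>\<^bsub>?K\<^esub> u = ?e \<cdot>\<^bsub>?K\<^esub> v"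
    "(g \<cdot>\<^bsub>?K\<^esub> f') \<cdot>\<^bsub>?K\<^esub> u = ?e \<cdot>\<^bsub>?K\<^esub> v"
    using st(5) unfolding roof_equiv_def prod.case e_eq by blast
  have "Dom ?K (s \<cdot>\<^bsub>?K\<^esub> t') = A'"
    using st(3) by (auto simp: K_cat_def hclass_def Mor_def)
  then obtain u0 where u0: "M \<in> S" "A' \<in> S" "chain_map C M A' u0" "u = hclass C M A' u0"
    using uv(1) by (auto simp: K_Mor split: if_splits)
  have gt: "t \<in> ?W" "t \<in> Mor ?K (Dom ?K g) B" "g \<in> Mor ?K (Dom ?K g) A"
    using \<Psi>_roof[OF st(2)] by (auto simp: is_roof_def)
  define B' where "B' = Dom ?K g"
  obtain g0 where g0: "B' \<in> S" "chain_map C B' A g0" "g = hclass C B' A g0"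
    using gt(3) unfolding B'_def[symmetric] by (auto simp: K_Mor split: if_splits)
  obtain X Y t0 where t: "t = hclass C X Y t0" "quasi_iso C X Y t0"
    using gt(1) by (auto simp: qis_def)
  then have t0: "quasi_iso C B' B t0"
    using gt(2) unfolding B'_def[symmetric] by (simp add: Mor_def K_cat_def hclass_def)
  have "Dom ?K t = B'"
    using gt(2) by (simp add: Mor_def B'_def)
  then obtain f0 where f0: "chain_map C A' B' f0" "f' = hclass C A' B' f0"
    using st(4) by (auto simp: K_Mor split: if_splits)
  let ?w = "\<lambda>n. f0 n \<cdot> u0 n"
  have w: "chain_map C M B' ?w"
    using u0 f0 g0 cpx by (intro chain_map_comp[of M A' B']) auto
  have gw: "chain_map C M A (\<lambda>n. g0 n \<cdot> ?w n)"
    using w g0 u0 A cpx by (intro chain_map_comp[of M B' A]) auto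
  have "(g \<cdot>\<^bsub>?K\<^esub> f') \<cdot>\<^bsub>?K\<^esub> u = hclass C M A (\<lambda>n. (g0 n \<cdot> f0 n) \<cdot> u0 n)"
    using u0 f0 g0 A cpx by (simp add: K_comp_hclass chain_map_comp[of A' B' A])
  also have "(\<lambda>n. (g0 n \<cdot> f0 n) \<cdot> u0 n) = (\<lambda>n. g0 n \<cdot> ?w n)"
    using chain_mapD[OF u0(3)] chain_mapD[OF f0(1)] chain_mapD[OF g0(2)] by auto
  finally have v: "hclass C M A (\<lambda>n. g0 n \<cdot> ?w n) \<in> ?W"
    using uv by simp
  obtain v0 where v0: "quasi_iso C M A v0" "hclass C M A v0 = hclass C M A (\<lambda>n. g0 n \<cdot> ?w n)"
    using v by (auto simp: qis_def hclass_def)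
  have "homotopic C M A v0 (\<lambda>n. g0 n \<cdot> ?w n)"
    using v0 gw hclass_eq_iff[of M A v0] u0 A cpx by (auto simp: quasi_iso_def)
  then show ?thesis
    using that[OF u0(1) g0(1) v0(1) w g0(2) t0] by blast
qed

end

section \<open>Maps into injective objects\<close>

text \<open>
  Dependent choice indexed by the integers: up to \<open>N\<close> the sequence is prescribed, from there on each
  term is chosen to fit its predecessor.
\<close>

lemma int_sequence_choice:
  fixes N :: int
  assumes low: "\<And>n. n \<le> N \<Longrightarrow> P n (z n)" "\<And>n. n < N \<Longrightarrow> Q n (z n) (z (n + 1))"
    and step: "\<And>n x. \<lbrakk>n \<ge> N; P n x\<rbrakk> \<Longrightarrow> \<exists>y. P (n + 1) y \<and> Q n x y"
  shows "\<exists>f. \<forall>n. P n (f n) \<and> Q n (f n) (f (n + 1))"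
proof -
  let ?g = "rec_nat (z N) (\<lambda>m x. SOME y. P (N + int m + 1) y \<and> Q (N + int m) x y)"
  define g where "g = ?g"
  have gSuc: "g (Suc m) = (SOME y. P (N + int m + 1) y \<and> Q (N + int m) (g m) y)" for m
    by (simp add: g_def)
  have ex: "P (N + int m + 1) (g (Suc m)) \<and> Q (N + int m) (g m) (g (Suc m))" 
    if "P (N + int m) (g m)" for m
    unfolding gSuc by (rule someI_ex) (use step[of "N + int m" "g m"] that in simp)
  have P: "P (N + int m) (g m)" for m
  proof (induction m)
    case 0
    then show ?case using low(1)[of N] by (simp add: g_def)
  next
    case (Suc m)
    then show ?case using ex[of m] by (simp add: add_ac)
  qed
  define f where "f n = (if n < N then z n else g (nat (n - N)))" for n
  have "P n (f n) \<and> Q n (f n) (f (n + 1))" for n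
  proof -
    consider "n < N - 1" | "n = N - 1" | "n \<ge> N" by linarith
    then show ?thesis
    proof cases
      case 1
      then show ?thesis using low[of n] by (simp add: f_def)
    next
      case 2
      then show ?thesis using low[of n] by (simp add: f_def g_def)
    next
      case 3
      define m where "m = nat (n - N)"
      have m: "n = N + int m"
        using 3 by (simp add: m_def)
      have "f n = g m" "f (n + 1) = g (Suc m)"
        by (simp_all add: f_def m nat_add_distrib)
      then show ?thesis
        using P[of m] ex[of m] by (simp add: m)
    qed
  qed
  then show ?thesis by blast
qed

context preadditive_category
begin

lemma zero_obj_eqI:
  assumes "is_zero_obj C Z" "f \<in> Arr C" "g \<in> Arr C" "Dom C g = Dom C f" "Cod C f = Z" "Cod C g = Z"
  shows "f = g"
proof -
  have "\<exists>!f'. f' \<in> Mor C (Dom C f) Z"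
    using assms(1,2) by (simp add: is_zero_obj_def)
  then show ?thesis
    by (rule ex1_eq) (use assms in \<open>simp_all add: Mor_def\<close>)
qed

lemma is_monoI:
  assumes "m \<in> Arr C"
    and "\<And>g. \<lbrakk>g \<in> Arr C; Cod C g = Dom C m; m \<cdot> g = Zero C (Dom C g) (Cod C m)\<rbrakk>
      \<Longrightarrow> g = Zero C (Dom C g) (Dom C m)"
  shows "is_mono C m"
  unfolding is_mono_def
proof (intro conjI allI ballI impI assms(1))
  fix A g h assume gh: "g \<in> Mor C A (Dom C m)" "h \<in> Mor C A (Dom C m)" "m \<cdot> g = m \<cdot> h"
  then have D: "g \<in> Arr C" "Cod C g = Dom C m" "Dom C g = A" "h \<in> Arr C" "Cod C h = Dom C m" "Dom C h = A"
    by (auto simp: Mor_def)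
  have "m \<cdot> (g \<oplus> Neg C h) = Zero C A (Cod C m)"
    using gh(3) by (simp add: D assms(1))
  then have "g \<oplus> Neg C h = Zero C A (Dom C m)"
    using assms(2)[of "g \<oplus> Neg C h"] by (simp add: D)
  then show "g = h"
    by - (rule eq_if_diff_zero, simp_all add: D)
qed

lemma kernel_is_mono: "is_kernel C f k \<Longrightarrow> is_mono C k"
  using kernelD[of f k] unfolding is_mono_def
  by (auto simp: Mor_def intro: kernel_cancel[of f k])

end

context abelian_category
begin

sublocale kernel_cokernel_category
  by unfold_locales (fact ex_kernel ex_cokernel)+

text \<open>
  If \<open>m \<cdot> g = 0\<close> then \<open>m\<close> factors through the cokernel \<open>c\<close> of \<open>g\<close>. The epimorphism \<open>c \<cdot> q\<close> is the
  cokernel of some \<open>l\<close>, and \<open>l\<close> factors through \<open>k\<close> as \<open>d \<cdot> l = 0\<close>. So \<open>q\<close> kills \<open>l\<close> and factors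
  through \<open>c \<cdot> q\<close>, which splits \<open>c\<close> and forces \<open>g = 0\<close>.
\<close>

lemma coimage_map_is_mono:
  assumes k: "is_kernel C d k" and q: "is_cokernel C k q"
    and m: "m \<in> Arr C" "Dom C m = Cod C q" "d = m \<cdot> q"
  shows "is_mono C m"
proof (rule is_monoI)
  note kD = kernelD(1-3)[OF k] and qD = cokernelD(1-3)[OF q]
  have codm: "Cod C d = Cod C m"
    using m qD by simp
  fix g assume g: "g \<in> Arr C" "Cod C g = Dom C m" "m \<cdot> g = Zero C (Dom C g) (Cod C m)"
  obtain c where c: "is_cokernel C g c"
    using cokernel_exists g by blast
  note cD = cokernelD(1-3)[OF c]
  obtain m' where m': "m' \<in> Arr C" "Dom C m' = Cod C c" "Cod C m' = Cod C m" "m' \<cdot> c = m"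
    using cokernel_factor[OF c, of m] m g by auto
  note D = kD qD m(1,2) g(1,2) cD m'(1-3)
  have "is_epi C (c \<cdot> q)"
    unfolding is_epi_def
  proof (intro conjI allI ballI impI)
    show "c \<cdot> q \<in> Arr C"
      by (simp add: D)
    fix A u v assume uv: "u \<in> Mor C (Cod C (c \<cdot> q)) A" "v \<in> Mor C (Cod C (c \<cdot> q)) A"
      "u \<cdot> (c \<cdot> q) = v \<cdot> (c \<cdot> q)"
    then have uvD: "u \<in> Arr C" "v \<in> Arr C" "Dom C u = Cod C c" "Dom C v = Cod C c" "Cod C u = A" "Cod C v = A"
      by (auto simp: Mor_def D)
    have "(u \<cdot> c) \<cdot> q = (v \<cdot> c) \<cdot> q"
      using uv(3) by (simp add: D uvD)
    then have "u \<cdot> c = v \<cdot> c"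
      by - (rule cokernel_cancel[OF q], simp_all add: D uvD)
    then show "u = v"
      by - (rule cokernel_cancel[OF c], simp_all add: D uvD)
  qed
  then obtain l where l: "is_cokernel C l (c \<cdot> q)"
    using epi_cokernel by blast
  have lD: "l \<in> Arr C" "Cod C l = Dom C d"
    using cokernelD(1,3)[OF l] by (simp_all add: D)
  have "d \<cdot> l = m' \<cdot> ((c \<cdot> q) \<cdot> l)"
    unfolding m(3) m'(4)[symmetric] by (simp add: D lD)
  also have "\<dots> = Zero C (Dom C l) (Cod C d)"
    unfolding cokernelD(4)[OF l] codm by (simp add: D lD)
  finally have "\<exists>l'. l' \<in> Arr C \<and> Dom C l' = Dom C l \<and> Cod C l' = Dom C k \<and> k \<cdot> l' = l"
    by (intro kernel_factor[OF k]) (simp_all add: D lD)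
  then obtain l' where l': "l' \<in> Arr C" "Dom C l' = Dom C l" "Cod C l' = Dom C k" "k \<cdot> l' = l"
    by blast
  have "q \<cdot> l = (q \<cdot> k) \<cdot> l'"
    unfolding l'(4)[symmetric] by (simp add: D l'(1-3))
  also have "\<dots> = Zero C (Dom C l) (Cod C q)"
    unfolding cokernelD(4)[OF q] by (simp add: D l'(1-3))
  finally have "\<exists>r. r \<in> Arr C \<and> Dom C r = Cod C (c \<cdot> q) \<and> Cod C r = Cod C q \<and> r \<cdot> (c \<cdot> q) = q"
    by (intro cokernel_factor[OF l]) (simp_all add: D lD)
  then obtain r where r: "r \<in> Arr C" "Dom C r = Cod C c" "Cod C r = Cod C q" "r \<cdot> (c \<cdot> q) = q"
    by (auto simp: D)
  have "(r \<cdot> c) \<cdot> q = Ident C (Cod C q) \<cdot> q"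
    using r(4) by (simp add: D r(1-3))
  then have rc: "r \<cdot> c = Ident C (Cod C q)"
    by - (rule cokernel_cancel[OF q], simp_all add: D r(1-3))
  have "g = (r \<cdot> c) \<cdot> g"
    unfolding rc by (simp add: D)
  also have "\<dots> = r \<cdot> (c \<cdot> g)"
    by (simp add: D r(1-3))
  also have "\<dots> = Zero C (Dom C g) (Dom C m)"
    unfolding cokernelD(4)[OF c] by (simp add: D r(1-3))
  finally show "g = Zero C (Dom C g) (Dom C m)" .
qed (fact m)

text \<open>
  A map that vanishes on the kernel of \<open>d\<close> factors through the image of \<open>d\<close>, a subobject of the codomain,
  and extends to the codomain because \<open>J\<close> is injective.
\<close>

lemma injective_extension:
  assumes k: "is_kernel C d k" and J: "is_injective C J"
    and \<phi>: "\<phi> \<in> Arr C" "Dom C \<phi> = Dom C d" "Cod C \<phi> = J" "\<phi> \<cdot> k = Zero C (Dom C k) J"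
  shows "\<exists>\<chi>. \<chi> \<in> Arr C \<and> Dom C \<chi> = Cod C d \<and> Cod C \<chi> = J \<and> \<phi> = \<chi> \<cdot> d"
proof -
  note kD = kernelD[OF k]
  obtain q where q: "is_cokernel C k q"
    using cokernel_exists kD(2) by blast
  note qD = cokernelD(1-3)[OF q]
  obtain m where m: "m \<in> Arr C" "Dom C m = Cod C q" "Cod C m = Cod C d" "m \<cdot> q = d"
    using cokernel_factor[OF q, of d] kD by auto
  obtain \<phi>' where \<phi>': "\<phi>' \<in> Arr C" "Dom C \<phi>' = Cod C q" "Cod C \<phi>' = J" "\<phi>' \<cdot> q = \<phi>"
    using cokernel_factor[OF q, of \<phi>] kD \<phi> by auto
  have "is_mono C m"
    using m by (intro coimage_map_is_mono[OF k q]) auto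
  moreover have "\<phi>' \<in> Mor C (Dom C m) J"
    using \<phi>' m by (simp add: Mor_def)
  ultimately have "\<exists>\<chi> \<in> Mor C (Cod C m) J. \<chi> \<cdot> m = \<phi>'"
    using J unfolding is_injective_def by blast
  then obtain \<chi> where \<chi>: "\<chi> \<in> Mor C (Cod C m) J" "\<chi> \<cdot> m = \<phi>'"
    by blast
  then have \<chi>D: "\<chi> \<in> Arr C" "Dom C \<chi> = Cod C d" "Cod C \<chi> = J"
    using m(3) by (auto simp: Mor_def)
  have "\<phi> = (\<chi> \<cdot> m) \<cdot> q"
    using \<phi>'(4) \<chi>(2) by simp
  also have "\<dots> = \<chi> \<cdot> d"
    unfolding m(4)[symmetric] by (simp add: \<chi>D qD m(1-3))
  finally show ?thesis
    using \<chi>D by blast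
qed

section \<open>Quasi-isomorphisms and injective objects\<close>

context
  fixes X' X s J
  assumes X': "is_cpx C X'" and X: "is_cpx C X" and s: "quasi_iso C X' X s" and J: "is_injective C J"
begin

lemma s_chain: "chain_map C X' X s"
  using s by (simp add: quasi_iso_def)

lemmas qisD = cpxD(1-4)[OF X'] cpxD(1-4)[OF X] chain_mapD(1-3)[OF s_chain]

text \<open>
  As \<open>J\<close> is injective, a cocycle \<open>\<phi>\<close> of \<open>Hom(X, J)\<close> is a coboundary if and only if the map that it
  induces from the cohomology of \<open>X\<close> to \<open>J\<close> vanishes.
\<close>

lemma quasi_iso_hom_injective:
  assumes \<phi>: "\<phi> \<in> Arr C" "Dom C \<phi> = cobj X n" "Cod C \<phi> = J"
      "\<phi> \<cdot> cdif X (n - 1) = Zero C (cobj X (n - 1)) J"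
    and \<psi>: "\<psi> \<in> Arr C" "Dom C \<psi> = cobj X' (n + 1)" "Cod C \<psi> = J" "\<phi> \<cdot> s n = \<psi> \<cdot> cdif X' n"
  shows "\<exists>\<chi>. \<chi> \<in> Arr C \<and> Dom C \<chi> = cobj X (n + 1) \<and> Cod C \<chi> = J \<and> \<phi> = \<chi> \<cdot> cdif X n"
proof -
  obtain k' q' k q z h where H: "is_cohomology C n X' (k', q')" "is_cohomology C n X (k, q)"
    "z \<in> Arr C" "Dom C z = Dom C k'" "Cod C z = Dom C k" "k \<cdot> z = s n \<cdot> k'"
    "h \<in> Arr C" "Dom C h = Cod C q'" "Cod C h = Cod C q" "h \<cdot> q' = q \<cdot> z" "is_iso C h"
    by (rule quasi_isoE[OF X' X s, of n]) (rule that)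
  obtain b' where b': "is_kernel C (cdif X' n) k'" "is_cokernel C b' q'" "k' \<cdot> b' = cdif X' (n - 1)"
    "k' \<in> Arr C" "Cod C k' = cobj X' n" "b' \<in> Arr C" "Dom C b' = cobj X' (n - 1)" "Cod C b' = Dom C k'"
    "q' \<in> Arr C" "Dom C q' = Dom C k'" "cdif X' n \<cdot> k' = Zero C (Dom C k') (cobj X' (n + 1))"
    by (rule cohomologyE[OF X' H(1)]) (rule that)
  obtain b where b: "is_kernel C (cdif X n) k" "is_cokernel C b q" "k \<cdot> b = cdif X (n - 1)"
    "k \<in> Arr C" "Cod C k = cobj X n" "b \<in> Arr C" "Dom C b = cobj X (n - 1)" "Cod C b = Dom C k"
    "q \<in> Arr C" "Dom C q = Dom C k"
    by (rule cohomologyE[OF X H(2)]) (rule that)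
  have "J \<in> Obj C"
    using J by (simp add: is_injective_def)
  note D = qisD \<phi>(1-3) \<psi>(1-3) H(3-5,7-9) b'(4-10) b(4-10) this
  obtain h' where h': "inverse_arrows C h h'"
    using H(11) by (auto simp: is_iso_def)
  have h'D: "h' \<in> Arr C" "Dom C h' = Cod C q" "Cod C h' = Cod C q'" and hh': "h \<cdot> h' = Ident C (Cod C q)"
    using h' by (auto simp: inverse_arrows_def Mor_def D)
  have "(\<phi> \<cdot> k) \<cdot> b = Zero C (cobj X (n - 1)) J"
    using b(3) \<phi>(4) by (simp add: D)
  then have "\<exists>\<rho>. \<rho> \<in> Arr C \<and> Dom C \<rho> = Cod C q \<and> Cod C \<rho> = J \<and> \<rho> \<cdot> q = \<phi> \<cdot> k"
    using cokernel_factor[OF b(2), of "\<phi> \<cdot> k"] by (simp add: D)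
  then obtain \<rho> where \<rho>: "\<rho> \<in> Arr C" "Dom C \<rho> = Cod C q" "Cod C \<rho> = J" "\<rho> \<cdot> q = \<phi> \<cdot> k"
    by blast
  have "(\<rho> \<cdot> h) \<cdot> q' = (\<rho> \<cdot> q) \<cdot> z"
    using H(10) by (simp add: D \<rho>(1-3))
  also have "\<dots> = (\<phi> \<cdot> s n) \<cdot> k'"
    unfolding \<rho>(4) using H(6) by (simp add: D)
  also have "\<dots> = Zero C (Cod C q') J \<cdot> q'"
    unfolding \<psi>(4) using b'(11) by (simp add: D)
  finally have "\<rho> \<cdot> h = Zero C (Cod C q') J"
    by - (rule cokernel_cancel[OF b'(2)], simp_all add: D \<rho>(1-3))
  then have "(\<rho> \<cdot> h) \<cdot> h' = Zero C (Cod C q) J"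
    by (simp add: D h'D)
  then have "\<rho> = Zero C (Cod C q) J"
    using hh' by (simp add: D \<rho>(1-3) h'D)
  then have "\<phi> \<cdot> k = Zero C (Dom C k) J"
    using \<rho>(4) by (simp add: D)
  then show ?thesis
    using injective_extension[OF b(1) J, of \<phi>] by (simp add: D)
qed

text \<open>
  The cocycle \<open>\<psi>\<close> induces a map from the cohomology of \<open>X'\<close> to \<open>J\<close>. Through the inverse of \<open>H(s)\<close> it
  becomes a map on the cohomology of \<open>X\<close>, and injectivity of \<open>J\<close> extends the latter from the cocycles to
  \<open>\<phi>\<close>. Then \<open>\<psi>\<close> and \<open>\<phi> \<cdot> s\<close> agree on cocycles, so they differ by a map that factors through the
  differential.
\<close>

lemma quasi_iso_hom_surjective:
  assumes \<psi>: "\<psi> \<in> Arr C" "Dom C \<psi> = cobj X' n" "Cod C \<psi> = J"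
      "\<psi> \<cdot> cdif X' (n - 1) = Zero C (cobj X' (n - 1)) J"
  shows "\<exists>\<phi> \<chi>. \<phi> \<in> Arr C \<and> Dom C \<phi> = cobj X n \<and> Cod C \<phi> = J \<and>
    \<phi> \<cdot> cdif X (n - 1) = Zero C (cobj X (n - 1)) J \<and>
    \<chi> \<in> Arr C \<and> Dom C \<chi> = cobj X' (n + 1) \<and> Cod C \<chi> = J \<and> \<psi> = \<phi> \<cdot> s n \<oplus> \<chi> \<cdot> cdif X' n"
proof -
  obtain k' q' k q z h where H: "is_cohomology C n X' (k', q')" "is_cohomology C n X (k, q)"
    "z \<in> Arr C" "Dom C z = Dom C k'" "Cod C z = Dom C k" "k \<cdot> z = s n \<cdot> k'"
    "h \<in> Arr C" "Dom C h = Cod C q'" "Cod C h = Cod C q" "h \<cdot> q' = q \<cdot> z" "is_iso C h"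
    by (rule quasi_isoE[OF X' X s, of n]) (rule that)
  obtain b' where b': "is_kernel C (cdif X' n) k'" "is_cokernel C b' q'" "k' \<cdot> b' = cdif X' (n - 1)"
    "k' \<in> Arr C" "Cod C k' = cobj X' n" "b' \<in> Arr C" "Dom C b' = cobj X' (n - 1)" "Cod C b' = Dom C k'"
    "q' \<in> Arr C" "Dom C q' = Dom C k'" "cdif X' n \<cdot> k' = Zero C (Dom C k') (cobj X' (n + 1))"
    by (rule cohomologyE[OF X' H(1)]) (rule that)
  obtain b where b: "is_kernel C (cdif X n) k" "is_cokernel C b q" "k \<cdot> b = cdif X (n - 1)"
    "k \<in> Arr C" "Cod C k = cobj X n" "b \<in> Arr C" "Dom C b = cobj X (n - 1)" "Cod C b = Dom C k"
    "q \<in> Arr C" "Dom C q = Dom C k" "cdif X n \<cdot> k = Zero C (Dom C k) (cobj X (n + 1))"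
    "q \<cdot> b = Zero C (cobj X (n - 1)) (Cod C q)"
    by (rule cohomologyE[OF X H(2)]) (rule that)
  have "J \<in> Obj C"
    using J by (simp add: is_injective_def)
  note D = qisD \<psi>(1-3) H(3-5,7-9) b'(4-10) b(4-10) this
  obtain h' where h': "inverse_arrows C h h'"
    using H(11) by (auto simp: is_iso_def)
  have h'D: "h' \<in> Arr C" "Dom C h' = Cod C q" "Cod C h' = Cod C q'" and hh': "h' \<cdot> h = Ident C (Cod C q')"
    using h' by (auto simp: inverse_arrows_def Mor_def D)
  have "(\<psi> \<cdot> k') \<cdot> b' = Zero C (cobj X' (n - 1)) J"
    using b'(3) \<psi>(4) by (simp add: D)
  then have "\<exists>\<rho>. \<rho> \<in> Arr C \<and> Dom C \<rho> = Cod C q' \<and> Cod C \<rho> = J \<and> \<rho> \<cdot> q' = \<psi> \<cdot> k'"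
    using cokernel_factor[OF b'(2), of "\<psi> \<cdot> k'"] by (simp add: D)
  then obtain \<rho> where \<rho>: "\<rho> \<in> Arr C" "Dom C \<rho> = Cod C q'" "Cod C \<rho> = J" "\<rho> \<cdot> q' = \<psi> \<cdot> k'"
    by blast
  have "is_mono C k"
    using b(1) by (rule kernel_is_mono)
  moreover have "\<rho> \<cdot> (h' \<cdot> q) \<in> Mor C (Dom C k) J"
    by (simp add: Mor_def D \<rho>(1-3) h'D)
  ultimately have "\<exists>\<phi> \<in> Mor C (Cod C k) J. \<phi> \<cdot> k = \<rho> \<cdot> (h' \<cdot> q)"
    using J unfolding is_injective_def by blast
  then obtain \<phi> where \<phi>: "\<phi> \<in> Arr C" "Dom C \<phi> = cobj X n" "Cod C \<phi> = J" "\<phi> \<cdot> k = \<rho> \<cdot> (h' \<cdot> q)"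
    by (auto simp: Mor_def D)
  have "\<phi> \<cdot> cdif X (n - 1) = (\<phi> \<cdot> k) \<cdot> b"
    unfolding b(3)[symmetric] by (simp add: D \<phi>(1-3))
  also have "\<dots> = Zero C (cobj X (n - 1)) J"
    unfolding \<phi>(4) using b(12) by (simp add: D \<rho>(1-3) h'D)
  finally have \<phi>d: "\<phi> \<cdot> cdif X (n - 1) = Zero C (cobj X (n - 1)) J" .
  have "(\<phi> \<cdot> s n) \<cdot> k' = (\<phi> \<cdot> k) \<cdot> z"
    using H(6) by (simp add: D \<phi>(1-3))
  also have "\<dots> = \<rho> \<cdot> ((h' \<cdot> h) \<cdot> q')"
    unfolding \<phi>(4) using H(10) by (simp add: D \<rho>(1-3) h'D)
  also have "\<dots> = \<psi> \<cdot> k'"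
    unfolding hh' using \<rho>(4) by (simp add: D)
  finally have "(\<phi> \<cdot> s n) \<cdot> k' = \<psi> \<cdot> k'" .
  then have "(\<psi> \<oplus> Neg C (\<phi> \<cdot> s n)) \<cdot> k' = Zero C (Dom C k') J"
    by (simp add: D \<phi>(1-3))
  then have "\<exists>\<chi>. \<chi> \<in> Arr C \<and> Dom C \<chi> = cobj X' (n + 1) \<and> Cod C \<chi> = J \<and>
      \<psi> \<oplus> Neg C (\<phi> \<cdot> s n) = \<chi> \<cdot> cdif X' n"
    using injective_extension[OF b'(1) J, of "\<psi> \<oplus> Neg C (\<phi> \<cdot> s n)"] by (simp add: D \<phi>(1-3))
  then obtain \<chi> where \<chi>: "\<chi> \<in> Arr C" "Dom C \<chi> = cobj X' (n + 1)" "Cod C \<chi> = J"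
      "\<psi> \<oplus> Neg C (\<phi> \<cdot> s n) = \<chi> \<cdot> cdif X' n"
    by blast
  have "\<phi> \<cdot> s n \<oplus> \<chi> \<cdot> cdif X' n = \<psi>"
    unfolding \<chi>(4)[symmetric] by (simp add: D \<phi>(1-3) add_left_commute[of _ \<psi>])
  then show ?thesis
    using \<phi>(1-3) \<phi>d \<chi>(1-3) by metis
qed

text \<open>
  The pairs \<open>(\<phi>, \<psi>)\<close> are the maps from the mapping cone of \<open>s\<close> to \<open>J\<close>, and the statement says that the
  complex which they form is exact. By injectivity on cohomology \<open>\<phi> = \<chi> \<cdot> d\<close> for some \<open>\<chi>\<close>; then
  \<open>\<psi> - \<chi> \<cdot> s\<close> is a cocycle, and surjectivity on cohomology decomposes it.
\<close>

lemma quasi_iso_cone_exact: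
  assumes \<phi>: "\<phi> \<in> Arr C" "Dom C \<phi> = cobj X n" "Cod C \<phi> = J"
      "\<phi> \<cdot> cdif X (n - 1) = Zero C (cobj X (n - 1)) J"
    and \<psi>: "\<psi> \<in> Arr C" "Dom C \<psi> = cobj X' (n + 1)" "Cod C \<psi> = J" "\<phi> \<cdot> s n = \<psi> \<cdot> cdif X' n"
  shows "\<exists>\<phi>' \<psi>'. \<phi>' \<in> Arr C \<and> Dom C \<phi>' = cobj X (n + 1) \<and> Cod C \<phi>' = J \<and>
    \<psi>' \<in> Arr C \<and> Dom C \<psi>' = cobj X' (n + 2) \<and> Cod C \<psi>' = J \<and>
    \<phi> = \<phi>' \<cdot> cdif X n \<and> \<psi> = \<phi>' \<cdot> s (n + 1) \<oplus> \<psi>' \<cdot> cdif X' (n + 1)"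
proof -
  have n2: "n + 1 + 1 = n + 2" for n :: int
    by simp
  obtain \<chi> where \<chi>: "\<chi> \<in> Arr C" "Dom C \<chi> = cobj X (n + 1)" "Cod C \<chi> = J" "\<phi> = \<chi> \<cdot> cdif X n"
    using quasi_iso_hom_injective[OF \<phi> \<psi>] by blast
  note D = qisD \<phi>(1-3) \<psi>(1-3) \<chi>(1-3)
  have "(\<chi> \<cdot> s (n + 1)) \<cdot> cdif X' n = (\<chi> \<cdot> cdif X n) \<cdot> s n"
    using chain_mapD(4)[OF s_chain, of n] by (simp add: D)
  also have "\<dots> = \<psi> \<cdot> cdif X' n"
    using \<psi>(4) \<chi>(4) by simp
  finally have "(\<psi> \<oplus> Neg C (\<chi> \<cdot> s (n + 1))) \<cdot> cdif X' n = Zero C (cobj X' n) J"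
    by (simp add: D)
  then have "\<exists>\<phi>2 \<chi>2. \<phi>2 \<in> Arr C \<and> Dom C \<phi>2 = cobj X (n + 1) \<and> Cod C \<phi>2 = J \<and>
    \<phi>2 \<cdot> cdif X n = Zero C (cobj X n) J \<and>
    \<chi>2 \<in> Arr C \<and> Dom C \<chi>2 = cobj X' (n + 2) \<and> Cod C \<chi>2 = J \<and>
    \<psi> \<oplus> Neg C (\<chi> \<cdot> s (n + 1)) = \<phi>2 \<cdot> s (n + 1) \<oplus> \<chi>2 \<cdot> cdif X' (n + 1)"
    using quasi_iso_hom_surjective[of "\<psi> \<oplus> Neg C (\<chi> \<cdot> s (n + 1))" "n + 1"] by (simp add: D n2)
  then obtain \<phi>2 \<chi>2 where P: "\<phi>2 \<in> Arr C" "Dom C \<phi>2 = cobj X (n + 1)" "Cod C \<phi>2 = J"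
    "\<phi>2 \<cdot> cdif X n = Zero C (cobj X n) J"
    "\<chi>2 \<in> Arr C" "Dom C \<chi>2 = cobj X' (n + 2)" "Cod C \<chi>2 = J"
    "\<psi> \<oplus> Neg C (\<chi> \<cdot> s (n + 1)) = \<phi>2 \<cdot> s (n + 1) \<oplus> \<chi>2 \<cdot> cdif X' (n + 1)"
    by blast
  have "\<phi> = (\<chi> \<oplus> \<phi>2) \<cdot> cdif X n"
    using P(4) \<chi>(4) by (simp add: D P(1-3))
  moreover have "\<psi> = \<chi> \<cdot> s (n + 1) \<oplus> (\<psi> \<oplus> Neg C (\<chi> \<cdot> s (n + 1)))"
    by (simp add: D add_left_commute[of _ \<psi>])
  then have "\<psi> = (\<chi> \<oplus> \<phi>2) \<cdot> s (n + 1) \<oplus> \<chi>2 \<cdot> cdif X' (n + 1)"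
    unfolding P(8) by (simp add: D P(1-3,5-7) add_assoc n2)
  moreover have "\<chi> \<oplus> \<phi>2 \<in> Arr C" "Dom C (\<chi> \<oplus> \<phi>2) = cobj X (n + 1)" "Cod C (\<chi> \<oplus> \<phi>2) = J"
    by (simp_all add: D P)
  ultimately show ?thesis
    using P(5-7) by metis
qed

end

end

section \<open>Maps into bounded below complexes of injectives\<close>

definition bounded_injective_cpx :: "('o, 'm, 'z) addcat_scheme \<Rightarrow> ('o, 'm) cpx \<Rightarrow> bool" where
  "bounded_injective_cpx C T \<longleftrightarrow> is_cpx C T \<and> (\<forall>n. is_injective C (cobj T n)) \<and>
     (\<exists>N. \<forall>n < N. is_zero_obj C (cobj T n))"

definition null_homotopic ::
    "('o, 'm, 'z) addcat_scheme \<Rightarrow> ('o, 'm) cpx \<Rightarrow> ('o, 'm) cpx \<Rightarrow> (int \<Rightarrow> 'm) \<Rightarrow> bool" where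
  "null_homotopic C X Y f \<longleftrightarrow> (\<exists>h. \<forall>n. h n \<in> Mor C (cobj X n) (cobj Y (n - 1)) \<and>
     f n = (cdif Y (n - 1) \<cdot>\<^bsub>C\<^esub> h n) \<oplus>\<^bsub>C\<^esub> (h (n + 1) \<cdot>\<^bsub>C\<^esub> cdif X n))"

text \<open>
  Vanishing of the group of homotopy classes of maps from \<open>X\<close> to \<open>T\<close>.
\<close>

definition no_maps_into ::
    "('o, 'm, 'z) addcat_scheme \<Rightarrow> ('o, 'm) cpx \<Rightarrow> ('o, 'm) cpx \<Rightarrow> bool" where
  "no_maps_into C T X \<longleftrightarrow> (\<forall>x. chain_map C X T x \<longrightarrow> null_homotopic C X T x)"

context preadditive_category
begin

lemma null_homotopicE:
  assumes "null_homotopic C X Y f"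
  obtains h where "\<And>n. h n \<in> Arr C" "\<And>n. Dom C (h n) = cobj X n"
    "\<And>n. Cod C (h n) = cobj Y (n - 1)"
    "\<And>n. f n = cdif Y (n - 1) \<cdot> h n \<oplus> h (n + 1) \<cdot> cdif X n"
  using assms unfolding null_homotopic_def Mor_def by blast

lemma null_homotopicI:
  assumes "\<And>n. h n \<in> Arr C" "\<And>n. Dom C (h n) = cobj X n"
    "\<And>n. Cod C (h n) = cobj Y (n - 1)"
    "\<And>n. f n = cdif Y (n - 1) \<cdot> h n \<oplus> h (n + 1) \<cdot> cdif X n"
  shows "null_homotopic C X Y f"
  using assms unfolding null_homotopic_def Mor_def by blast

lemma null_homotopic_iff:
  assumes X: "is_cpx C X" and Y: "is_cpx C Y"
  shows "null_homotopic C X Y f \<longleftrightarrow> homotopic C X Y f (\<lambda>n. Zero C (cobj X n) (cobj Y n))"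
proof
  assume "null_homotopic C X Y f"
  then obtain h where h: "\<And>n. h n \<in> Arr C" "\<And>n. Dom C (h n) = cobj X n"
    "\<And>n. Cod C (h n) = cobj Y (n - 1)" "\<And>n. f n = cdif Y (n - 1) \<cdot> h n \<oplus> h (n + 1) \<cdot> cdif X n"
    by (rule null_homotopicE) (rule that)
  show "homotopic C X Y f (\<lambda>n. Zero C (cobj X n) (cobj Y n))"
    by (rule homotopicI[where h = h]) (simp_all add: h cpxD(1-4)[OF X] cpxD(1-4)[OF Y])
next
  assume "homotopic C X Y f (\<lambda>n. Zero C (cobj X n) (cobj Y n))"
  then obtain h where h: "\<And>n. h n \<in> Arr C" "\<And>n. Dom C (h n) = cobj X n"
    "\<And>n. Cod C (h n) = cobj Y (n - 1)"
    "\<And>n. f n = Zero C (cobj X n) (cobj Y n) \<oplus> (cdif Y (n - 1) \<cdot> h n \<oplus> h (n + 1) \<cdot> cdif X n)"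
    by (rule homotopicE) (rule that)
  show "null_homotopic C X Y f"
    by (rule null_homotopicI[where h = h]) (simp_all add: h cpxD(1-4)[OF X] cpxD(1-4)[OF Y])
qed

lemma chain_map_zero:
  assumes "is_cpx C X" "is_cpx C Y"
  shows "chain_map C X Y (\<lambda>n. Zero C (cobj X n) (cobj Y n))"
  using cpxD(1-4)[OF assms(1)] cpxD(1-4)[OF assms(2)] by (simp add: chain_map_def Mor_def)

lemma null_homotopic_cong:
  assumes "is_cpx C X" "is_cpx C Y" "chain_map C X Y f" "chain_map C X Y g"
    "homotopic C X Y f g" "null_homotopic C X Y g"
  shows "null_homotopic C X Y f"
  using homotopic_trans[OF assms(1-4) chain_map_zero[OF assms(1,2)] assms(5)] assms(6)
  unfolding null_homotopic_iff[OF assms(1,2)] .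

lemma null_homotopic_comp:
  assumes "is_cpx C X" "is_cpx C Y" "is_cpx C Z" "chain_map C X Y f" "null_homotopic C Y Z g"
  shows "null_homotopic C X Z (\<lambda>n. g n \<cdot> f n)"
proof -
  obtain h where h: "\<And>n. h n \<in> Arr C" "\<And>n. Dom C (h n) = cobj Y n"
    "\<And>n. Cod C (h n) = cobj Z (n - 1)"
    "\<And>n. g n = cdif Z (n - 1) \<cdot> h n \<oplus> h (n + 1) \<cdot> cdif Y n"
    by (rule null_homotopicE[OF assms(5)]) (rule that)
  note D = cpxD(1-4)[OF assms(1)] cpxD(1-4)[OF assms(2)] cpxD(1-4)[OF assms(3)] 
    chain_mapD[OF assms(4)] h(1-3)
  show ?thesis
    by (rule null_homotopicI[where h = "\<lambda>n. h n \<cdot> f n"]) (simp_all add: D h(4))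
qed

end

context abelian_category
begin

text \<open>
  The pair \<open>(\<alpha>, \<beta>)\<close> is a chain map from the mapping cone of \<open>s\<close> to \<open>T\<close>, and \<open>(\<gamma>, \<delta>)\<close> is a homotopy
  from it to zero. The homotopy is constructed by induction on the degree, beginning where \<open>T\<close> is
  still zero: exactness of maps from the cone to the next term of \<open>T\<close> gives its next component.
\<close>

lemma cone_map_null_homotopic:
  assumes X': "is_cpx C X'" and X: "is_cpx C X" and s: "quasi_iso C X' X s"
    and T: "bounded_injective_cpx C T"
    and \<beta>: "chain_map C X T \<beta>"
    and \<alpha>: "\<And>n. \<alpha> n \<in> Arr C" "\<And>n. Dom C (\<alpha> n) = cobj X' n" "\<And>n. Cod C (\<alpha> n) = cobj T (n - 1)"
      "\<And>n. \<beta> n \<cdot> s n = cdif T (n - 1) \<cdot> \<alpha> n \<oplus> \<alpha> (n + 1) \<cdot> cdif X' n"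
  obtains \<delta> \<gamma> where "\<And>n. \<delta> n \<in> Arr C" "\<And>n. Dom C (\<delta> n) = cobj X n" "\<And>n. Cod C (\<delta> n) = cobj T (n - 1)"
    "\<And>n. \<gamma> n \<in> Arr C" "\<And>n. Dom C (\<gamma> n) = cobj X' n" "\<And>n. Cod C (\<gamma> n) = cobj T (n - 2)"
    "\<And>n. \<beta> n = cdif T (n - 1) \<cdot> \<delta> n \<oplus> \<delta> (n + 1) \<cdot> cdif X n"
    "\<And>n. \<alpha> n \<oplus> cdif T (n - 2) \<cdot> \<gamma> n = \<delta> n \<cdot> s n \<oplus> \<gamma> (n + 1) \<cdot> cdif X' n"
proof -
  have Tc: "is_cpx C T" and Tinj: "\<And>n. is_injective C (cobj T n)"
    using T by (auto simp: bounded_injective_cpx_def)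
  obtain N where N: "\<And>n. n < N \<Longrightarrow> is_zero_obj C (cobj T n)"
    using T by (auto simp: bounded_injective_cpx_def)
  have sc: "chain_map C X' X s"
    using s by (simp add: quasi_iso_def)
  have two: "n + 1 + 1 = n + 2" "n - 1 + 1 = n" "n + 1 - 1 = n" "n + 2 - 1 = n + 1" 
    "n + 1 - 2 = n - 1" "n + 2 - 2 = n" for n :: int
    by simp_all
  note D = cpxD(1-4)[OF X'] cpxD(1-4)[OF X] cpxD(1-4)[OF Tc] chain_mapD(1-3)[OF sc]
    chain_mapD(1-3)[OF \<beta>] \<alpha>(1-3)
  \<comment> \<open>The state in degree \<open>n\<close> consists of \<open>\<delta> n\<close> and \<open>\<gamma> (n + 1)\<close>; it can be continued if the remaining
    part of the cone map is a cocycle.\<close>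
  define typed where "typed n = (\<lambda>(\<delta>, \<gamma>). \<delta> \<in> Arr C \<and> Dom C \<delta> = cobj X n \<and> Cod C \<delta> = cobj T (n - 1) \<and>
    \<gamma> \<in> Arr C \<and> Dom C \<gamma> = cobj X' (n + 1) \<and> Cod C \<gamma> = cobj T (n - 1))" for n
  define P where "P n = (\<lambda>(\<delta>, \<gamma>). typed n (\<delta>, \<gamma>) \<and>
    (\<beta> n \<oplus> Neg C (cdif T (n - 1) \<cdot> \<delta>)) \<cdot> cdif X (n - 1) = Zero C (cobj X (n - 1)) (cobj T n) \<and>
    (\<beta> n \<oplus> Neg C (cdif T (n - 1) \<cdot> \<delta>)) \<cdot> s n = (\<alpha> (n + 1) \<oplus> cdif T (n - 1) \<cdot> \<gamma>) \<cdot> cdif X' n)" for n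
  define Q where "Q n = (\<lambda>(\<delta>, \<gamma>) (\<delta>', \<gamma>').
    \<beta> n = cdif T (n - 1) \<cdot> \<delta> \<oplus> \<delta>' \<cdot> cdif X n \<and>
    \<alpha> (n + 1) \<oplus> cdif T (n - 1) \<cdot> \<gamma> = \<delta>' \<cdot> s (n + 1) \<oplus> \<gamma>' \<cdot> cdif X' (n + 1))" for n
  let ?z = "\<lambda>n. (Zero C (cobj X n) (cobj T (n - 1)), Zero C (cobj X' (n + 1)) (cobj T (n - 1)))"
  have z_typed: "typed n (?z n)" for n
    by (simp add: typed_def D)
  have "\<exists>f. \<forall>n. P n (f n) \<and> Q n (f n) (f (n + 1))"
  proof (rule int_sequence_choice[where z = ?z and N = "N - 1"])
    fix n :: int assume n: "n \<le> N - 1"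
    then have "is_zero_obj C (cobj T n)"
      using N by simp
    note z = zero_obj_eqI[OF this]
    show "P n (?z n)"
      unfolding P_def prod.case 
    proof (intro conjI z_typed)
      show "(\<beta> n \<oplus> Neg C (cdif T (n - 1) \<cdot> Zero C (cobj X n) (cobj T (n - 1)))) \<cdot> cdif X (n - 1) =
        Zero C (cobj X (n - 1)) (cobj T n)"
        by (rule z) (simp_all add: D)
      show "(\<beta> n \<oplus> Neg C (cdif T (n - 1) \<cdot> Zero C (cobj X n) (cobj T (n - 1)))) \<cdot> s n =
        (\<alpha> (n + 1) \<oplus> cdif T (n - 1) \<cdot> Zero C (cobj X' (n + 1)) (cobj T (n - 1))) \<cdot> cdif X' n"
        by (rule z) (simp_all add: D)
    qed
  next
    fix n :: int assume n: "n < N - 1"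
    then have "is_zero_obj C (cobj T n)"
      using N by simp
    note z = zero_obj_eqI[OF this]
    show "Q n (?z n) (?z (n + 1))"
      unfolding Q_def prod.case
    proof (intro conjI)
      show "\<beta> n = cdif T (n - 1) \<cdot> Zero C (cobj X n) (cobj T (n - 1)) \<oplus>
        Zero C (cobj X (n + 1)) (cobj T (n + 1 - 1)) \<cdot> cdif X n"
        by (rule z) (simp_all add: D)
      show "\<alpha> (n + 1) \<oplus> cdif T (n - 1) \<cdot> Zero C (cobj X' (n + 1)) (cobj T (n - 1)) =
        Zero C (cobj X (n + 1)) (cobj T (n + 1 - 1)) \<cdot> s (n + 1) \<oplus>
        Zero C (cobj X' (n + 1 + 1)) (cobj T (n + 1 - 1)) \<cdot> cdif X' (n + 1)"
        by (rule z) (simp_all add: D)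
    qed
  next
    fix n :: int and x assume Px: "P n x"
    obtain \<delta> \<gamma> where x: "x = (\<delta>, \<gamma>)"
      by (cases x)
    have G: "\<delta> \<in> Arr C" "Dom C \<delta> = cobj X n" "Cod C \<delta> = cobj T (n - 1)"
      "\<gamma> \<in> Arr C" "Dom C \<gamma> = cobj X' (n + 1)" "Cod C \<gamma> = cobj T (n - 1)"
      using Px by (auto simp: P_def x typed_def)
    let ?\<phi> = "\<beta> n \<oplus> Neg C (cdif T (n - 1) \<cdot> \<delta>)" and ?\<psi> = "\<alpha> (n + 1) \<oplus> cdif T (n - 1) \<cdot> \<gamma>"
    have "?\<phi> \<cdot> cdif X (n - 1) = Zero C (cobj X (n - 1)) (cobj T n)" "?\<phi> \<cdot> s n = ?\<psi> \<cdot> cdif X' n"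
      using Px by (auto simp: P_def x)
    from quasi_iso_cone_exact[OF X' X s Tinj _ _ _ this(1) _ _ _ this(2)]
    have "\<exists>\<phi>' \<psi>'. \<phi>' \<in> Arr C \<and> Dom C \<phi>' = cobj X (n + 1) \<and> Cod C \<phi>' = cobj T n \<and>
      \<psi>' \<in> Arr C \<and> Dom C \<psi>' = cobj X' (n + 2) \<and> Cod C \<psi>' = cobj T n \<and>
      ?\<phi> = \<phi>' \<cdot> cdif X n \<and> ?\<psi> = \<phi>' \<cdot> s (n + 1) \<oplus> \<psi>' \<cdot> cdif X' (n + 1)"
      by (simp add: D G)
    then obtain \<delta>' \<gamma>' where G': "\<delta>' \<in> Arr C" "Dom C \<delta>' = cobj X (n + 1)" "Cod C \<delta>' = cobj T n"
      "\<gamma>' \<in> Arr C" "Dom C \<gamma>' = cobj X' (n + 2)" "Cod C \<gamma>' = cobj T n"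
      and \<phi>: "?\<phi> = \<delta>' \<cdot> cdif X n" and \<psi>: "?\<psi> = \<delta>' \<cdot> s (n + 1) \<oplus> \<gamma>' \<cdot> cdif X' (n + 1)"
      by blast
    have \<beta>n: "cdif T (n - 1) \<cdot> \<delta> \<oplus> \<delta>' \<cdot> cdif X n = \<beta> n"
      unfolding \<phi>[symmetric] by (simp add: D G add_left_commute[of _ "\<beta> n"])
    have dd: "cdif T n \<cdot> (cdif T (n - 1) \<cdot> f) = Zero C (Dom C f) (cobj T (n + 1))"
      if "f \<in> Arr C" "Cod C f = cobj T (n - 1)" for f
      using cdif_cdif[OF Tc that, of n] by (simp add: add.commute)
    have "\<beta> (n + 1) \<cdot> cdif X n = cdif T n \<cdot> \<beta> n"
      using chain_mapD(4)[OF \<beta>, of n] by simp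
    also have "\<dots> = cdif T n \<cdot> (\<delta>' \<cdot> cdif X n)"
      unfolding \<beta>n[symmetric] by (simp add: D G G' dd)
    finally have P1: "(\<beta> (n + 1) \<oplus> Neg C (cdif T n \<cdot> \<delta>')) \<cdot> cdif X n = Zero C (cobj X n) (cobj T (n + 1))"
      by (simp add: D G')
    have "cdif T n \<cdot> (\<gamma>' \<cdot> cdif X' (n + 1)) \<oplus> cdif T n \<cdot> (\<delta>' \<cdot> s (n + 1)) = cdif T n \<cdot> ?\<psi>"
      unfolding \<psi> by (simp add: D G G' two add_commute)
    also have "\<dots> = cdif T n \<cdot> \<alpha> (n + 1)"
      by (simp add: D G dd)
    finally have *: "cdif T n \<cdot> (\<gamma>' \<cdot> cdif X' (n + 1)) \<oplus> cdif T n \<cdot> (\<delta>' \<cdot> s (n + 1)) =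
      cdif T n \<cdot> \<alpha> (n + 1)" .
    have "(\<beta> (n + 1) \<oplus> Neg C (cdif T n \<cdot> \<delta>')) \<cdot> s (n + 1) =
        (cdif T n \<cdot> \<alpha> (n + 1) \<oplus> \<alpha> (n + 2) \<cdot> cdif X' (n + 1)) \<oplus> Neg C (cdif T n \<cdot> (\<delta>' \<cdot> s (n + 1)))"
      using \<alpha>(4)[of "n + 1"] by (simp add: D G' two)
    also have "\<dots> = \<alpha> (n + 2) \<cdot> cdif X' (n + 1) \<oplus> cdif T n \<cdot> (\<gamma>' \<cdot> cdif X' (n + 1)) \<oplus>
        (cdif T n \<cdot> (\<delta>' \<cdot> s (n + 1)) \<oplus> Neg C (cdif T n \<cdot> (\<delta>' \<cdot> s (n + 1))))"
      unfolding *[symmetric] by (simp add: D G' two add_ac del: add_neg)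
    also have "\<dots> = (\<alpha> (n + 2) \<oplus> cdif T n \<cdot> \<gamma>') \<cdot> cdif X' (n + 1)"
      by (simp add: D G' two)
    finally have P2: "(\<beta> (n + 1) \<oplus> Neg C (cdif T n \<cdot> \<delta>')) \<cdot> s (n + 1) =
        (\<alpha> (n + 2) \<oplus> cdif T n \<cdot> \<gamma>') \<cdot> cdif X' (n + 1)" .
    have "P (n + 1) (\<delta>', \<gamma>')"
      unfolding P_def typed_def prod.case two by (intro conjI G' P1 P2)
    moreover have "Q n x (\<delta>', \<gamma>')"
      unfolding Q_def x prod.case using \<beta>n \<psi> by simp
    ultimately show "\<exists>y. P (n + 1) y \<and> Q n x y"
      by blast
  qed
  then obtain f where f: "\<And>n. P n (f n)" "\<And>n. Q n (f n) (f (n + 1))"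
    by blast
  have fP: "P n (fst (f n), snd (f n))" and fQ: "Q n (fst (f n), snd (f n)) (fst (f (n + 1)), snd (f (n + 1)))" for n
    using f[of n] by simp_all
  show ?thesis
  proof (rule that[of "\<lambda>n. fst (f n)" "\<lambda>n. snd (f (n - 1))"])
    fix n
    show "fst (f n) \<in> Arr C" "Dom C (fst (f n)) = cobj X n" "Cod C (fst (f n)) = cobj T (n - 1)"
      using fP[of n] unfolding P_def typed_def prod.case by auto
    show "snd (f (n - 1)) \<in> Arr C" "Dom C (snd (f (n - 1))) = cobj X' n" "Cod C (snd (f (n - 1))) = cobj T (n - 2)"
      using fP[of "n - 1"] unfolding P_def typed_def prod.case by auto
    show "\<beta> n = cdif T (n - 1) \<cdot> fst (f n) \<oplus> fst (f (n + 1)) \<cdot> cdif X n"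
      using fQ[of n] unfolding Q_def prod.case by simp
    show "\<alpha> n \<oplus> cdif T (n - 2) \<cdot> snd (f (n - 1)) = fst (f n) \<cdot> s n \<oplus> snd (f (n + 1 - 1)) \<cdot> cdif X' n"
      using fQ[of "n - 1"] unfolding Q_def prod.case by simp
  qed
qed

text \<open>
  A null-homotopy of \<open>x \<cdot> s\<close> extends \<open>x\<close> to a map from the mapping cone of \<open>s\<close> to \<open>T\<close>.
\<close>

lemma null_homotopic_if_comp_quasi_iso:
  assumes X': "is_cpx C X'" and X: "is_cpx C X" and s: "quasi_iso C X' X s"
    and T: "bounded_injective_cpx C T" and x: "chain_map C X T x"
    and null: "null_homotopic C X' T (\<lambda>n. x n \<cdot> s n)"
  shows "null_homotopic C X T x"
proof -
  obtain \<alpha> where \<alpha>: "\<And>n. \<alpha> n \<in> Arr C" "\<And>n. Dom C (\<alpha> n) = cobj X' n" "\<And>n. Cod C (\<alpha> n) = cobj T (n - 1)"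
      "\<And>n. x n \<cdot> s n = cdif T (n - 1) \<cdot> \<alpha> n \<oplus> \<alpha> (n + 1) \<cdot> cdif X' n"
    by (rule null_homotopicE[OF null]) (rule that)
  show ?thesis
    by (rule cone_map_null_homotopic[OF X' X s T x \<alpha>], rule null_homotopicI)
qed

text \<open>
  Up to homotopy, every \<open>y : X' \<rightarrow> T\<close> factors through the quasi-isomorphism \<open>s : X' \<rightarrow> X\<close>: regard \<open>y\<close> as a map
  from the mapping cone of \<open>s\<close> to \<open>T[1]\<close> that vanishes on \<open>X\<close>.
\<close>

lemma no_maps_into_quasi_iso:
  assumes X': "is_cpx C X'" and X: "is_cpx C X" and s: "quasi_iso C X' X s"
    and T: "bounded_injective_cpx C T" and no_maps: "no_maps_into C T X"
  shows "no_maps_into C T X'"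
  unfolding no_maps_into_def
proof (intro allI impI)
  fix y assume y: "chain_map C X' T y"
  have Tc: "is_cpx C T" and Tinj: "\<And>n. is_injective C (cobj T n)"
    using T by (auto simp: bounded_injective_cpx_def)
  obtain N where N: "\<And>n. n < N \<Longrightarrow> is_zero_obj C (cobj T n)"
    using T by (auto simp: bounded_injective_cpx_def)
  have sc: "chain_map C X' X s"
    using s by (simp add: quasi_iso_def)
  note D = cpxD(1-4)[OF X'] cpxD(1-4)[OF X] cpxD(1-4)[OF Tc] chain_mapD(1-3)[OF sc]
    chain_mapD(1-3)[OF y]
  let ?T' = "shift_cpx C T"
  have T'_simps: "cobj ?T' n = cobj T (n + 1)" "cdif ?T' n = Neg C (cdif T (n + 1))" for n
    by (simp_all add: shift_cpx_def)
  have T'c: "is_cpx C ?T'"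
    unfolding is_cpx_def
  proof (intro allI conjI)
    fix n
    have "cdif T (n + 1 + 1) \<cdot> cdif T (n + 1) = Zero C (cobj T (n + 1)) (cobj T (n + 1 + 2))"
      by (rule cpxD(5)[OF Tc])
    moreover have "n + 1 + 2 = n + 2 + 1"
      by simp
    ultimately show "cdif ?T' (n + 1) \<cdot> cdif ?T' n = Zero C (cobj ?T' n) (cobj ?T' (n + 2))"
      by (simp add: T'_simps D)
  qed (simp_all add: T'_simps Mor_def D)
  have "is_zero_obj C (cobj ?T' n)" if "n < N - 1" for n
    using N that by (simp add: T'_simps)
  then have T': "bounded_injective_cpx C ?T'"
    using T'c Tinj unfolding bounded_injective_cpx_def T'_simps by blast
  have y_cod: "Cod C (y n) = cobj ?T' (n - 1)" for n
    by (simp add: T'_simps D)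
  have "Zero C (cobj X n) (cobj ?T' n) \<cdot> s n = cdif ?T' (n - 1) \<cdot> y n \<oplus> y (n + 1) \<cdot> cdif X' n" for n
    using chain_mapD(4)[OF y, of n] by (simp add: D T'_simps)
  note maps = cone_map_null_homotopic[OF X' X s T' chain_map_zero[OF X T'c] chain_mapD(1,2)[OF y] y_cod this]
  obtain \<delta> \<gamma> where \<delta>: "\<And>n. \<delta> n \<in> Arr C" "\<And>n. Dom C (\<delta> n) = cobj X n" "\<And>n. Cod C (\<delta> n) = cobj ?T' (n - 1)"
    and \<gamma>: "\<And>n. \<gamma> n \<in> Arr C" "\<And>n. Dom C (\<gamma> n) = cobj X' n" "\<And>n. Cod C (\<gamma> n) = cobj ?T' (n - 2)"
    and \<delta>d: "\<And>n. Zero C (cobj X n) (cobj ?T' n) = cdif ?T' (n - 1) \<cdot> \<delta> n \<oplus> \<delta> (n + 1) \<cdot> cdif X n"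
    and \<gamma>d: "\<And>n. y n \<oplus> cdif ?T' (n - 2) \<cdot> \<gamma> n = \<delta> n \<cdot> s n \<oplus> \<gamma> (n + 1) \<cdot> cdif X' n"
    by (rule maps) (rule that)
  have G: "Cod C (\<delta> n) = cobj T n" "Cod C (\<gamma> n) = cobj T (n - 1)" for n
    using \<delta>(3)[of n] \<gamma>(3)[of n] by (simp_all add: T'_simps algebra_simps)
  have \<delta>c: "chain_map C X T \<delta>"
  proof -
    have "cdif T n \<cdot> \<delta> n = \<delta> (n + 1) \<cdot> cdif X n" for n
    proof -
      have "cdif T n \<cdot> \<delta> n \<oplus> (Neg C (cdif T n \<cdot> \<delta> n) \<oplus> \<delta> (n + 1) \<cdot> cdif X n) = cdif T n \<cdot> \<delta> n"
        using \<delta>d[of n, symmetric] by (simp add: T'_simps D \<delta>(1,2) G)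
      then show ?thesis
        by (simp add: D \<delta>(1,2) G)
    qed
    then show ?thesis
      by (simp add: chain_map_def Mor_def \<delta>(1,2) G)
  qed
  then have "null_homotopic C X' T (\<lambda>n. \<delta> n \<cdot> s n)"
    using no_maps unfolding no_maps_into_def by (blast intro: null_homotopic_comp[OF X' X Tc sc])
  moreover have "homotopic C X' T y (\<lambda>n. \<delta> n \<cdot> s n)"
  proof (rule homotopicI[where h = \<gamma>])
    fix n :: int
    have "n - 2 + 1 = n - 1"
      by simp
    then have "y n \<oplus> Neg C (cdif T (n - 1) \<cdot> \<gamma> n) = \<delta> n \<cdot> s n \<oplus> \<gamma> (n + 1) \<cdot> cdif X' n"
      using \<gamma>d[of n] by (simp add: T'_simps D \<gamma>(1,2) G)
    then have "(y n \<oplus> Neg C (cdif T (n - 1) \<cdot> \<gamma> n)) \<oplus> cdif T (n - 1) \<cdot> \<gamma> n =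
       (\<delta> n \<cdot> s n \<oplus> \<gamma> (n + 1) \<cdot> cdif X' n) \<oplus> cdif T (n - 1) \<cdot> \<gamma> n"
      by simp
    then show "y n = \<delta> n \<cdot> s n \<oplus> (cdif T (n - 1) \<cdot> \<gamma> n \<oplus> \<gamma> (n + 1) \<cdot> cdif X' n)"
      by (simp add: D \<gamma>(1,2) \<delta>(1,2) G add_ac)
  qed (simp_all add: \<gamma>(1,2) G)
  ultimately show "null_homotopic C X' T y"
    using null_homotopic_cong[OF X' Tc y chain_map_comp[OF X' X Tc sc \<delta>c]] by blast
qed

text \<open>
  With \<open>v\<close>, \<open>g\<close> and \<open>t\<close> as in \<open>isomorphic_D_catE\<close>, a map \<open>x : A \<rightarrow> T\<close> is null-homotopic if \<open>x \<cdot> v\<close> is. The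
  latter is homotopic to a map that factors through \<open>x \<cdot> g : B' \<rightarrow> T\<close>, which is null-homotopic because
  \<open>B'\<close> is quasi-isomorphic to \<open>B\<close>.
\<close>

lemma no_maps_into_isomorphic:
  assumes S: "S \<subseteq> complexes C" and iso: "isomorphic (D_cat C S) A B" and A: "A \<in> S" and B: "B \<in> S"
    and T: "bounded_injective_cpx C T" and no_maps: "no_maps_into C T B"
  shows "no_maps_into C T A"
  unfolding no_maps_into_def
proof (intro allI impI)
  fix x assume x: "chain_map C A T x"
  obtain M B' v w t g where R: "M \<in> S" "B' \<in> S" "quasi_iso C M A v" "chain_map C M B' w"
    "chain_map C B' A g" "quasi_iso C B' B t" "homotopic C M A v (\<lambda>n. g n \<cdot> w n)"
    by (rule isomorphic_D_catE[OF S iso A]) (rule that)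
  have c: "is_cpx C A" "is_cpx C B" "is_cpx C M" "is_cpx C B'"
    using S A B R by (auto simp: complexes_def)
  have Tc: "is_cpx C T"
    using T by (simp add: bounded_injective_cpx_def)
  have v: "chain_map C M A v"
    using R(3) by (simp add: quasi_iso_def)
  have gw: "chain_map C M A (\<lambda>n. g n \<cdot> w n)"
    by (rule chain_map_comp[OF c(3) c(4) c(1) R(4,5)])
  have "no_maps_into C T B'"
    using no_maps_into_quasi_iso[OF c(4) c(2) R(6) T no_maps] .
  moreover have "chain_map C B' T (\<lambda>n. x n \<cdot> g n)"
    by (rule chain_map_comp[OF c(4) c(1) Tc R(5) x])
  ultimately have "null_homotopic C B' T (\<lambda>n. x n \<cdot> g n)"
    by (simp add: no_maps_into_def)
  then have "null_homotopic C M T (\<lambda>n. (x n \<cdot> g n) \<cdot> w n)"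
    by (rule null_homotopic_comp[OF c(3) c(4) Tc R(4)])
  also have "(\<lambda>n. (x n \<cdot> g n) \<cdot> w n) = (\<lambda>n. x n \<cdot> (g n \<cdot> w n))"
    by (rule ext) (simp add: chain_mapD[OF x] chain_mapD(1-3)[OF R(4)] chain_mapD(1-3)[OF R(5)])
  finally have "null_homotopic C M T (\<lambda>n. x n \<cdot> (g n \<cdot> w n))" .
  then have "null_homotopic C M T (\<lambda>n. x n \<cdot> v n)"
    using chain_map_comp[OF c(3,1) Tc v x] chain_map_comp[OF c(3,1) Tc gw x]
      homotopic_comp_left[OF c(3,1) Tc v gw x R(7)] null_homotopic_cong[OF c(3) Tc] by blast
  then show "null_homotopic C A T x"
    by (rule null_homotopic_if_comp_quasi_iso[OF c(3,1) R(3) T x])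
qed

end

section \<open>Abelian groups: kernels and cokernels\<close>

abbreviation ab_fun :: "'u abarr \<Rightarrow> 'u \<Rightarrow> 'u" where
  "ab_fun a \<equiv> snd (snd a)"

lemma Ab_Mor_iff:
  "a \<in> Mor Ab G H \<longleftrightarrow> comm_group G \<and> comm_group H \<and>
     (\<exists>f. a = (G, H, f) \<and> f \<in> hom G H \<and> f \<in> extensional (carrier G))"
  by (auto simp: Mor_def Ab_def)

lemma Ab_MorE:
  assumes "a \<in> Mor Ab G H"
  obtains "comm_group G" "comm_group H" "group_hom G H (ab_fun a)" "a = (G, H, ab_fun a)"
    "ab_fun a \<in> extensional (carrier G)"
  using assms by (auto simp: Ab_Mor_iff group_hom_def group_hom_axioms_def comm_group_def)

lemma Ab_MorI:
  assumes "comm_group G" "comm_group H" "f \<in> hom G H"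
  shows "(G, H, restrict f (carrier G)) \<in> Mor Ab G H"
proof -
  interpret G: comm_group G by fact
  have "restrict f (carrier G) \<in> hom G H"
    using assms(3) by (auto simp: hom_def)
  then show ?thesis
    using assms by (simp add: Ab_Mor_iff)
qed

lemma Ab_eqI:
  assumes "a \<in> Mor Ab G H" "b \<in> Mor Ab G H" "\<And>x. x \<in> carrier G \<Longrightarrow> ab_fun a x = ab_fun b x"
  shows "a = b"
  using assms by (auto simp: Ab_Mor_iff intro: extensionalityI)

lemma Ab_fun_closed: "\<lbrakk>a \<in> Mor Ab G H; x \<in> carrier G\<rbrakk> \<Longrightarrow> ab_fun a x \<in> carrier H"
  by (auto simp: Ab_Mor_iff hom_def)

lemma Ab_fun_mult:
  "\<lbrakk>a \<in> Mor Ab G H; x \<in> carrier G; y \<in> carrier G\<rbrakk>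
    \<Longrightarrow> ab_fun a (x \<otimes>\<^bsub>G\<^esub> y) = ab_fun a x \<otimes>\<^bsub>H\<^esub> ab_fun a y"
  by (auto simp: Ab_Mor_iff hom_def)

lemma Ab_fun_one: "a \<in> Mor Ab G H \<Longrightarrow> ab_fun a \<one>\<^bsub>G\<^esub> = \<one>\<^bsub>H\<^esub>"
  by (erule Ab_MorE) (rule group_hom.hom_one)

lemma Ab_fun_inv:
  "\<lbrakk>a \<in> Mor Ab G H; x \<in> carrier G\<rbrakk> \<Longrightarrow> ab_fun a (inv\<^bsub>G\<^esub> x) = inv\<^bsub>H\<^esub> (ab_fun a x)"
  by (erule Ab_MorE) (rule group_hom.hom_inv)

lemma Ab_comp:
  assumes "a \<in> Mor Ab G H" "b \<in> Mor Ab H K"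
  shows "b \<cdot>\<^bsub>Ab\<^esub> a \<in> Mor Ab G K"
    and "x \<in> carrier G \<Longrightarrow> ab_fun (b \<cdot>\<^bsub>Ab\<^esub> a) x = ab_fun b (ab_fun a x)"
proof -
  obtain f g where f: "a = (G, H, f)" "f \<in> hom G H" "comm_group G" and
    g: "b = (H, K, g)" "g \<in> hom H K" "comm_group K"
    using assms by (auto simp: Ab_Mor_iff)
  have eq: "b \<cdot>\<^bsub>Ab\<^esub> a = (G, K, restrict (g \<circ> f) (carrier G))"
    by (simp add: Ab_def f g compose_def comp_def)
  have "g \<circ> f \<in> hom G K"
    using f(2) g(2) by (auto simp: hom_def Pi_iff)
  then show "b \<cdot>\<^bsub>Ab\<^esub> a \<in> Mor Ab G K"
    unfolding eq by (intro Ab_MorI f(3) g(3))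
  show "x \<in> carrier G \<Longrightarrow> ab_fun (b \<cdot>\<^bsub>Ab\<^esub> a) x = ab_fun b (ab_fun a x)"
    unfolding eq by (simp add: f g)
qed

lemma Ab_ident:
  assumes "comm_group G"
  shows "Ident Ab G \<in> Mor Ab G G" and "x \<in> carrier G \<Longrightarrow> ab_fun (Ident Ab G) x = x"
  using Ab_MorI[OF assms assms, of "\<lambda>x. x"] by (simp_all add: Ab_def hom_def)

lemma Ab_add:
  assumes "a \<in> Mor Ab G H" "b \<in> Mor Ab G H"
  shows "a \<oplus>\<^bsub>Ab\<^esub> b \<in> Mor Ab G H"
    and "x \<in> carrier G \<Longrightarrow> ab_fun (a \<oplus>\<^bsub>Ab\<^esub> b) x = ab_fun a x \<otimes>\<^bsub>H\<^esub> ab_fun b x"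
proof -
  obtain f g where f: "a = (G, H, f)" "f \<in> hom G H" "comm_group G" and
    g: "b = (G, H, g)" "g \<in> hom G H" "comm_group H"
    using assms by (auto simp: Ab_Mor_iff)
  interpret H: comm_group H by fact
  have eq: "a \<oplus>\<^bsub>Ab\<^esub> b = (G, H, \<lambda>x\<in>carrier G. f x \<otimes>\<^bsub>H\<^esub> g x)"
    by (simp add: Ab_def f g)
  have "(\<lambda>x. f x \<otimes>\<^bsub>H\<^esub> g x) \<in> hom G H"
    using f(2) g(2) by (auto simp: hom_def Pi_iff H.m_ac)
  then show "a \<oplus>\<^bsub>Ab\<^esub> b \<in> Mor Ab G H"
    unfolding eq by (intro Ab_MorI f(3) g(3))
  show "x \<in> carrier G \<Longrightarrow> ab_fun (a \<oplus>\<^bsub>Ab\<^esub> b) x = ab_fun a x \<otimes>\<^bsub>H\<^esub> ab_fun b x"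
    unfolding eq by (simp add: f g)
qed

lemma Ab_zero:
  assumes "comm_group G" "comm_group H"
  shows "Zero Ab G H \<in> Mor Ab G H" and "x \<in> carrier G \<Longrightarrow> ab_fun (Zero Ab G H) x = \<one>\<^bsub>H\<^esub>"
proof -
  interpret H: comm_group H by fact
  show "Zero Ab G H \<in> Mor Ab G H" and "x \<in> carrier G \<Longrightarrow> ab_fun (Zero Ab G H) x = \<one>\<^bsub>H\<^esub>"
    using Ab_MorI[OF assms, of "\<lambda>x. \<one>\<^bsub>H\<^esub>"] by (simp_all add: Ab_def hom_def)
qed

lemma category_Ab: "category Ab"
proof
  fix A B B' B'' f g h
  show "A \<in> Obj Ab \<Longrightarrow> Ident Ab A \<in> Mor Ab A A"
    by (rule Ab_ident) (simp add: Ab_def)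
  show "\<lbrakk>f \<in> Mor Ab A B; g \<in> Mor Ab B B'\<rbrakk> \<Longrightarrow> g \<cdot>\<^bsub>Ab\<^esub> f \<in> Mor Ab A B'"
    by (rule Ab_comp)
  show "(h \<cdot>\<^bsub>Ab\<^esub> g) \<cdot>\<^bsub>Ab\<^esub> f = h \<cdot>\<^bsub>Ab\<^esub> (g \<cdot>\<^bsub>Ab\<^esub> f)"
    if "f \<in> Mor Ab A B" "g \<in> Mor Ab B B'" "h \<in> Mor Ab B' B''"
  proof (rule Ab_eqI[OF Ab_comp(1)[OF that(1) Ab_comp(1)[OF that(2,3)]]
        Ab_comp(1)[OF Ab_comp(1)[OF that(1,2)] that(3)]])
    fix x assume x: "x \<in> carrier A"
    have fx: "ab_fun f x \<in> carrier B"
      using that(1) x by (rule Ab_fun_closed)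
    show "ab_fun ((h \<cdot>\<^bsub>Ab\<^esub> g) \<cdot>\<^bsub>Ab\<^esub> f) x = ab_fun (h \<cdot>\<^bsub>Ab\<^esub> (g \<cdot>\<^bsub>Ab\<^esub> f)) x"
      unfolding Ab_comp(2)[OF that(1) Ab_comp(1)[OF that(2,3)] x] Ab_comp(2)[OF that(2,3) fx]
        Ab_comp(2)[OF Ab_comp(1)[OF that(1,2)] that(3) x] Ab_comp(2)[OF that(1,2) x] ..
  qed
  show "f \<cdot>\<^bsub>Ab\<^esub> Ident Ab A = f" if f: "f \<in> Mor Ab A B"
  proof -
    have A: "comm_group A"
      using f by (rule Ab_MorE)
    show ?thesis
      by (rule Ab_eqI[OF Ab_comp(1)[OF Ab_ident(1)[OF A] f] f])
        (simp add: Ab_comp(2)[OF Ab_ident(1)[OF A] f] Ab_ident(2)[OF A])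
  qed
  show "Ident Ab B \<cdot>\<^bsub>Ab\<^esub> f = f" if f: "f \<in> Mor Ab A B"
  proof -
    have B: "comm_group B"
      using f by (rule Ab_MorE)
    show ?thesis
      by (rule Ab_eqI[OF Ab_comp(1)[OF f Ab_ident(1)[OF B]] f])
        (simp add: Ab_comp(2)[OF f Ab_ident(1)[OF B]] Ab_ident(2)[OF B] Ab_fun_closed[OF f])
  qed
qed (auto simp: Ab_def)

lemma preadditive_category_Ab: "preadditive_category (Ab :: ('u monoid, 'u abarr) addcat)"
proof -
  show ?thesis
  proof (intro preadditive_category.intro preadditive_category_axioms.intro category_Ab)
    fix A B :: "'u monoid" assume "A \<in> Obj Ab" "B \<in> Obj Ab"
    then have AB: "comm_group A" "comm_group B"
      by (simp_all add: Ab_def)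
    interpret B: comm_group B by fact
    have simps: "carrier (mor_group Ab A B) = Mor Ab A B" "\<one>\<^bsub>mor_group Ab A B\<^esub> = Zero Ab A B"
      "x \<otimes>\<^bsub>mor_group Ab A B\<^esub> y = x \<oplus>\<^bsub>Ab\<^esub> y" for x y
      by (simp_all add: mor_group_def)
    show "comm_group (mor_group Ab A B)"
    proof (rule comm_groupI, unfold simps)
      fix x y z assume x: "x \<in> Mor Ab A B"
      {
        assume y: "y \<in> Mor Ab A B"
        show "x \<oplus>\<^bsub>Ab\<^esub> y \<in> Mor Ab A B"
          using x y by (rule Ab_add)
        show "x \<oplus>\<^bsub>Ab\<^esub> y = y \<oplus>\<^bsub>Ab\<^esub> x"
          by (rule Ab_eqI[OF Ab_add(1)[OF x y] Ab_add(1)[OF y x]])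
            (simp add: Ab_add(2)[OF x y] Ab_add(2)[OF y x] B.m_comm Ab_fun_closed[OF x] Ab_fun_closed[OF y])
        assume z: "z \<in> Mor Ab A B"
        note xy = Ab_add(1)[OF x y] and yz = Ab_add(1)[OF y z]
        show "x \<oplus>\<^bsub>Ab\<^esub> y \<oplus>\<^bsub>Ab\<^esub> z = x \<oplus>\<^bsub>Ab\<^esub> (y \<oplus>\<^bsub>Ab\<^esub> z)"
          by (rule Ab_eqI[OF Ab_add(1)[OF xy z] Ab_add(1)[OF x yz]])
            (simp add: Ab_add(2)[OF x y] Ab_add(2)[OF y z] Ab_add(2)[OF xy z] Ab_add(2)[OF x yz]
              B.m_assoc Ab_fun_closed[OF x] Ab_fun_closed[OF y] Ab_fun_closed[OF z])
      }
      show "Zero Ab A B \<oplus>\<^bsub>Ab\<^esub> x = x"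
        by (rule Ab_eqI[OF Ab_add(1)[OF Ab_zero(1)[OF AB] x] x])
          (simp add: Ab_add(2)[OF Ab_zero(1)[OF AB] x] Ab_zero(2)[OF AB] Ab_fun_closed[OF x])
      let ?y = "(A, B, restrict (\<lambda>a. inv\<^bsub>B\<^esub> (ab_fun x a)) (carrier A))"
      have y: "?y \<in> Mor Ab A B"
        by (rule Ab_MorI[OF AB]) 
          (simp add: hom_def Pi_iff Ab_fun_closed[OF x] Ab_fun_mult[OF x] B.inv_mult)
      have "?y \<oplus>\<^bsub>Ab\<^esub> x = Zero Ab A B"
        by (rule Ab_eqI[OF Ab_add(1)[OF y x] Ab_zero(1)[OF AB]])
          (simp add: Ab_add(2)[OF y x] Ab_zero(2)[OF AB] Ab_fun_closed[OF x])
      then show "\<exists>y\<in>Mor Ab A B. y \<oplus>\<^bsub>Ab\<^esub> x = Zero Ab A B"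
        using y by blast
    qed (rule Ab_zero(1)[OF AB])
  next
    fix f f' g :: "'u abarr" and A B B' assume f: "f \<in> Mor Ab A B" and f': "f' \<in> Mor Ab A B" and g: "g \<in> Mor Ab B B'"
    show "g \<cdot>\<^bsub>Ab\<^esub> (f \<oplus>\<^bsub>Ab\<^esub> f') = g \<cdot>\<^bsub>Ab\<^esub> f \<oplus>\<^bsub>Ab\<^esub> g \<cdot>\<^bsub>Ab\<^esub> f'"
      by (rule Ab_eqI[OF Ab_comp(1)[OF Ab_add(1)[OF f f'] g] Ab_add(1)[OF Ab_comp(1)[OF f g] Ab_comp(1)[OF f' g]]])
        (simp add: Ab_comp(2)[OF Ab_add(1)[OF f f'] g] Ab_add(2)[OF f f'] Ab_comp(2)[OF f g] Ab_comp(2)[OF f' g]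
          Ab_add(2)[OF Ab_comp(1)[OF f g] Ab_comp(1)[OF f' g]] Ab_fun_mult[OF g] Ab_fun_closed[OF f] Ab_fun_closed[OF f'])
  next
    fix f g g' :: "'u abarr" and A B B' assume f: "f \<in> Mor Ab A B" and g: "g \<in> Mor Ab B B'" and g': "g' \<in> Mor Ab B B'"
    show "(g \<oplus>\<^bsub>Ab\<^esub> g') \<cdot>\<^bsub>Ab\<^esub> f = g \<cdot>\<^bsub>Ab\<^esub> f \<oplus>\<^bsub>Ab\<^esub> g' \<cdot>\<^bsub>Ab\<^esub> f"
      by (rule Ab_eqI[OF Ab_comp(1)[OF f Ab_add(1)[OF g g']] Ab_add(1)[OF Ab_comp(1)[OF f g] Ab_comp(1)[OF f g']]])
        (simp add: Ab_comp(2)[OF f Ab_add(1)[OF g g']] Ab_add(2)[OF g g'] Ab_comp(2)[OF f g] Ab_comp(2)[OF f g']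
          Ab_add(2)[OF Ab_comp(1)[OF f g] Ab_comp(1)[OF f g']] Ab_fun_closed[OF f])
  qed
qed

lemma Ab_kernel_exists:
  assumes a: "a \<in> Mor Ab G H"
  obtains k where "is_kernel Ab a k" "inj_on (ab_fun k) (carrier (Dom Ab k))"
    "ab_fun k ` carrier (Dom Ab k) = {x \<in> carrier G. ab_fun a x = \<one>\<^bsub>H\<^esub>}"
proof -
  have GH: "comm_group G" "comm_group H"
    using a by (auto elim: Ab_MorE)
  interpret G: comm_group G by fact
  interpret H: comm_group H by fact
  let ?S = "{x \<in> carrier G. ab_fun a x = \<one>\<^bsub>H\<^esub>}"
  define K where "K = \<lparr>carrier = ?S, mult = mult G, one = \<one>\<^bsub>G\<^esub>\<rparr>"
  have K_simps: "carrier K = ?S" "x \<otimes>\<^bsub>K\<^esub> y = x \<otimes>\<^bsub>G\<^esub> y" "\<one>\<^bsub>K\<^esub> = \<one>\<^bsub>G\<^esub>" for x y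
    by (simp_all add: K_def)
  define k where "k = (K, G, restrict (\<lambda>x. x) (carrier K))"
  have k_fun: "ab_fun k x = x" if "x \<in> carrier K" for x
    using that by (simp add: k_def)
  have K: "comm_group K"
  proof (rule comm_groupI)
    fix x assume x: "x \<in> carrier K"
    then have "inv\<^bsub>G\<^esub> x \<in> carrier K"
      by (simp add: K_simps Ab_fun_inv[OF a])
    then show "\<exists>y\<in>carrier K. y \<otimes>\<^bsub>K\<^esub> x = \<one>\<^bsub>K\<^esub>"
      using x by (intro bexI[of _ "inv\<^bsub>G\<^esub> x"]) (auto simp: K_simps)
  qed (auto simp: K_simps Ab_fun_mult[OF a] Ab_fun_one[OF a] G.m_ac)
  have k: "k \<in> Mor Ab K G"
    unfolding k_def by (rule Ab_MorI[OF K GH(1)]) (auto simp: hom_def K_simps)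
  have dc: "Dom Ab k = K" "Cod Ab k = G" "Dom Ab a = G" "Cod Ab a = H" "a \<in> Arr Ab" "k \<in> Arr Ab"
    using k a by (auto simp: Mor_def)
  have "is_kernel Ab a k"
    unfolding is_kernel_def dc(1-4)
  proof (intro conjI allI ballI impI dc(5,6) refl)
    show "a \<cdot>\<^bsub>Ab\<^esub> k = Zero Ab K H"
      by (rule Ab_eqI[OF Ab_comp(1)[OF k a] Ab_zero(1)[OF K GH(2)]])
        (simp add: Ab_comp(2)[OF k a] Ab_zero(2)[OF K GH(2)] k_fun, simp add: K_simps)
    fix A h assume h: "h \<in> Mor Ab A G" "a \<cdot>\<^bsub>Ab\<^esub> h = Zero Ab A H"
    have A: "comm_group A"
      using h(1) by (rule Ab_MorE)
    have ah: "ab_fun a (ab_fun h x) = \<one>\<^bsub>H\<^esub>" if "x \<in> carrier A" for x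
      using Ab_comp(2)[OF h(1) a that] Ab_zero(2)[OF A GH(2) that] h(2) by simp
    define u where "u = (A, K, restrict (ab_fun h) (carrier A))"
    have u_fun: "ab_fun u x = ab_fun h x" if "x \<in> carrier A" for x
      using that by (simp add: u_def)
    have hK: "ab_fun h x \<in> carrier K" if "x \<in> carrier A" for x
      using that by (simp add: K_simps Ab_fun_closed[OF h(1)] ah)
    have u: "u \<in> Mor Ab A K"
      unfolding u_def by (rule Ab_MorI[OF A K]) (auto simp: hom_def K_simps Ab_fun_closed[OF h(1)] ah Ab_fun_mult[OF h(1)])
    show "\<exists>!u. u \<in> Mor Ab A K \<and> k \<cdot>\<^bsub>Ab\<^esub> u = h"
    proof (rule ex1I[of _ u])
      show "u \<in> Mor Ab A K \<and> k \<cdot>\<^bsub>Ab\<^esub> u = h"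
        by (intro conjI u Ab_eqI[OF Ab_comp(1)[OF u k] h(1)])
          (simp add: Ab_comp(2)[OF u k] u_fun k_fun hK)
      fix v assume v: "v \<in> Mor Ab A K \<and> k \<cdot>\<^bsub>Ab\<^esub> v = h"
      then have v: "v \<in> Mor Ab A K" "k \<cdot>\<^bsub>Ab\<^esub> v = h"
        by auto
      show "v = u"
        using Ab_comp(2)[OF v(1) k] Ab_fun_closed[OF v(1)] unfolding v(2)
        by (intro Ab_eqI[OF v(1) u]) (simp add: u_fun k_fun)
    qed
  qed
  then show ?thesis
    by (rule that) (simp_all add: dc(1) inj_on_def k_fun image_def K_simps)
qed

text \<open>
  The cokernel of a homomorphism to \<open>H\<close> is carried by a system of representatives of the cosets of
  its image, since the elements of a quotient group must come from the type of the elements of \<open>H\<close>.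
\<close>

lemma Ab_cokernel_exists:
  assumes a: "a \<in> Mor Ab G H"
  obtains q where "is_cokernel Ab a q" "ab_fun q ` carrier H = carrier (Cod Ab q)"
    "\<And>x. x \<in> carrier H \<Longrightarrow> ab_fun q x = \<one>\<^bsub>Cod Ab q\<^esub> \<longleftrightarrow> x \<in> ab_fun a ` carrier G"
proof -
  have GH: "comm_group G" "comm_group H"
    using a by (auto elim: Ab_MorE)
  interpret G: comm_group G by fact
  interpret H: comm_group H by fact
  let ?N = "ab_fun a ` carrier G"
  define E where "E x y \<longleftrightarrow> y \<in> carrier H \<and> x \<otimes>\<^bsub>H\<^esub> inv\<^bsub>H\<^esub> y \<in> ?N" for x y
  define \<pi> where "\<pi> x = (SOME y. E x y)" for x
  have N: "\<one>\<^bsub>H\<^esub> \<in> ?N" "\<And>x. x \<in> ?N \<Longrightarrow> x \<in> carrier H" "\<And>x. x \<in> ?N \<Longrightarrow> inv\<^bsub>H\<^esub> x \<in> ?N"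
    "\<And>x y. \<lbrakk>x \<in> ?N; y \<in> ?N\<rbrakk> \<Longrightarrow> x \<otimes>\<^bsub>H\<^esub> y \<in> ?N"
    subgoal using Ab_fun_one[OF a] by (metis G.one_closed imageI)
    subgoal by (auto simp: Ab_fun_closed[OF a])
    subgoal by (auto simp: Ab_fun_inv[OF a, symmetric])
    subgoal by (auto simp: Ab_fun_mult[OF a, symmetric])
    done
  have E_refl: "E x x" if "x \<in> carrier H" for x
    using that N(1) by (simp add: E_def)
  have E_sym: "E y x" if "E x y" "x \<in> carrier H" for x y
    using that N(3)[of "x \<otimes>\<^bsub>H\<^esub> inv\<^bsub>H\<^esub> y"] by (auto simp: E_def H.inv_mult H.m_comm)
  have E_trans: "E x z" if "E x y" "E y z" "x \<in> carrier H" for x y z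
  proof -
    have "(x \<otimes>\<^bsub>H\<^esub> inv\<^bsub>H\<^esub> y) \<otimes>\<^bsub>H\<^esub> (y \<otimes>\<^bsub>H\<^esub> inv\<^bsub>H\<^esub> z) \<in> ?N"
      using that by - (rule N(4), auto simp: E_def)
    moreover have "(x \<otimes>\<^bsub>H\<^esub> inv\<^bsub>H\<^esub> y) \<otimes>\<^bsub>H\<^esub> (y \<otimes>\<^bsub>H\<^esub> inv\<^bsub>H\<^esub> z) = x \<otimes>\<^bsub>H\<^esub> inv\<^bsub>H\<^esub> z"
      using that by (simp add: E_def H.m_assoc) (simp add: H.m_assoc[symmetric])
    ultimately show ?thesis
      using that by (simp add: E_def)
  qed
  have E_mult: "E (x \<otimes>\<^bsub>H\<^esub> x') (y \<otimes>\<^bsub>H\<^esub> y')" 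
    if "E x y" "E x' y'" "x \<in> carrier H" "x' \<in> carrier H" for x x' y y'
  proof -
    have "(x \<otimes>\<^bsub>H\<^esub> inv\<^bsub>H\<^esub> y) \<otimes>\<^bsub>H\<^esub> (x' \<otimes>\<^bsub>H\<^esub> inv\<^bsub>H\<^esub> y') \<in> ?N"
      using that by - (rule N(4), auto simp: E_def)
    then show ?thesis
      using that by (simp add: E_def H.inv_mult H.m_ac)
  qed
  have \<pi>: "E x (\<pi> x)" if "x \<in> carrier H" for x
    unfolding \<pi>_def using E_refl[OF that] by (rule someI)
  have \<pi>c: "\<pi> x \<in> carrier H" if "x \<in> carrier H" for x
    using \<pi>[OF that] by (simp add: E_def)
  have \<pi>_eq: "\<pi> x = \<pi> y" if "E x y" "x \<in> carrier H" "y \<in> carrier H" for x y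
  proof -
    have "E x = E y"
      using E_trans E_sym that by blast
    then show ?thesis
      by (simp add: \<pi>_def)
  qed
  have \<pi>\<pi>: "\<pi> (\<pi> x) = \<pi> x" if "x \<in> carrier H" for x
    using \<pi>_eq[OF \<pi>[OF that] that \<pi>c[OF that]] by simp
  have \<pi>_mult: "\<pi> (\<pi> x \<otimes>\<^bsub>H\<^esub> \<pi> y) = \<pi> (x \<otimes>\<^bsub>H\<^esub> y)" if "x \<in> carrier H" "y \<in> carrier H" for x y
    using \<pi>_eq[OF E_mult[OF \<pi>[OF that(1)] \<pi>[OF that(2)]]] that \<pi>c by simp
  define Q where "Q = \<lparr>carrier = \<pi> ` carrier H, mult = (\<lambda>x y. \<pi> (x \<otimes>\<^bsub>H\<^esub> y)), one = \<pi> \<one>\<^bsub>H\<^esub>\<rparr>"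
  have Q_simps: "carrier Q = \<pi> ` carrier H" "x \<otimes>\<^bsub>Q\<^esub> y = \<pi> (x \<otimes>\<^bsub>H\<^esub> y)" "\<one>\<^bsub>Q\<^esub> = \<pi> \<one>\<^bsub>H\<^esub>" for x y
    by (simp_all add: Q_def)
  have \<pi>_mult': "\<pi> (x \<otimes>\<^bsub>H\<^esub> \<pi> y) = \<pi> (x \<otimes>\<^bsub>H\<^esub> y)" "\<pi> (\<pi> x \<otimes>\<^bsub>H\<^esub> y) = \<pi> (x \<otimes>\<^bsub>H\<^esub> y)"
    if "x \<in> carrier H" "y \<in> carrier H" for x y
    using \<pi>_mult[of x "\<pi> y"] \<pi>_mult[of "\<pi> x" y] \<pi>_mult[of x y] that by (simp_all add: \<pi>\<pi> \<pi>c)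
  have Q: "comm_group Q"
  proof (rule comm_groupI)
    fix x assume "x \<in> carrier Q"
    then obtain x' where x': "x' \<in> carrier H" "x = \<pi> x'"
      by (auto simp: Q_simps)
    show "\<exists>y\<in>carrier Q. y \<otimes>\<^bsub>Q\<^esub> x = \<one>\<^bsub>Q\<^esub>"
      by (rule bexI[of _ "\<pi> (inv\<^bsub>H\<^esub> x')"]) (use x' in \<open>auto simp: Q_simps \<pi>_mult\<close>)
  next
    fix x y assume "x \<in> carrier Q" "y \<in> carrier Q"
    then show "x \<otimes>\<^bsub>Q\<^esub> y = y \<otimes>\<^bsub>Q\<^esub> x"
      by (auto simp: Q_simps \<pi>_mult H.m_comm)
  qed (auto simp: Q_simps \<pi>_mult' \<pi>\<pi> \<pi>c H.m_assoc)
  define q where "q = (H, Q, restrict \<pi> (carrier H))"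
  have q_fun: "ab_fun q x = \<pi> x" if "x \<in> carrier H" for x
    using that by (simp add: q_def)
  have q: "q \<in> Mor Ab H Q"
    unfolding q_def by (rule Ab_MorI[OF GH(2) Q]) (auto simp: hom_def Q_simps \<pi>_mult)
  have dc: "Dom Ab q = H" "Cod Ab q = Q" "Dom Ab a = G" "Cod Ab a = H" "a \<in> Arr Ab" "q \<in> Arr Ab"
    using q a by (auto simp: Mor_def)
  have q_one: "ab_fun q x = \<one>\<^bsub>Q\<^esub> \<longleftrightarrow> x \<in> ?N" if x: "x \<in> carrier H" for x
  proof -
    have "x \<in> ?N \<longleftrightarrow> E x \<one>\<^bsub>H\<^esub>"
      using x by (simp add: E_def)
    also have "\<dots> \<longleftrightarrow> \<pi> x = \<pi> \<one>\<^bsub>H\<^esub>"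
    proof
      assume "\<pi> x = \<pi> \<one>\<^bsub>H\<^esub>"
      then have "E x (\<pi> \<one>\<^bsub>H\<^esub>)"
        using \<pi>[OF x] by simp
      then show "E x \<one>\<^bsub>H\<^esub>"
        using E_trans[OF _ E_sym[OF \<pi>]] x by blast
    qed (use \<pi>_eq x in simp)
    finally show ?thesis
      using x by (simp add: q_fun Q_simps)
  qed
  have "is_cokernel Ab a q"
    unfolding is_cokernel_def dc(1-4)
  proof (intro conjI allI ballI impI dc(5,6) refl)
    show "q \<cdot>\<^bsub>Ab\<^esub> a = Zero Ab G Q"
      by (rule Ab_eqI[OF Ab_comp(1)[OF a q] Ab_zero(1)[OF GH(1) Q]])
        (simp add: Ab_comp(2)[OF a q] Ab_zero(2)[OF GH(1) Q] q_one Ab_fun_closed[OF a])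
    fix A h assume h: "h \<in> Mor Ab H A" "h \<cdot>\<^bsub>Ab\<^esub> a = Zero Ab G A"
    have A: "comm_group A"
      using h(1) by (rule Ab_MorE)
    interpret A: comm_group A by fact
    have ha: "ab_fun h x = \<one>\<^bsub>A\<^esub>" if "x \<in> ?N" for x
      using Ab_comp(2)[OF a h(1)] Ab_zero(2)[OF GH(1) A] h(2) that by auto
    have h\<pi>: "ab_fun h (\<pi> x) = ab_fun h x" if x: "x \<in> carrier H" for x
    proof -
      have "ab_fun h (x \<otimes>\<^bsub>H\<^esub> inv\<^bsub>H\<^esub> \<pi> x) = \<one>\<^bsub>A\<^esub>"
        using \<pi>[OF x] by (intro ha) (simp add: E_def)
      then have "ab_fun h x \<otimes>\<^bsub>A\<^esub> inv\<^bsub>A\<^esub> ab_fun h (\<pi> x) = \<one>\<^bsub>A\<^esub>"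
        using x \<pi>c[OF x] by (simp add: Ab_fun_mult[OF h(1)] Ab_fun_inv[OF h(1)])
      then show ?thesis
        using x \<pi>c[OF x] A.inv_solve_right'[of "\<one>\<^bsub>A\<^esub>" "ab_fun h x" "ab_fun h (\<pi> x)"] 
        by (simp add: Ab_fun_closed[OF h(1)])
    qed
    define u where "u = (Q, A, restrict (ab_fun h) (carrier Q))"
    have u_fun: "ab_fun u x = ab_fun h x" if "x \<in> carrier Q" for x
      using that by (simp add: u_def)
    have u: "u \<in> Mor Ab Q A"
      unfolding u_def by (rule Ab_MorI[OF Q A]) (auto simp: hom_def Q_simps \<pi>c Ab_fun_closed[OF h(1)] Ab_fun_mult[OF h(1)] h\<pi>)
    show "\<exists>!u. u \<in> Mor Ab Q A \<and> u \<cdot>\<^bsub>Ab\<^esub> q = h"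
    proof (rule ex1I[of _ u])
      show "u \<in> Mor Ab Q A \<and> u \<cdot>\<^bsub>Ab\<^esub> q = h"
        by (intro conjI u Ab_eqI[OF Ab_comp(1)[OF q u] h(1)])
          (simp add: Ab_comp(2)[OF q u] q_fun u_fun Q_simps h\<pi>)
      fix v assume v: "v \<in> Mor Ab Q A \<and> v \<cdot>\<^bsub>Ab\<^esub> q = h"
      then have v: "v \<in> Mor Ab Q A" "v \<cdot>\<^bsub>Ab\<^esub> q = h"
        by auto
      show "v = u"
        using Ab_comp(2)[OF q v(1)] unfolding v(2)
        by (intro Ab_eqI[OF v(1) u]) (auto simp: Q_simps h\<pi> u_fun q_fun)
    qed
  qed
  then show ?thesis
    by (rule that) (use q_one in \<open>simp_all add: dc(2) Q_simps q_fun\<close>)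
qed

lemma Ab_in_Mor: "a \<in> Arr Ab \<Longrightarrow> a \<in> Mor Ab (Dom Ab a) (Cod Ab a)"
  by (simp add: Mor_def)

interpretation Ab: kernel_cokernel_category "Ab :: ('u monoid, 'u abarr) addcat"
proof -
  interpret preadditive_category "Ab :: ('u monoid, 'u abarr) addcat" by (rule preadditive_category_Ab)
  show "kernel_cokernel_category (Ab :: ('u monoid, 'u abarr) addcat)"
  proof
    fix f :: "'u abarr" assume "f \<in> Arr Ab"
    then have f: "f \<in> Mor Ab (Dom Ab f) (Cod Ab f)"
      by (rule Ab_in_Mor)
    show "\<exists>k. is_kernel Ab f k"
      by (rule Ab_kernel_exists[OF f]) blast
    show "\<exists>q. is_cokernel Ab f q"
      by (rule Ab_cokernel_exists[OF f]) blast
  qed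
qed

lemma Ab_kernel_elements:
  assumes k: "is_kernel Ab a k"
  shows "inj_on (ab_fun k) (carrier (Dom Ab k))"
    and "ab_fun k ` carrier (Dom Ab k) = {x \<in> carrier (Dom Ab a). ab_fun a x = \<one>\<^bsub>Cod Ab a\<^esub>}"
proof -
  note kD = Ab.kernelD[OF k]
  obtain k0 where k0: "is_kernel Ab a k0" "inj_on (ab_fun k0) (carrier (Dom Ab k0))"
    "ab_fun k0 ` carrier (Dom Ab k0) = {x \<in> carrier (Dom Ab a). ab_fun a x = \<one>\<^bsub>Cod Ab a\<^esub>}"
    by (rule Ab_kernel_exists[OF Ab_in_Mor[OF kD(1)]]) (rule that)
  note k0D = Ab.kernelD[OF k0(1)]
  obtain u where u: "u \<in> Arr Ab" "Dom Ab u = Dom Ab k0" "Cod Ab u = Dom Ab k" "k \<cdot>\<^bsub>Ab\<^esub> u = k0"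
    using Ab.kernel_factor[OF k k0D(2,3,4)] by blast
  obtain v where v: "v \<in> Arr Ab" "Dom Ab v = Dom Ab k" "Cod Ab v = Dom Ab k0" "k0 \<cdot>\<^bsub>Ab\<^esub> v = k"
    using Ab.kernel_factor[OF k0(1) kD(2,3,4)] by blast
  have uM: "u \<in> Mor Ab (Dom Ab k0) (Dom Ab k)" and vM: "v \<in> Mor Ab (Dom Ab k) (Dom Ab k0)"
    and kM: "k \<in> Mor Ab (Dom Ab k) (Dom Ab a)" and k0M: "k0 \<in> Mor Ab (Dom Ab k0) (Dom Ab a)"
    using u v kD k0D by (auto simp: Mor_def)
  have G: "comm_group (Dom Ab k)"
    using kM by (rule Ab_MorE)
  have "(k \<cdot>\<^bsub>Ab\<^esub> u) \<cdot>\<^bsub>Ab\<^esub> v = k \<cdot>\<^bsub>Ab\<^esub> Ident Ab (Dom Ab k)"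
    using u(4) v(4) kD(2) by simp
  then have "u \<cdot>\<^bsub>Ab\<^esub> v = Ident Ab (Dom Ab k)"
    by - (rule Ab.kernel_cancel[OF k], simp_all add: u(1-3) v(1-3) kD(1-3))
  then have uv: "ab_fun u (ab_fun v x) = x" if "x \<in> carrier (Dom Ab k)" for x
    using Ab_comp(2)[OF vM uM that] Ab_ident(2)[OF G that] by simp
  have kv: "ab_fun k x = ab_fun k0 (ab_fun v x)" if "x \<in> carrier (Dom Ab k)" for x
    using Ab_comp(2)[OF vM k0M that] v(4) by simp
  have ku: "ab_fun k0 x = ab_fun k (ab_fun u x)" if "x \<in> carrier (Dom Ab k0)" for x
    using Ab_comp(2)[OF uM kM that] u(4) by simp
  show "inj_on (ab_fun k) (carrier (Dom Ab k))"
  proof (rule inj_onI)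
    fix x y assume xy: "x \<in> carrier (Dom Ab k)" "y \<in> carrier (Dom Ab k)" "ab_fun k x = ab_fun k y"
    then have "ab_fun v x = ab_fun v y"
      using inj_onD[OF k0(2)] kv Ab_fun_closed[OF vM] by simp
    then show "x = y"
      using uv xy by metis
  qed
  show "ab_fun k ` carrier (Dom Ab k) = {x \<in> carrier (Dom Ab a). ab_fun a x = \<one>\<^bsub>Cod Ab a\<^esub>}"
    unfolding k0(3)[symmetric] using kv ku Ab_fun_closed[OF vM] Ab_fun_closed[OF uM]
    by (auto simp: image_iff) metis+
qed

lemma Ab_cokernel_elements:
  assumes q: "is_cokernel Ab a q"
  shows "ab_fun q ` carrier (Cod Ab a) = carrier (Cod Ab q)"
    and "\<And>x. x \<in> carrier (Cod Ab a) \<Longrightarrow>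
      ab_fun q x = \<one>\<^bsub>Cod Ab q\<^esub> \<longleftrightarrow> x \<in> ab_fun a ` carrier (Dom Ab a)"
proof -
  note qD = Ab.cokernelD[OF q]
  obtain q0 where q0: "is_cokernel Ab a q0" "ab_fun q0 ` carrier (Cod Ab a) = carrier (Cod Ab q0)"
    "\<And>x. x \<in> carrier (Cod Ab a) \<Longrightarrow> ab_fun q0 x = \<one>\<^bsub>Cod Ab q0\<^esub> \<longleftrightarrow> x \<in> ab_fun a ` carrier (Dom Ab a)"
    by (rule Ab_cokernel_exists[OF Ab_in_Mor[OF qD(1)]]) (rule that)
  note q0D = Ab.cokernelD[OF q0(1)]
  obtain u where u: "u \<in> Arr Ab" "Dom Ab u = Cod Ab q" "Cod Ab u = Cod Ab q0" "u \<cdot>\<^bsub>Ab\<^esub> q = q0"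
    using Ab.cokernel_factor[OF q q0D(2,3,4)] by blast
  obtain v where v: "v \<in> Arr Ab" "Dom Ab v = Cod Ab q0" "Cod Ab v = Cod Ab q" "v \<cdot>\<^bsub>Ab\<^esub> q0 = q"
    using Ab.cokernel_factor[OF q0(1) qD(2,3,4)] by blast
  have uM: "u \<in> Mor Ab (Cod Ab q) (Cod Ab q0)" and vM: "v \<in> Mor Ab (Cod Ab q0) (Cod Ab q)"
    and qM: "q \<in> Mor Ab (Cod Ab a) (Cod Ab q)" and q0M: "q0 \<in> Mor Ab (Cod Ab a) (Cod Ab q0)"
    using u v qD q0D by (auto simp: Mor_def)
  have G: "comm_group (Cod Ab q)"
    using qM by (rule Ab_MorE)
  have "v \<cdot>\<^bsub>Ab\<^esub> (u \<cdot>\<^bsub>Ab\<^esub> q) = Ident Ab (Cod Ab q) \<cdot>\<^bsub>Ab\<^esub> q"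
    using u(4) v(4) qD(2) by simp
  then have "v \<cdot>\<^bsub>Ab\<^esub> u = Ident Ab (Cod Ab q)"
    by - (rule Ab.cokernel_cancel[OF q], simp_all add: u(1-3) v(1-3) qD(1-3))
  then have vu: "ab_fun v (ab_fun u x) = x" if "x \<in> carrier (Cod Ab q)" for x
    using Ab_comp(2)[OF uM vM that] Ab_ident(2)[OF G that] by simp
  have qv: "ab_fun q x = ab_fun v (ab_fun q0 x)" if "x \<in> carrier (Cod Ab a)" for x
    using Ab_comp(2)[OF q0M vM that] v(4) by simp
  have qu: "ab_fun q0 x = ab_fun u (ab_fun q x)" if "x \<in> carrier (Cod Ab a)" for x
    using Ab_comp(2)[OF qM uM that] u(4) by simp
  show "ab_fun q ` carrier (Cod Ab a) = carrier (Cod Ab q)"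
  proof
    show "carrier (Cod Ab q) \<subseteq> ab_fun q ` carrier (Cod Ab a)"
    proof
      fix y assume y: "y \<in> carrier (Cod Ab q)"
      then have "ab_fun u y \<in> ab_fun q0 ` carrier (Cod Ab a)"
        using q0(2) Ab_fun_closed[OF uM] by simp
      then show "y \<in> ab_fun q ` carrier (Cod Ab a)"
        using vu[OF y] qv by force
    qed
  qed (use Ab_fun_closed[OF qM] in auto)
  show "ab_fun q x = \<one>\<^bsub>Cod Ab q\<^esub> \<longleftrightarrow> x \<in> ab_fun a ` carrier (Dom Ab a)" if x: "x \<in> carrier (Cod Ab a)" for x
    unfolding q0(3)[OF x, symmetric] using qv[OF x] qu[OF x] Ab_fun_one[OF uM] Ab_fun_one[OF vM] by metis
qed

section \<open>Complexes of abelian groups\<close>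

definition exact_at :: "('u monoid, 'u abarr) cpx \<Rightarrow> int \<Rightarrow> bool" where
  "exact_at P n \<longleftrightarrow> (\<forall>x \<in> carrier (cobj P n). ab_fun (cdif P n) x = \<one>\<^bsub>cobj P (n + 1)\<^esub> \<longrightarrow>
     x \<in> ab_fun (cdif P (n - 1)) ` carrier (cobj P (n - 1)))"

lemma Ab_zero_obj_iff:
  assumes G: "comm_group G"
  shows "is_zero_obj Ab G \<longleftrightarrow> carrier G = {\<one>\<^bsub>G\<^esub>}"
proof
  interpret G: comm_group G by fact
  assume "is_zero_obj Ab G"
  then have "\<exists>!f. f \<in> Mor Ab G G"
    using G by (auto simp: is_zero_obj_def Ab_def)
  then have "Ident Ab G = Zero Ab G G"
    by (rule ex1_eq) (use Ab_ident(1)[OF G] Ab_zero(1)[OF G G] in auto)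
  then have "x = \<one>\<^bsub>G\<^esub>" if "x \<in> carrier G" for x
    using Ab_ident(2)[OF G that] Ab_zero(2)[OF G G that] by simp
  then show "carrier G = {\<one>\<^bsub>G\<^esub>}"
    by auto
next
  assume triv: "carrier G = {\<one>\<^bsub>G\<^esub>}"
  show "is_zero_obj Ab G"
    unfolding is_zero_obj_def
  proof (intro conjI ballI)
    fix A :: "'a monoid" assume "A \<in> Obj Ab"
    then have A: "comm_group A"
      by (simp add: Ab_def)
    show "\<exists>!f. f \<in> Mor Ab A G"
    proof (rule ex1I[of _ "Zero Ab A G"])
      show "f = Zero Ab A G" if f: "f \<in> Mor Ab A G" for f
        by (rule Ab_eqI[OF f Ab_zero(1)[OF A G]]) (use Ab_fun_closed[OF f] triv in \<open>simp add: Ab_zero(2)[OF A G]\<close>)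
    qed (rule Ab_zero(1)[OF A G])
    show "\<exists>!f. f \<in> Mor Ab G A"
    proof (rule ex1I[of _ "Zero Ab G A"])
      show "f = Zero Ab G A" if f: "f \<in> Mor Ab G A" for f
        by (rule Ab_eqI[OF f Ab_zero(1)[OF G A]]) (use Ab_fun_one[OF f] triv in \<open>simp add: Ab_zero(2)[OF G A]\<close>)
    qed (rule Ab_zero(1)[OF G A])
  qed (use G in \<open>simp add: Ab_def\<close>)
qed

text \<open>
  The kernel and the cokernel that define cohomology are arbitrary ones; in terms of elements they are
  nevertheless an injection onto the cocycles and a surjection that kills exactly the coboundaries.
\<close>

lemma Ab_cohomologyE:
  assumes P: "is_cpx Ab P" and H: "is_cohomology Ab n P (k, q)"
  obtains b where "k \<in> Mor Ab (Dom Ab k) (cobj P n)" "b \<in> Mor Ab (cobj P (n - 1)) (Dom Ab k)"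
    "q \<in> Mor Ab (Dom Ab k) (Cod Ab q)" "inj_on (ab_fun k) (carrier (Dom Ab k))"
    "ab_fun k ` carrier (Dom Ab k) = {x \<in> carrier (cobj P n). ab_fun (cdif P n) x = \<one>\<^bsub>cobj P (n + 1)\<^esub>}"
    "\<And>w. w \<in> carrier (cobj P (n - 1)) \<Longrightarrow> ab_fun k (ab_fun b w) = ab_fun (cdif P (n - 1)) w"
    "ab_fun q ` carrier (Dom Ab k) = carrier (Cod Ab q)"
    "\<And>x. x \<in> carrier (Dom Ab k) \<Longrightarrow>
      ab_fun q x = \<one>\<^bsub>Cod Ab q\<^esub> \<longleftrightarrow> x \<in> ab_fun b ` carrier (cobj P (n - 1))"
proof -
  obtain b where b: "is_kernel Ab (cdif P n) k" "is_cokernel Ab b q" "k \<cdot>\<^bsub>Ab\<^esub> b = cdif P (n - 1)"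
    "k \<in> Arr Ab" "Cod Ab k = cobj P n" "b \<in> Arr Ab" "Dom Ab b = cobj P (n - 1)" "Cod Ab b = Dom Ab k"
    "q \<in> Arr Ab" "Dom Ab q = Dom Ab k"
    by (rule Ab.cohomologyE[OF P H]) (rule that)
  have M: "k \<in> Mor Ab (Dom Ab k) (cobj P n)" "b \<in> Mor Ab (cobj P (n - 1)) (Dom Ab k)"
    "q \<in> Mor Ab (Dom Ab k) (Cod Ab q)"
    using b by (auto simp: Mor_def)
  show ?thesis
    by (rule that[OF M])
      (use Ab_kernel_elements[OF b(1)] Ab_cokernel_elements[OF b(2)] Ab_comp(2)[OF M(2,1)] 
        in \<open>simp_all add: b Ab.cpxD[OF P]\<close>)
qed

lemma Ab_H_obj_zero_iff:
  assumes P: "is_cpx Ab P"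
  shows "is_zero_obj Ab (H_obj Ab n P) \<longleftrightarrow> exact_at P n"
proof -
  obtain k q where kq: "cohomology Ab n P = (k, q)"
    by (cases "cohomology Ab n P")
  obtain b where b: "k \<in> Mor Ab (Dom Ab k) (cobj P n)" "b \<in> Mor Ab (cobj P (n - 1)) (Dom Ab k)"
    "q \<in> Mor Ab (Dom Ab k) (Cod Ab q)" "inj_on (ab_fun k) (carrier (Dom Ab k))"
    "ab_fun k ` carrier (Dom Ab k) = {x \<in> carrier (cobj P n). ab_fun (cdif P n) x = \<one>\<^bsub>cobj P (n + 1)\<^esub>}"
    "\<And>w. w \<in> carrier (cobj P (n - 1)) \<Longrightarrow> ab_fun k (ab_fun b w) = ab_fun (cdif P (n - 1)) w"
    "ab_fun q ` carrier (Dom Ab k) = carrier (Cod Ab q)"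
    "\<And>x. x \<in> carrier (Dom Ab k) \<Longrightarrow>
      ab_fun q x = \<one>\<^bsub>Cod Ab q\<^esub> \<longleftrightarrow> x \<in> ab_fun b ` carrier (cobj P (n - 1))"
    by (rule Ab_cohomologyE[OF P Ab.is_cohomology_cohomology[OF P, of n, unfolded kq]]) (rule that)
  have G: "comm_group (Cod Ab q)"
    using b(3) by (rule Ab_MorE)
  interpret G: comm_group "Cod Ab q" by fact
  have "is_zero_obj Ab (H_obj Ab n P) \<longleftrightarrow> carrier (Cod Ab q) = {\<one>\<^bsub>Cod Ab q\<^esub>}"
    using Ab_zero_obj_iff[OF G] by (simp add: H_obj_def kq)
  also have "\<dots> \<longleftrightarrow> (\<forall>c \<in> carrier (Dom Ab k). ab_fun q c = \<one>\<^bsub>Cod Ab q\<^esub>)"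
    unfolding b(7)[symmetric] using G.one_closed b(7) by auto
  also have "\<dots> \<longleftrightarrow> (\<forall>c \<in> carrier (Dom Ab k). c \<in> ab_fun b ` carrier (cobj P (n - 1)))"
    using b(8) by simp
  also have "\<dots> \<longleftrightarrow> (\<forall>c \<in> carrier (Dom Ab k). ab_fun k c \<in> ab_fun (cdif P (n - 1)) ` carrier (cobj P (n - 1)))"
  proof (rule ball_cong[OF refl])
    fix c assume c: "c \<in> carrier (Dom Ab k)"
    have "c = ab_fun b w \<longleftrightarrow> ab_fun k c = ab_fun (cdif P (n - 1)) w" if "w \<in> carrier (cobj P (n - 1))" for w
      unfolding b(6)[OF that, symmetric] using b(4) c Ab_fun_closed[OF b(2) that] by (auto dest: inj_onD)
    then show "c \<in> ab_fun b ` carrier (cobj P (n - 1)) \<longleftrightarrow> 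
        ab_fun k c \<in> ab_fun (cdif P (n - 1)) ` carrier (cobj P (n - 1))"
      by (simp add: image_iff)
  qed
  also have "\<dots> \<longleftrightarrow> (\<forall>x \<in> ab_fun k ` carrier (Dom Ab k). x \<in> ab_fun (cdif P (n - 1)) ` carrier (cobj P (n - 1)))"
    by simp
  also have "\<dots> \<longleftrightarrow> exact_at P n"
    unfolding b(5) exact_at_def by blast
  finally show ?thesis .
qed

text \<open>
  These two statements are surjectivity and injectivity of the map on cohomology, expressed by
  cocycles.
\<close>

lemma Ab_quasi_iso_elements:
  assumes X: "is_cpx Ab X" and Y: "is_cpx Ab Y" and f: "quasi_iso Ab X Y f"
  shows "\<And>y. \<lbrakk>y \<in> carrier (cobj Y n); ab_fun (cdif Y n) y = \<one>\<^bsub>cobj Y (n + 1)\<^esub>\<rbrakk> \<Longrightarrow>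
      \<exists>x \<in> carrier (cobj X n). \<exists>w \<in> carrier (cobj Y (n - 1)).
        ab_fun (cdif X n) x = \<one>\<^bsub>cobj X (n + 1)\<^esub> \<and>
        y = ab_fun (cdif Y (n - 1)) w \<otimes>\<^bsub>cobj Y n\<^esub> ab_fun (f n) x"
    and "\<And>x. \<lbrakk>x \<in> carrier (cobj X n); ab_fun (cdif X n) x = \<one>\<^bsub>cobj X (n + 1)\<^esub>;
      ab_fun (f n) x \<in> ab_fun (cdif Y (n - 1)) ` carrier (cobj Y (n - 1))\<rbrakk> \<Longrightarrow>
      x \<in> ab_fun (cdif X (n - 1)) ` carrier (cobj X (n - 1))"
proof -
  obtain k q k' q' z h where H: "is_cohomology Ab n X (k, q)" "is_cohomology Ab n Y (k', q')"
    "z \<in> Arr Ab" "Dom Ab z = Dom Ab k" "Cod Ab z = Dom Ab k'" "k' \<cdot>\<^bsub>Ab\<^esub> z = f n \<cdot>\<^bsub>Ab\<^esub> k"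
    "h \<in> Arr Ab" "Dom Ab h = Cod Ab q" "Cod Ab h = Cod Ab q'" "h \<cdot>\<^bsub>Ab\<^esub> q = q' \<cdot>\<^bsub>Ab\<^esub> z" "is_iso Ab h"
    by (rule Ab.quasi_isoE[OF X Y f, of n]) (rule that)
  obtain b where b: "k \<in> Mor Ab (Dom Ab k) (cobj X n)" "b \<in> Mor Ab (cobj X (n - 1)) (Dom Ab k)"
    "q \<in> Mor Ab (Dom Ab k) (Cod Ab q)" "inj_on (ab_fun k) (carrier (Dom Ab k))"
    "ab_fun k ` carrier (Dom Ab k) = {x \<in> carrier (cobj X n). ab_fun (cdif X n) x = \<one>\<^bsub>cobj X (n + 1)\<^esub>}"
    "\<And>w. w \<in> carrier (cobj X (n - 1)) \<Longrightarrow> ab_fun k (ab_fun b w) = ab_fun (cdif X (n - 1)) w"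
    "ab_fun q ` carrier (Dom Ab k) = carrier (Cod Ab q)"
    "\<And>x. x \<in> carrier (Dom Ab k) \<Longrightarrow>
      ab_fun q x = \<one>\<^bsub>Cod Ab q\<^esub> \<longleftrightarrow> x \<in> ab_fun b ` carrier (cobj X (n - 1))"
    by (rule Ab_cohomologyE[OF X H(1)]) (rule that)
  obtain b' where b': "k' \<in> Mor Ab (Dom Ab k') (cobj Y n)" "b' \<in> Mor Ab (cobj Y (n - 1)) (Dom Ab k')"
    "q' \<in> Mor Ab (Dom Ab k') (Cod Ab q')" "inj_on (ab_fun k') (carrier (Dom Ab k'))"
    "ab_fun k' ` carrier (Dom Ab k') = {x \<in> carrier (cobj Y n). ab_fun (cdif Y n) x = \<one>\<^bsub>cobj Y (n + 1)\<^esub>}"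
    "\<And>w. w \<in> carrier (cobj Y (n - 1)) \<Longrightarrow> ab_fun k' (ab_fun b' w) = ab_fun (cdif Y (n - 1)) w"
    "ab_fun q' ` carrier (Dom Ab k') = carrier (Cod Ab q')"
    "\<And>x. x \<in> carrier (Dom Ab k') \<Longrightarrow>
      ab_fun q' x = \<one>\<^bsub>Cod Ab q'\<^esub> \<longleftrightarrow> x \<in> ab_fun b' ` carrier (cobj Y (n - 1))"
    by (rule Ab_cohomologyE[OF Y H(2)]) (rule that)
  have fc: "f n \<in> Mor Ab (cobj X n) (cobj Y n)"
    using f by (simp add: quasi_iso_def chain_map_def)
  have z: "z \<in> Mor Ab (Dom Ab k) (Dom Ab k')" and h: "h \<in> Mor Ab (Cod Ab q) (Cod Ab q')"
    using H by (auto simp: Mor_def)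
  have kz: "ab_fun k' (ab_fun z c) = ab_fun (f n) (ab_fun k c)" if "c \<in> carrier (Dom Ab k)" for c
    using Ab_comp(2)[OF z b'(1) that] Ab_comp(2)[OF b(1) fc that] H(6) by simp
  have hq: "ab_fun h (ab_fun q c) = ab_fun q' (ab_fun z c)" if "c \<in> carrier (Dom Ab k)" for c
    using Ab_comp(2)[OF z b'(3) that] Ab_comp(2)[OF b(3) h that] H(10) by simp
  obtain h' where h': "h' \<in> Mor Ab (Cod Ab q') (Cod Ab q)" "h' \<cdot>\<^bsub>Ab\<^esub> h = Ident Ab (Cod Ab q)"
    "h \<cdot>\<^bsub>Ab\<^esub> h' = Ident Ab (Cod Ab q')"
    using H(8,9,11) by (auto simp: is_iso_def inverse_arrows_def)
  have grp: "comm_group (Cod Ab q)" "comm_group (Cod Ab q')" "comm_group (Dom Ab k')" "comm_group (cobj Y n)"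
    using h b'(1) by (auto elim: Ab_MorE)
  interpret Hq': comm_group "Cod Ab q'" by (rule grp)
  interpret Z': comm_group "Dom Ab k'" by (rule grp)
  interpret Y: comm_group "cobj Y n" by (rule grp)
  have h'h: "ab_fun h' (ab_fun h e) = e" if "e \<in> carrier (Cod Ab q)" for e
    using Ab_comp(2)[OF h h'(1) that] Ab_ident(2)[OF grp(1) that] h'(2) by simp
  have hh': "ab_fun h (ab_fun h' e) = e" if "e \<in> carrier (Cod Ab q')" for e
    using Ab_comp(2)[OF h'(1) h that] Ab_ident(2)[OF grp(2) that] h'(3) by simp
  {
    fix y assume y: "y \<in> carrier (cobj Y n)" "ab_fun (cdif Y n) y = \<one>\<^bsub>cobj Y (n + 1)\<^esub>"
    then have "y \<in> ab_fun k' ` carrier (Dom Ab k')"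
      unfolding b'(5) by blast
    then obtain c' where c': "c' \<in> carrier (Dom Ab k')" "y = ab_fun k' c'"
      by blast
    note q'c' = Ab_fun_closed[OF b'(3) c'(1)]
    have "ab_fun h' (ab_fun q' c') \<in> ab_fun q ` carrier (Dom Ab k)"
      unfolding b(7) by (rule Ab_fun_closed[OF h'(1) q'c'])
    then obtain c where c: "c \<in> carrier (Dom Ab k)" "ab_fun h' (ab_fun q' c') = ab_fun q c"
      by blast
    note zc = Ab_fun_closed[OF z c(1)]
    have "ab_fun q' (ab_fun z c) = ab_fun q' c'"
      using hq[OF c(1)] hh'[OF q'c'] c(2) by simp
    then have "ab_fun q' (c' \<otimes>\<^bsub>Dom Ab k'\<^esub> inv\<^bsub>Dom Ab k'\<^esub> ab_fun z c) = \<one>\<^bsub>Cod Ab q'\<^esub>"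
      using c'(1) zc q'c' by (simp add: Ab_fun_mult[OF b'(3)] Ab_fun_inv[OF b'(3)])
    then obtain w where w: "w \<in> carrier (cobj Y (n - 1))" 
      "c' \<otimes>\<^bsub>Dom Ab k'\<^esub> inv\<^bsub>Dom Ab k'\<^esub> ab_fun z c = ab_fun b' w"
      using b'(8)[of "c' \<otimes>\<^bsub>Dom Ab k'\<^esub> inv\<^bsub>Dom Ab k'\<^esub> ab_fun z c"] c'(1) zc by auto
    have b'w: "ab_fun b' w \<in> carrier (Dom Ab k')"
      using Ab_fun_closed[OF b'(2) w(1)] .
    have "c' = ab_fun b' w \<otimes>\<^bsub>Dom Ab k'\<^esub> ab_fun z c"
      unfolding w(2)[symmetric] using c'(1) zc by (simp add: Z'.m_assoc)
    then have "y = ab_fun (cdif Y (n - 1)) w \<otimes>\<^bsub>cobj Y n\<^esub> ab_fun (f n) (ab_fun k c)"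
      using c'(2) b'(6)[OF w(1)] kz[OF c(1)] Ab_fun_mult[OF b'(1) b'w zc] by simp
    moreover have "ab_fun k c \<in> carrier (cobj X n)" "ab_fun (cdif X n) (ab_fun k c) = \<one>\<^bsub>cobj X (n + 1)\<^esub>"
      using b(5) c(1) by blast+
    ultimately show "\<exists>x \<in> carrier (cobj X n). \<exists>w \<in> carrier (cobj Y (n - 1)).
        ab_fun (cdif X n) x = \<one>\<^bsub>cobj X (n + 1)\<^esub> \<and>
        y = ab_fun (cdif Y (n - 1)) w \<otimes>\<^bsub>cobj Y n\<^esub> ab_fun (f n) x"
      using w(1) by blast
  }
  {
    fix x assume x: "x \<in> carrier (cobj X n)" "ab_fun (cdif X n) x = \<one>\<^bsub>cobj X (n + 1)\<^esub>"
      "ab_fun (f n) x \<in> ab_fun (cdif Y (n - 1)) ` carrier (cobj Y (n - 1))"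
    then have "x \<in> ab_fun k ` carrier (Dom Ab k)"
      unfolding b(5) by blast
    then obtain c where c: "c \<in> carrier (Dom Ab k)" "x = ab_fun k c"
      by blast
    obtain w where w: "w \<in> carrier (cobj Y (n - 1))" "ab_fun (f n) x = ab_fun (cdif Y (n - 1)) w"
      using x(3) by blast
    have zc: "ab_fun z c \<in> carrier (Dom Ab k')"
      by (rule Ab_fun_closed[OF z c(1)])
    have "ab_fun k' (ab_fun z c) = ab_fun k' (ab_fun b' w)"
      using kz[OF c(1)] w(2) b'(6)[OF w(1)] c(2) by simp
    then have "ab_fun z c = ab_fun b' w"
      using b'(4) zc Ab_fun_closed[OF b'(2) w(1)] by (auto dest: inj_onD)
    then have "ab_fun q' (ab_fun z c) = \<one>\<^bsub>Cod Ab q'\<^esub>"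
      using b'(8)[OF zc] w(1) by blast
    then have "ab_fun h (ab_fun q c) = \<one>\<^bsub>Cod Ab q'\<^esub>"
      using hq[OF c(1)] by simp
    then have "ab_fun q c = \<one>\<^bsub>Cod Ab q\<^esub>"
      using h'h[OF Ab_fun_closed[OF b(3) c(1)]] Ab_fun_one[OF h'(1)] by simp
    then obtain v where v: "v \<in> carrier (cobj X (n - 1))" "c = ab_fun b v"
      using b(8)[OF c(1)] by blast
    then show "x \<in> ab_fun (cdif X (n - 1)) ` carrier (cobj X (n - 1))"
      using c(2) b(6)[OF v(1)] by simp
  }
qed

text \<open>
  The isomorphism gives quasi-isomorphisms \<open>v : M \<rightarrow> P\<close> and \<open>t : B \<rightarrow> Q\<close> such that \<open>v\<close> factors through \<open>B\<close>
  up to homotopy. As \<open>Q\<close> is exact in degree \<open>n\<close>, so is \<open>B\<close>, and \<open>v\<close> maps cocycles of degree \<open>n\<close> to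
  coboundaries; but up to coboundaries these images are all cocycles of \<open>P\<close>.
\<close>

lemma exact_at_isomorphic:
  assumes iso: "isomorphic D_Ab P Q" and P: "P \<in> complexes Ab" and Q: "Q \<in> complexes Ab"
    and exact: "exact_at Q n"
  shows "exact_at P n"
  unfolding exact_at_def
proof (intro ballI impI)
  fix y assume y: "y \<in> carrier (cobj P n)" "ab_fun (cdif P n) y = \<one>\<^bsub>cobj P (n + 1)\<^esub>"
  obtain M B v w t g where R: "M \<in> complexes Ab" "B \<in> complexes Ab" "quasi_iso Ab M P v" "chain_map Ab M B w"
    "chain_map Ab B P g" "quasi_iso Ab B Q t" "homotopic Ab M P v (\<lambda>n. g n \<cdot>\<^bsub>Ab\<^esub> w n)"
    by (rule Ab.isomorphic_D_catE[OF subset_refl iso P]) (rule that)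
  have c: "is_cpx Ab P" "is_cpx Ab Q" "is_cpx Ab M" "is_cpx Ab B"
    using P Q R by (auto simp: complexes_def)
  obtain h where h: "\<And>n. h n \<in> Mor Ab (cobj M n) (cobj P (n - 1))" 
    "\<And>n. v n = (g n \<cdot>\<^bsub>Ab\<^esub> w n) \<oplus>\<^bsub>Ab\<^esub> ((cdif P (n - 1) \<cdot>\<^bsub>Ab\<^esub> h n) \<oplus>\<^bsub>Ab\<^esub> (h (n + 1) \<cdot>\<^bsub>Ab\<^esub> cdif M n))"
    using R(7) unfolding homotopic_def by blast
  have d: "cdif X n \<in> Mor Ab (cobj X n) (cobj X (n + 1))" if "is_cpx Ab X" for X n
    using that by (simp add: is_cpx_def)
  have d': "cdif X (n - 1) \<in> Mor Ab (cobj X (n - 1)) (cobj X n)" if "is_cpx Ab X" for X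
    using d[OF that, of "n - 1"] by simp
  have map: "f n \<in> Mor Ab (cobj X n) (cobj Y n)" 
    "x \<in> carrier (cobj X n) \<Longrightarrow> ab_fun (cdif Y n) (ab_fun (f n) x) = ab_fun (f (n + 1)) (ab_fun (cdif X n) x)" 
    if "chain_map Ab X Y f" "is_cpx Ab X" "is_cpx Ab Y" for X Y f x n
  proof -
    have f: "f n \<in> Mor Ab (cobj X n) (cobj Y n)" for n
      using that(1) by (simp add: chain_map_def)
    then show "f n \<in> Mor Ab (cobj X n) (cobj Y n)" .
    have e: "cdif Y n \<cdot>\<^bsub>Ab\<^esub> f n = f (n + 1) \<cdot>\<^bsub>Ab\<^esub> cdif X n"
      using that(1) by (simp add: chain_map_def)
    show "ab_fun (cdif Y n) (ab_fun (f n) x) = ab_fun (f (n + 1)) (ab_fun (cdif X n) x)" if "x \<in> carrier (cobj X n)"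
      using Ab_comp(2)[OF f d[OF \<open>is_cpx Ab Y\<close>] that] Ab_comp(2)[OF d[OF \<open>is_cpx Ab X\<close>] f that] e by simp
  qed
  note g = map[OF R(5) c(4,1)] and w = map[OF R(4) c(3,4)]
  have P_grp: "comm_group (cobj P m)" for m
    using d[OF c(1)] by (rule Ab_MorE)
  interpret P: comm_group "cobj P n" by (rule P_grp)
  interpret P': comm_group "cobj P (n - 1)" by (rule P_grp)
  \<comment> \<open>A cocycle of \<open>P\<close> comes from \<open>M\<close> up to a coboundary and hence, up to a coboundary, from \<open>B\<close>.\<close>
  obtain x e where x: "x \<in> carrier (cobj M n)" "ab_fun (cdif M n) x = \<one>\<^bsub>cobj M (n + 1)\<^esub>"
    and e: "e \<in> carrier (cobj P (n - 1))" "y = ab_fun (cdif P (n - 1)) e \<otimes>\<^bsub>cobj P n\<^esub> ab_fun (v n) x"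
    using Ab_quasi_iso_elements(1)[OF c(3,1) R(3) y] by blast
  note wx = Ab_fun_closed[OF w(1) x(1)]
  have "ab_fun (cdif B n) (ab_fun (w n) x) = \<one>\<^bsub>cobj B (n + 1)\<^esub>"
    using w(2)[OF x(1)] x(2) Ab_fun_one[OF w(1)] by simp
  moreover have "ab_fun (cdif B n) (ab_fun (w n) x) = \<one>\<^bsub>cobj B (n + 1)\<^esub> \<Longrightarrow>
      ab_fun (t n) (ab_fun (w n) x) \<in> ab_fun (cdif Q (n - 1)) ` carrier (cobj Q (n - 1))"
  proof -
    assume a: "ab_fun (cdif B n) (ab_fun (w n) x) = \<one>\<^bsub>cobj B (n + 1)\<^esub>"
    have "chain_map Ab B Q t"
      using R(6) by (simp add: quasi_iso_def)
    note t = map[OF this c(4,2)]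
    have "ab_fun (cdif Q n) (ab_fun (t n) (ab_fun (w n) x)) = \<one>\<^bsub>cobj Q (n + 1)\<^esub>"
      using t(2)[OF wx] a Ab_fun_one[OF t(1)] by simp
    then show ?thesis
      using exact Ab_fun_closed[OF t(1) wx] unfolding exact_at_def by blast
  qed
  ultimately have "ab_fun (w n) x \<in> ab_fun (cdif B (n - 1)) ` carrier (cobj B (n - 1))"
    using Ab_quasi_iso_elements(2)[OF c(4,2) R(6) wx] by blast
  then obtain b where b: "b \<in> carrier (cobj B (n - 1))" "ab_fun (w n) x = ab_fun (cdif B (n - 1)) b"
    by blast
  have gb: "ab_fun (g (n - 1)) b \<in> carrier (cobj P (n - 1))"
    by (rule Ab_fun_closed[OF g(1) b(1)])
  have gwx: "ab_fun (g n) (ab_fun (w n) x) = ab_fun (cdif P (n - 1)) (ab_fun (g (n - 1)) b)"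
    using g(2)[OF b(1)] b(2) by simp
  note hx = Ab_fun_closed[OF h(1) x(1)]
  have h1: "h (n + 1) \<in> Mor Ab (cobj M (n + 1)) (cobj P n)"
    using h(1)[of "n + 1"] by simp
  note gw = Ab_comp[OF w(1) g(1)] and dh = Ab_comp[OF h(1) d'[OF c(1)]] and hd = Ab_comp[OF d[OF c(3)] h1]
  have "ab_fun (v n) x = ab_fun (g n) (ab_fun (w n) x) \<otimes>\<^bsub>cobj P n\<^esub>
      (ab_fun (cdif P (n - 1)) (ab_fun (h n) x) \<otimes>\<^bsub>cobj P n\<^esub> ab_fun (h (n + 1)) (ab_fun (cdif M n) x))"
    unfolding h(2) using Ab_add(2)[OF gw(1) Ab_add(1)[OF dh(1) hd(1)] x(1)] 
      Ab_add(2)[OF dh(1) hd(1) x(1)] gw(2)[OF x(1)] dh(2)[OF x(1)] hd(2)[OF x(1)] by simp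
  also have "\<dots> = ab_fun (cdif P (n - 1)) (ab_fun (g (n - 1)) b) \<otimes>\<^bsub>cobj P n\<^esub> ab_fun (cdif P (n - 1)) (ab_fun (h n) x)"
    using x(2) Ab_fun_one[OF h1] gwx Ab_fun_closed[OF d'[OF c(1)] hx] by simp
  finally have "y = ab_fun (cdif P (n - 1)) (e \<otimes>\<^bsub>cobj P (n - 1)\<^esub> (ab_fun (g (n - 1)) b \<otimes>\<^bsub>cobj P (n - 1)\<^esub> ab_fun (h n) x))"
    using e gb hx by (simp add: Ab_fun_mult[OF d'[OF c(1)]])
  then show "y \<in> ab_fun (cdif P (n - 1)) ` carrier (cobj P (n - 1))"
    using e(1) gb hx by blast
qed

section \<open>Vanishing of Ext groups\<close>

lemma tr_group_simps:
  assumes "inj \<iota>"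
  shows "carrier (tr_group \<iota> G) = \<iota> ` carrier G" "\<iota> x \<otimes>\<^bsub>tr_group \<iota> G\<^esub> \<iota> y = \<iota> (x \<otimes>\<^bsub>G\<^esub> y)"
    "\<one>\<^bsub>tr_group \<iota> G\<^esub> = \<iota> \<one>\<^bsub>G\<^esub>"
  using assms by (simp_all add: tr_group_def)

lemma comm_group_tr_group:
  assumes \<iota>: "inj \<iota>" and "comm_group G"
  shows "comm_group (tr_group \<iota> G)"
proof -
  interpret G: comm_group G by fact
  note simps = tr_group_simps[OF \<iota>]
  show ?thesis
  proof (rule comm_groupI)
    fix x assume "x \<in> carrier (tr_group \<iota> G)"
    then obtain x' where "x' \<in> carrier G" "x = \<iota> x'"
      by (auto simp: simps)
    then show "\<exists>y\<in>carrier (tr_group \<iota> G). y \<otimes>\<^bsub>tr_group \<iota> G\<^esub> x = \<one>\<^bsub>tr_group \<iota> G\<^esub>"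
      by (intro bexI[of _ "\<iota> (inv\<^bsub>G\<^esub> x')"]) (auto simp: simps)
  qed (auto simp: simps G.m_ac)
qed

lemma tr_map_Mor:
  assumes \<iota>: "inj \<iota>" and G: "comm_group G" and H: "comm_group H" and f: "f \<in> hom G H"
  shows "tr_map \<iota> G H f \<in> Mor Ab (tr_group \<iota> G) (tr_group \<iota> H)"
    and "x \<in> carrier G \<Longrightarrow> ab_fun (tr_map \<iota> G H f) (\<iota> x) = \<iota> (f x)"
proof -
  note simps = tr_group_simps[OF \<iota>]
  have "(\<lambda>x. \<iota> (f (inv_into UNIV \<iota> x))) \<in> hom (tr_group \<iota> G) (tr_group \<iota> H)"
    using f \<iota> by (auto simp: hom_def simps Pi_iff)
  from Ab_MorI[OF comm_group_tr_group[OF \<iota> G] comm_group_tr_group[OF \<iota> H] this]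
  show "tr_map \<iota> G H f \<in> Mor Ab (tr_group \<iota> G) (tr_group \<iota> H)"
    by (simp add: tr_map_def simps)
  show "x \<in> carrier G \<Longrightarrow> ab_fun (tr_map \<iota> G H f) (\<iota> x) = \<iota> (f x)"
    using \<iota> by (simp add: tr_map_def)
qed

text \<open>
  The sign \<open>(-1)\<^sup>i\<close> of the differential of \<open>I[i]\<close> matches the one in \<open>Hom(X, I)\<close>: the cocycles of degree
  \<open>i\<close> are precisely the chain maps from \<open>X\<close> to \<open>I[i]\<close>, and the coboundaries the null-homotopic ones.
\<close>

definition signed_shift :: "('o, 'm, 'z) addcat_scheme \<Rightarrow> int \<Rightarrow> ('o, 'm) cpx \<Rightarrow> ('o, 'm) cpx" where
  "signed_shift C i I = \<lparr>cobj = (\<lambda>n. cobj I (n + i)),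
     cdif = (\<lambda>n. if even i then cdif I (n + i) else Neg C (cdif I (n + i)))\<rparr>"

context preadditive_category
begin

lemma hom_group_simps:
  "\<phi> \<in> carrier (hom_group C X Y n) \<longleftrightarrow>
     (\<forall>p. \<phi> p \<in> Arr C \<and> Dom C (\<phi> p) = cobj X p \<and> Cod C (\<phi> p) = cobj Y (p + n))"
  "\<phi> \<otimes>\<^bsub>hom_group C X Y n\<^esub> \<psi> = (\<lambda>p. \<phi> p \<oplus> \<psi> p)"
  "\<one>\<^bsub>hom_group C X Y n\<^esub> = (\<lambda>p. Zero C (cobj X p) (cobj Y (p + n)))"
  by (auto simp: hom_group_def Mor_def)

context
  fixes X Y
  assumes X: "is_cpx C X" and Y: "is_cpx C Y"
begin

lemmas XYD = cpxD(1-4)[OF X] cpxD(1-4)[OF Y]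

lemma comm_group_hom_group: "comm_group (hom_group C X Y n)"
proof (rule comm_groupI)
  fix \<phi> assume \<phi>: "\<phi> \<in> carrier (hom_group C X Y n)"
  then show "\<exists>\<psi>\<in>carrier (hom_group C X Y n). \<psi> \<otimes>\<^bsub>hom_group C X Y n\<^esub> \<phi> = \<one>\<^bsub>hom_group C X Y n\<^esub>"
    by (intro bexI[of _ "\<lambda>p. Neg C (\<phi> p)"]) (auto simp: hom_group_simps)
qed (auto simp: hom_group_simps XYD add_assoc intro!: add_commute)

lemma hom_dif_even: "even n \<Longrightarrow> hom_dif C X Y n \<phi> p =
    cdif Y (p + n) \<cdot> \<phi> p \<oplus> Neg C (\<phi> (p + 1) \<cdot> cdif X p)"
  by (simp add: hom_dif_def Let_def)

lemma hom_dif_odd: "odd n \<Longrightarrow> hom_dif C X Y n \<phi> p = cdif Y (p + n) \<cdot> \<phi> p \<oplus> \<phi> (p + 1) \<cdot> cdif X p"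
  by (simp add: hom_dif_def Let_def)

lemma hom_dif_hom: "hom_dif C X Y n \<in> hom (hom_group C X Y n) (hom_group C X Y (n + 1))"
proof -
  have idx: "p + 1 + n = p + n + 1" "p + (n + 1) = p + n + 1" for p
    by simp_all
  show ?thesis
    by (cases "even n")
      (auto simp: hom_def hom_group_simps hom_dif_even hom_dif_odd XYD idx fun_eq_iff add_ac)
qed

lemma hom_dif_hom_dif:
  assumes \<phi>: "\<phi> \<in> carrier (hom_group C X Y n)"
  shows "hom_dif C X Y (n + 1) (hom_dif C X Y n \<phi>) = \<one>\<^bsub>hom_group C X Y (n + 1 + 1)\<^esub>"
proof
  fix p
  have idx: "p + 1 + n = p + n + 1" "p + (n + 1) = p + n + 1" for p
    by simp_all
  have \<phi>D: "\<phi> p \<in> Arr C" "Dom C (\<phi> p) = cobj X p" "Cod C (\<phi> p) = cobj Y (p + n)" for p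
    using \<phi> by (auto simp: hom_group_simps)
  have idx2: "p + n + 1 + 1 = p + n + 2" "2 + p = p + 2" "2 + (p + n) = p + n + 2" "p + 2 + n = p + n + 2"
    by simp_all
  have dd: "cdif Y (p + n + 1) \<cdot> (cdif Y (p + n) \<cdot> \<phi> p) = Zero C (cobj X p) (cobj Y (p + n + 2))"
    using cdif_cdif[OF Y \<phi>D(1,3) refl, of p] by (simp add: \<phi>D)
  have dd': "\<phi> (p + 1 + 1) \<cdot> (cdif X (p + 1) \<cdot> cdif X p) = Zero C (cobj X p) (cobj Y (p + n + 2))"
    unfolding cpxD(5)[OF X] by (simp add: \<phi>D XYD idx2)
  have "\<one>\<^bsub>hom_group C X Y (n + 1 + 1)\<^esub> p = Zero C (cobj X p) (cobj Y (p + n + 2))"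
    by (simp add: hom_group_simps algebra_simps)
  moreover have "hom_dif C X Y (n + 1) (hom_dif C X Y n \<phi>) p = Zero C (cobj X p) (cobj Y (p + n + 2))"
    using dd dd' by (cases "even n") (simp_all add: hom_dif_even hom_dif_odd XYD \<phi>D idx idx2)
  ultimately show "hom_dif C X Y (n + 1) (hom_dif C X Y n \<phi>) p = \<one>\<^bsub>hom_group C X Y (n + 1 + 1)\<^esub> p"
    by simp
qed

lemma is_cpx_hom_cpx:
  assumes \<iota>: "inj \<iota>"
  shows "is_cpx Ab (hom_cpx \<iota> C X Y)"
  unfolding is_cpx_def
proof (intro allI conjI)
  fix n
  let ?H = "hom_cpx \<iota> C X Y"
  note d = tr_map_Mor[OF \<iota> comm_group_hom_group comm_group_hom_group hom_dif_hom]
  have grp: "comm_group (cobj ?H n)" for n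
    by (simp add: hom_cpx_def comm_group_tr_group[OF \<iota> comm_group_hom_group])
  then show "cobj ?H n \<in> Obj Ab"
    by (simp add: Ab_def)
  have M: "cdif ?H n \<in> Mor Ab (cobj ?H n) (cobj ?H (n + 1))" for n
    using d(1) by (simp add: hom_cpx_def)
  then show "cdif ?H n \<in> Mor Ab (cobj ?H n) (cobj ?H (n + 1))" .
  have "cdif ?H (n + 1) \<cdot>\<^bsub>Ab\<^esub> cdif ?H n = Zero Ab (cobj ?H n) (cobj ?H (n + 1 + 1))"
  proof (rule Ab_eqI[OF Ab_comp(1)[OF M M] Ab_zero(1)[OF grp grp]])
    fix x assume x: "x \<in> carrier (cobj ?H n)"
    then obtain \<phi> where \<phi>: "\<phi> \<in> carrier (hom_group C X Y n)" "x = \<iota> \<phi>"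
      by (auto simp: hom_cpx_def tr_group_simps[OF \<iota>])
    have d\<phi>: "hom_dif C X Y n \<phi> \<in> carrier (hom_group C X Y (n + 1))"
      using hom_dif_hom \<phi>(1) by (auto simp: hom_def)
    have "ab_fun (cdif ?H (n + 1)) (ab_fun (cdif ?H n) x) =
        \<iota> (hom_dif C X Y (n + 1) (hom_dif C X Y n \<phi>))"
      using d(2)[OF \<phi>(1)] d(2)[OF d\<phi>] by (simp add: hom_cpx_def \<phi>(2))
    also have "\<dots> = \<one>\<^bsub>cobj ?H (n + 1 + 1)\<^esub>"
      unfolding hom_dif_hom_dif[OF \<phi>(1)] by (simp add: hom_cpx_def tr_group_simps[OF \<iota>])
    finally show "ab_fun (cdif ?H (n + 1) \<cdot>\<^bsub>Ab\<^esub> cdif ?H n) x = ab_fun (Zero Ab (cobj ?H n) (cobj ?H (n + 1 + 1))) x"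
      unfolding Ab_comp(2)[OF M M x] Ab_zero(2)[OF grp grp x] .
  qed
  then show "cdif ?H (n + 1) \<cdot>\<^bsub>Ab\<^esub> cdif ?H n = Zero Ab (cobj ?H n) (cobj ?H (n + 2))"
    by (simp add: add.assoc)
qed

lemma exact_at_hom_cpx_iff:
  assumes \<iota>: "inj \<iota>"
  shows "exact_at (hom_cpx \<iota> C X Y) n \<longleftrightarrow>
    (\<forall>\<phi> \<in> carrier (hom_group C X Y n). hom_dif C X Y n \<phi> = \<one>\<^bsub>hom_group C X Y (n + 1)\<^esub> \<longrightarrow>
      \<phi> \<in> hom_dif C X Y (n - 1) ` carrier (hom_group C X Y (n - 1)))"
proof -
  let ?H = "hom_cpx \<iota> C X Y"
  note d = tr_map_Mor(2)[OF \<iota> comm_group_hom_group comm_group_hom_group hom_dif_hom]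
  have c: "carrier (cobj ?H m) = \<iota> ` carrier (hom_group C X Y m)" "\<one>\<^bsub>cobj ?H m\<^esub> = \<iota> \<one>\<^bsub>hom_group C X Y m\<^esub>" for m
    by (simp_all add: hom_cpx_def tr_group_simps[OF \<iota>])
  have f: "ab_fun (cdif ?H m) (\<iota> \<phi>) = \<iota> (hom_dif C X Y m \<phi>)" if "\<phi> \<in> carrier (hom_group C X Y m)" for m \<phi>
    using d[OF that] by (simp add: hom_cpx_def)
  have im: "ab_fun (cdif ?H m) ` carrier (cobj ?H m) = \<iota> ` hom_dif C X Y m ` carrier (hom_group C X Y m)" for m
    unfolding c image_image using f by (intro image_cong) auto
  show ?thesis
    unfolding exact_at_def im using \<iota> by (auto simp: c f inj_eq inj_image_mem_iff)
qed

lemma is_cpx_signed_shift: "is_cpx C (signed_shift C i Y)"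
  unfolding is_cpx_def
proof (intro allI conjI)
  fix n
  have idx: "n + 1 + i = n + i + 1" "n + 2 + i = n + i + 2"
    by simp_all
  show "cobj (signed_shift C i Y) n \<in> Obj C"
    by (simp add: signed_shift_def XYD)
  show "cdif (signed_shift C i Y) n \<in> Mor C (cobj (signed_shift C i Y) n) (cobj (signed_shift C i Y) (n + 1))"
    by (simp add: signed_shift_def XYD Mor_def idx)
  show "cdif (signed_shift C i Y) (n + 1) \<cdot> cdif (signed_shift C i Y) n =
    Zero C (cobj (signed_shift C i Y) n) (cobj (signed_shift C i Y) (n + 2))"
    using cpxD(5)[OF Y, of "n + i"] by (simp add: signed_shift_def XYD idx)
qed

lemma chain_map_signed_shift_iff:
  "chain_map C X (signed_shift C n Y) \<phi> \<longleftrightarrow> 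
    \<phi> \<in> carrier (hom_group C X Y n) \<and> hom_dif C X Y n \<phi> = \<one>\<^bsub>hom_group C X Y (n + 1)\<^esub>"
proof (cases "\<phi> \<in> carrier (hom_group C X Y n)")
  case True
  then have \<phi>D: "\<phi> p \<in> Arr C" "Dom C (\<phi> p) = cobj X p" "Cod C (\<phi> p) = cobj Y (p + n)" for p
    by (auto simp: hom_group_simps)
  have idx: "p + 1 + n = p + n + 1" "p + (n + 1) = p + n + 1" for p
    by simp_all
  have "cdif (signed_shift C n Y) p \<cdot> \<phi> p = \<phi> (p + 1) \<cdot> cdif X p \<longleftrightarrow>
      hom_dif C X Y n \<phi> p = \<one>\<^bsub>hom_group C X Y (n + 1)\<^esub> p" for p
  proof (cases "even n")
    case even: True
    have "cdif Y (p + n) \<cdot> \<phi> p = \<phi> (p + 1) \<cdot> cdif X p \<longleftrightarrow>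
        cdif Y (p + n) \<cdot> \<phi> p \<oplus> Neg C (\<phi> (p + 1) \<cdot> cdif X p) = Zero C (cobj X p) (cobj Y (p + n + 1))"
    proof
      assume "cdif Y (p + n) \<cdot> \<phi> p \<oplus> Neg C (\<phi> (p + 1) \<cdot> cdif X p) = Zero C (cobj X p) (cobj Y (p + n + 1))"
      then show "cdif Y (p + n) \<cdot> \<phi> p = \<phi> (p + 1) \<cdot> cdif X p"
        by - (rule eq_if_diff_zero, simp_all add: \<phi>D XYD idx)
    qed (simp add: \<phi>D XYD idx)
    then show ?thesis
      using even by (simp add: hom_dif_even signed_shift_def hom_group_simps idx)
  next
    case odd: False
    have "Neg C (cdif Y (p + n) \<cdot> \<phi> p) = \<phi> (p + 1) \<cdot> cdif X p \<longleftrightarrow>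
        cdif Y (p + n) \<cdot> \<phi> p \<oplus> \<phi> (p + 1) \<cdot> cdif X p = Zero C (cobj X p) (cobj Y (p + n + 1))"
    proof
      assume "cdif Y (p + n) \<cdot> \<phi> p \<oplus> \<phi> (p + 1) \<cdot> cdif X p = Zero C (cobj X p) (cobj Y (p + n + 1))"
      then have "\<phi> (p + 1) \<cdot> cdif X p = Neg C (cdif Y (p + n) \<cdot> \<phi> p)"
        by - (rule neg_unique, simp_all add: \<phi>D XYD idx)
      then show "Neg C (cdif Y (p + n) \<cdot> \<phi> p) = \<phi> (p + 1) \<cdot> cdif X p"
        by (rule sym)
    next
      assume "Neg C (cdif Y (p + n) \<cdot> \<phi> p) = \<phi> (p + 1) \<cdot> cdif X p"
      then show "cdif Y (p + n) \<cdot> \<phi> p \<oplus> \<phi> (p + 1) \<cdot> cdif X p = Zero C (cobj X p) (cobj Y (p + n + 1))"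
        by (rule subst) (simp add: \<phi>D XYD)
    qed
    then show ?thesis
      using odd by (simp add: hom_dif_odd signed_shift_def hom_group_simps idx \<phi>D XYD)
  qed
  moreover have "\<phi> p \<in> Mor C (cobj X p) (cobj (signed_shift C n Y) p)" for p
    by (simp add: Mor_def \<phi>D signed_shift_def)
  ultimately show ?thesis
    using True by (simp add: chain_map_def fun_eq_iff)
qed (auto simp: chain_map_def hom_group_simps Mor_def signed_shift_def)

lemma null_homotopic_signed_shift_iff:
  "null_homotopic C X (signed_shift C n Y) \<phi> \<longleftrightarrow> 
    \<phi> \<in> hom_dif C X Y (n - 1) ` carrier (hom_group C X Y (n - 1))"
proof -
  let ?T = "signed_shift C n Y"
  have idx: "p - 1 + n = p + (n - 1)" "p + 1 + (n - 1) = p + n" "p + (n - 1) + 1 = p + n" for p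
    by simp_all
  have T: "cobj ?T (p - 1) = cobj Y (p + (n - 1))" for p
    by (simp add: signed_shift_def idx)
  show ?thesis
  proof
    assume "null_homotopic C X ?T \<phi>"
    then obtain h where h: "\<And>p. h p \<in> Arr C" "\<And>p. Dom C (h p) = cobj X p"
      "\<And>p. Cod C (h p) = cobj ?T (p - 1)" "\<And>p. \<phi> p = cdif ?T (p - 1) \<cdot> h p \<oplus> h (p + 1) \<cdot> cdif X p"
      by (rule null_homotopicE) (rule that)
    note hD = h(1,2) h(3)[unfolded T]
    define \<psi> where "\<psi> p = (if even n then h p else Neg C (h p))" for p
    have "\<psi> \<in> carrier (hom_group C X Y (n - 1))"
      by (simp add: \<psi>_def hom_group_simps hD)
    moreover have "\<phi> p = hom_dif C X Y (n - 1) \<psi> p" for p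
      unfolding h(4) by (cases "even n") 
        (simp_all add: \<psi>_def hom_dif_even hom_dif_odd signed_shift_def XYD hD idx)
    ultimately show "\<phi> \<in> hom_dif C X Y (n - 1) ` carrier (hom_group C X Y (n - 1))"
      by (intro image_eqI[of _ _ \<psi>]) (simp_all add: fun_eq_iff)
  next
    assume "\<phi> \<in> hom_dif C X Y (n - 1) ` carrier (hom_group C X Y (n - 1))"
    then obtain \<psi> where "\<psi> \<in> carrier (hom_group C X Y (n - 1))" and \<phi>: "\<phi> = hom_dif C X Y (n - 1) \<psi>"
      by blast
    then have \<psi>: "\<psi> p \<in> Arr C" "Dom C (\<psi> p) = cobj X p" "Cod C (\<psi> p) = cobj Y (p + (n - 1))" for p
      by (auto simp: hom_group_simps)
    show "null_homotopic C X ?T \<phi>"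
    proof (rule null_homotopicI[where h = "\<lambda>p. if even n then \<psi> p else Neg C (\<psi> p)"])
      fix p
      show "\<phi> p = cdif ?T (p - 1) \<cdot> (if even n then \<psi> p else Neg C (\<psi> p)) \<oplus>
          (if even n then \<psi> (p + 1) else Neg C (\<psi> (p + 1))) \<cdot> cdif X p"
        unfolding \<phi> by (cases "even n") 
          (simp_all add: hom_dif_even hom_dif_odd signed_shift_def XYD \<psi> idx)
    qed (simp_all add: \<psi> T)
  qed
qed

lemma exact_at_hom_cpx_iff_no_maps_into:
  "inj \<iota> \<Longrightarrow> exact_at (hom_cpx \<iota> C X Y) n \<longleftrightarrow> no_maps_into C (signed_shift C n Y) X"
  unfolding exact_at_hom_cpx_iff no_maps_into_def chain_map_signed_shift_iff null_homotopic_signed_shift_iff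
  by blast

end

end

context abelian_category
begin

lemma injective_resolutionD:
  assumes "finite_injective_dimension C R"
  shows "is_cpx C (injective_resolution C R)"
    and "bounded_injective_cpx C (signed_shift C i (injective_resolution C R))"
proof -
  let ?I = "injective_resolution C R"
  have "\<exists>I. is_injective_resolution C R I"
    using assms by (auto simp: finite_injective_dimension_def)
  then have "is_injective_resolution C R ?I"
    unfolding injective_resolution_def by (rule someI_ex)
  then have I: "is_cpx C ?I" "\<And>n. is_injective C (cobj ?I n)" "\<And>n. n < 0 \<Longrightarrow> is_zero_obj C (cobj ?I n)"
    by (auto simp: is_injective_resolution_def)
  then show "is_cpx C ?I"
    by simp
  have "is_zero_obj C (cobj (signed_shift C i ?I) n)" if "n < - i" for n
    using that I(3)[of "n + i"] by (simp add: signed_shift_def)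
  moreover have "is_injective C (cobj (signed_shift C i ?I) n)" for n
    using I(2) by (simp add: signed_shift_def)
  ultimately show "bounded_injective_cpx C (signed_shift C i ?I)"
    unfolding bounded_injective_cpx_def using is_cpx_signed_shift[OF I(1) I(1)] by blast
qed

text \<open>
  The elements of \<open>Ext\<^sup>i(X, R)\<close> correspond to the homotopy classes of maps from \<open>X\<close> to \<open>I[i]\<close>, where \<open>I\<close> is
  the injective resolution of \<open>R\<close>.
\<close>

lemma Ext_zero_iff:
  assumes \<iota>: "inj \<iota>" and R: "finite_injective_dimension C R" and X: "is_cpx C X"
  shows "is_zero_obj Ab (Ext \<iota> C i X R) \<longleftrightarrow>
    no_maps_into C (signed_shift C i (injective_resolution C R)) X"
  unfolding Ext_def RHom_def Let_def ftor.simps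
  using Ab_H_obj_zero_iff[OF is_cpx_hom_cpx[OF X injective_resolutionD(1)[OF R] \<iota>]]
    exact_at_hom_cpx_iff_no_maps_into[OF X injective_resolutionD(1)[OF R] \<iota>] by simp

lemma Ext_zero_isomorphic:
  assumes \<iota>: "inj \<iota>" and R: "finite_injective_dimension C R" and S: "S \<subseteq> complexes C"
    and iso: "isomorphic (D_cat C S) X Y" and X: "X \<in> S" and Y: "Y \<in> S"
    and zero: "is_zero_obj Ab (Ext \<iota> C i Y R)"
  shows "is_zero_obj Ab (Ext \<iota> C i X R)"
proof -
  have "is_cpx C X" "is_cpx C Y"
    using S X Y by (auto simp: complexes_def)
  then show ?thesis
    using zero no_maps_into_isomorphic[OF S iso X Y injective_resolutionD(2)[OF R]]
    by (simp add: Ext_zero_iff[OF \<iota> R])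
qed

end

section \<open>Restricting an equivalence to full subcategories\<close>

lemma full_subcat_simps:
  "Obj (full_subcat C S) = Obj C \<inter> S" "Ident (full_subcat C S) = Ident C" "Comp (full_subcat C S) = Comp C"
  "Dom (full_subcat C S) = Dom C" "Cod (full_subcat C S) = Cod C"
  "Arr (full_subcat C S) = {f \<in> Arr C. Dom C f \<in> S \<and> Cod C f \<in> S}"
  by (simp_all add: full_subcat_def)

lemma Mor_full_subcat: "f \<in> Mor (full_subcat C S) A B \<longleftrightarrow> f \<in> Mor C A B \<and> A \<in> S \<and> B \<in> S"
  by (auto simp: full_subcat_def Mor_def)

lemma category_full_subcat:
  assumes "category C"
  shows "category (full_subcat C S)"
proof -
  interpret category C by fact
  show ?thesis
  proof (rule category.intro, unfold Mor_full_subcat full_subcat_simps)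
    fix f g h A B B' B''
    show "f \<in> {f \<in> Arr C. Dom C f \<in> S \<and> Cod C f \<in> S} \<Longrightarrow> Dom C f \<in> Obj C \<inter> S"
      "f \<in> {f \<in> Arr C. Dom C f \<in> S \<and> Cod C f \<in> S} \<Longrightarrow> Cod C f \<in> Obj C \<inter> S"
      by simp_all
    show "A \<in> Obj C \<inter> S \<Longrightarrow> Ident C A \<in> Mor C A A \<and> A \<in> S \<and> A \<in> S"
      by (simp add: ident_mor)
    show "\<lbrakk>f \<in> Mor C A B \<and> A \<in> S \<and> B \<in> S; g \<in> Mor C B B' \<and> B \<in> S \<and> B' \<in> S\<rbrakk>
        \<Longrightarrow> g \<cdot>\<^bsub>C\<^esub> f \<in> Mor C A B' \<and> A \<in> S \<and> B' \<in> S"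
      by (auto intro: comp_mor[of f A B])
    show "\<lbrakk>f \<in> Mor C A B \<and> A \<in> S \<and> B \<in> S; g \<in> Mor C B B' \<and> B \<in> S \<and> B' \<in> S;
        h \<in> Mor C B' B'' \<and> B' \<in> S \<and> B'' \<in> S\<rbrakk> \<Longrightarrow> (h \<cdot>\<^bsub>C\<^esub> g) \<cdot>\<^bsub>C\<^esub> f = h \<cdot>\<^bsub>C\<^esub> (g \<cdot>\<^bsub>C\<^esub> f)"
      using comp_assoc[of f A B g B' h B''] by simp
    show "f \<in> Mor C A B \<and> A \<in> S \<and> B \<in> S \<Longrightarrow> f \<cdot>\<^bsub>C\<^esub> Ident C A = f"
      using ident_right[of f A B] by simp
    show "f \<in> Mor C A B \<and> A \<in> S \<and> B \<in> S \<Longrightarrow> Ident C B \<cdot>\<^bsub>C\<^esub> f = f"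
      using ident_left[of f A B] by simp
  qed
qed

lemma is_iso_full_subcat:
  assumes "is_iso C f" "Dom C f \<in> S" "Cod C f \<in> S"
  shows "is_iso (full_subcat C S) f"
  using assms by (auto simp: is_iso_def inverse_arrows_def Mor_full_subcat full_subcat_simps)

lemma is_functor_full_subcat:
  assumes F: "is_functor C D F" and S: "\<And>A. A \<in> Obj C \<inter> S \<Longrightarrow> on_obj F A \<in> S'"
  shows "is_functor (full_subcat C S) (full_subcat D S') F"
proof -
  interpret category C
    using F by (simp add: is_functor_def)
  have obj: "A \<in> Obj C" "B \<in> Obj C" if "f \<in> Mor C A B" for f A B
    using that by (auto simp: Mor_def)
  show ?thesis
    unfolding is_functor_def
  proof (intro conjI allI ballI)
    fix A B f assume "f \<in> Mor (full_subcat C S) A B"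
    then show "on_arr F f \<in> Mor (full_subcat D S') (on_obj F A) (on_obj F B)"
      using F S[of A] S[of B] obj[of f A B] by (simp add: Mor_full_subcat is_functor_def)
  next
    fix A B B' f g assume "f \<in> Mor (full_subcat C S) A B" "g \<in> Mor (full_subcat C S) B B'"
    then show "on_arr F (g \<cdot>\<^bsub>full_subcat C S\<^esub> f) = on_arr F g \<cdot>\<^bsub>full_subcat D S'\<^esub> on_arr F f"
      using F unfolding Mor_full_subcat full_subcat_simps is_functor_def by (elim conjE) simp
  qed (use F S in \<open>auto simp: is_functor_def full_subcat_simps intro: category_full_subcat\<close>)
qed

lemma nat_iso_full_subcat:
  assumes \<eta>: "nat_iso C D F G \<eta>" and S: "\<And>A. A \<in> Obj C \<inter> S \<Longrightarrow> on_obj F A \<in> S'" 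
    "\<And>A. A \<in> Obj C \<inter> S \<Longrightarrow> on_obj G A \<in> S'"
  shows "nat_iso (full_subcat C S) (full_subcat D S') F G \<eta>"
  unfolding nat_iso_def
proof (intro conjI allI ballI)
  show "is_functor (full_subcat C S) (full_subcat D S') F" "is_functor (full_subcat C S) (full_subcat D S') G"
    using \<eta> S by (auto simp: nat_iso_def intro: is_functor_full_subcat)
  fix A assume "A \<in> Obj (full_subcat C S)"
  then have A: "A \<in> Obj C \<inter> S"
    by (simp add: full_subcat_simps)
  then have \<eta>A: "\<eta> A \<in> Mor D (on_obj F A) (on_obj G A)" "is_iso D (\<eta> A)"
    using \<eta> by (auto simp: nat_iso_def)
  then show "\<eta> A \<in> Mor (full_subcat D S') (on_obj F A) (on_obj G A)"
    using S[OF A] by (simp add: Mor_full_subcat)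
  show "is_iso (full_subcat D S') (\<eta> A)"
    using \<eta>A S[OF A] by (intro is_iso_full_subcat) (auto simp: Mor_def)
next
  fix A B f assume "f \<in> Mor (full_subcat C S) A B"
  then have "f \<in> Mor C A B"
    by (simp add: Mor_full_subcat)
  then show "\<eta> B \<cdot>\<^bsub>full_subcat D S'\<^esub> on_arr F f = on_arr G f \<cdot>\<^bsub>full_subcat D S'\<^esub> \<eta> A"
    using \<eta> by (simp add: nat_iso_def full_subcat_simps)
qed

lemma quasi_inverse_full_subcat:
  assumes FG: "quasi_inverse C D F G"
    and F: "\<And>A. A \<in> Obj C \<inter> S \<Longrightarrow> on_obj F A \<in> S'" and G: "\<And>B. B \<in> Obj D \<inter> S' \<Longrightarrow> on_obj G B \<in> S"
  shows "quasi_inverse (full_subcat C S) (full_subcat D S') F G"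
proof -
  have obj: "\<And>A. A \<in> Obj C \<Longrightarrow> on_obj F A \<in> Obj D" "\<And>B. B \<in> Obj D \<Longrightarrow> on_obj G B \<in> Obj C"
    using FG by (auto simp: quasi_inverse_def is_functor_def)
  obtain \<eta> \<epsilon> where \<eta>: "nat_iso C C id_ftor (comp_ftor G F) \<eta>" and \<epsilon>: "nat_iso D D (comp_ftor F G) id_ftor \<epsilon>"
    using FG by (auto simp: quasi_inverse_def)
  have "nat_iso (full_subcat C S) (full_subcat C S) id_ftor (comp_ftor G F) \<eta>"
    using \<eta> F G obj by (intro nat_iso_full_subcat) (auto simp: id_ftor_def comp_ftor_def)
  moreover have "nat_iso (full_subcat D S') (full_subcat D S') (comp_ftor F G) id_ftor \<epsilon>"
    using \<epsilon> F G obj by (intro nat_iso_full_subcat) (auto simp: id_ftor_def comp_ftor_def)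
  moreover have "is_functor (full_subcat C S) (full_subcat D S') F" "is_functor (full_subcat D S') (full_subcat C S) G"
    using FG F G by (auto simp: quasi_inverse_def intro: is_functor_full_subcat)
  ultimately show ?thesis
    unfolding quasi_inverse_def by blast
qed

section \<open>Derived Morita equivalence preserves the ethic t-structure\<close>

lemma Obj_D_plus: "Obj (D_plus C) = bb_complexes C"
  by (simp add: D_plus_def addcat.extend_def D_cat_def localization_def K_cat_def)

lemma isomorphic_D_plus: "isomorphic (D_plus C) A B \<longleftrightarrow> isomorphic (D_cat C (bb_complexes C)) A B"
  by (simp add: isomorphic_def Mor_def is_iso_def inverse_arrows_def D_plus_def addcat.extend_def)

lemma isomorphic_sym: "isomorphic C A B \<Longrightarrow> isomorphic C B A"
  by (auto simp: isomorphic_def is_iso_def inverse_arrows_def Mor_def)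

lemma nat_iso_isomorphic:
  "\<lbrakk>nat_iso C D F G \<eta>; A \<in> Obj C\<rbrakk> \<Longrightarrow> isomorphic D (on_obj F A) (on_obj G A)"
  by (auto simp: nat_iso_def isomorphic_def)

text \<open>
  In contrast to \<open>Ext_zero_isomorphic\<close>, which concerns isomorphisms of the argument of \<open>RHom\<close>, this lemma
  transports vanishing along isomorphisms of its values.
\<close>

lemma H_obj_zero_isomorphic_iff:
  assumes "isomorphic D_Ab P Q" "P \<in> complexes Ab" "Q \<in> complexes Ab"
  shows "is_zero_obj Ab (H_obj Ab i P) \<longleftrightarrow> is_zero_obj Ab (H_obj Ab i Q)"
  using exact_at_isomorphic[OF assms] exact_at_isomorphic[OF isomorphic_sym[OF assms(1)] assms(3,2)]
    assms(2,3) by (auto simp: complexes_def Ab_H_obj_zero_iff)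

theorem proposition2p21:
  fixes E :: "('o, 'm) addcat" and E' :: "('p, 'n) addcat"
    and R :: 'o and R' :: 'p
    and \<iota> :: "(int \<Rightarrow> 'm) \<Rightarrow> 'u" and \<iota>' :: "(int \<Rightarrow> 'n) \<Rightarrow> 'u"
    and F :: "(('o, 'm) cpx, ('o, 'm) darr, ('p, 'n) cpx, ('p, 'n) darr) ftor"
  assumes universe: "infinite (UNIV :: 'u set)" "inj \<iota>" "inj \<iota>'"
    and E: "abelian_category E" "enough_injectives E"
    and E': "abelian_category E'" "enough_injectives E'"
    and R: "R \<in> Obj E" "finite_injective_dimension E R"
    and R': "R' \<in> Obj E'" "finite_injective_dimension E' R'"
    and Morita: "derived_Morita_via \<iota> \<iota>' E R E' R' F"
  shows "(\<forall>A \<in> Obj (D_plus E). A \<in> ethic_le0 \<iota> E R \<longleftrightarrow> on_obj F A \<in> ethic_le0 \<iota>' E' R') \<and>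
    (\<forall>A \<in> Obj (D_plus E). A \<in> ethic_ge0 \<iota> E R \<longleftrightarrow> on_obj F A \<in> ethic_ge0 \<iota>' E' R') \<and>
    is_equivalence (ethic_heart \<iota> E R) (ethic_heart \<iota>' E' R') F"
proof -
  interpret E: abelian_category E by fact
  obtain G \<eta> where FG: "quasi_inverse (D_plus E) (D_plus E') F G"
    and \<eta>: "nat_iso (op_cat (D_plus E')) D_Ab (RHom \<iota>' E' R') (comp_ftor (RHom \<iota> E R) G) \<eta>"
    using Morita unfolding derived_Morita_via_def by blast
  obtain \<theta> where \<theta>: "nat_iso (D_plus E) (D_plus E) id_ftor (comp_ftor G F) \<theta>"
    using FG unfolding quasi_inverse_def by blast
  have F_obj: "on_obj F A \<in> Obj (D_plus E')" if "A \<in> Obj (D_plus E)" for A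
    using FG that by (simp add: quasi_inverse_def is_functor_def)
  have G_obj: "on_obj G B \<in> Obj (D_plus E)" if "B \<in> Obj (D_plus E')" for B
    using FG that by (simp add: quasi_inverse_def is_functor_def)
  have bb: "bb_complexes E \<subseteq> complexes E"
    by (auto simp: bb_complexes_def complexes_def)

  have Ext_G: "is_zero_obj Ab (Ext \<iota>' E' i B R') \<longleftrightarrow> is_zero_obj Ab (Ext \<iota> E i (on_obj G B) R)"
    if B: "B \<in> Obj (D_plus E')" for B i
  proof -
    have B': "B \<in> Obj (op_cat (D_plus E'))"
      using B by (simp add: op_cat_def)
    have "isomorphic D_Ab (on_obj (RHom \<iota>' E' R') B) (on_obj (RHom \<iota> E R) (on_obj G B))"
      using nat_iso_isomorphic[OF \<eta> B'] by (simp add: comp_ftor_def)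
    moreover have "on_obj (RHom \<iota>' E' R') B \<in> complexes Ab" "on_obj (RHom \<iota> E R) (on_obj G B) \<in> complexes Ab"
      using \<eta> B' unfolding nat_iso_def is_functor_def
      by (auto simp: comp_ftor_def D_cat_def localization_def K_cat_def)
    ultimately show ?thesis
      unfolding Ext_def by (rule H_obj_zero_isomorphic_iff)
  qed
  have Ext_F: "is_zero_obj Ab (Ext \<iota>' E' i (on_obj F A) R') \<longleftrightarrow> is_zero_obj Ab (Ext \<iota> E i A R)"
    if A: "A \<in> Obj (D_plus E)" for A i
  proof -
    let ?GFA = "on_obj G (on_obj F A)"
    have iso: "isomorphic (D_cat E (bb_complexes E)) A ?GFA"
      using nat_iso_isomorphic[OF \<theta> A] by (simp add: isomorphic_D_plus id_ftor_def comp_ftor_def)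
    have mem: "A \<in> bb_complexes E" "?GFA \<in> bb_complexes E"
      using A G_obj[OF F_obj[OF A]] by (simp_all add: Obj_D_plus)
    show ?thesis
      unfolding Ext_G[OF F_obj[OF A]]
      using E.Ext_zero_isomorphic[OF universe(2) R(2) bb iso mem]
        E.Ext_zero_isomorphic[OF universe(2) R(2) bb isomorphic_sym[OF iso] mem(2,1)] by blast
  qed

  have le0: "A \<in> ethic_le0 \<iota> E R \<longleftrightarrow> on_obj F A \<in> ethic_le0 \<iota>' E' R'" if "A \<in> Obj (D_plus E)" for A
    using that F_obj Ext_F by (simp add: ethic_le0_def)
  have ge0: "A \<in> ethic_ge0 \<iota> E R \<longleftrightarrow> on_obj F A \<in> ethic_ge0 \<iota>' E' R'" if "A \<in> Obj (D_plus E)" for A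
    using that F_obj Ext_F by (simp add: ethic_ge0_def)
  have "quasi_inverse (ethic_heart \<iota> E R) (ethic_heart \<iota>' E' R') F G"
    unfolding ethic_heart_def
  proof (rule quasi_inverse_full_subcat[OF FG])
    show "on_obj F A \<in> ethic_le0 \<iota>' E' R' \<inter> ethic_ge0 \<iota>' E' R'"
      if "A \<in> Obj (D_plus E) \<inter> (ethic_le0 \<iota> E R \<inter> ethic_ge0 \<iota> E R)" for A
      using that le0 ge0 by blast
    show "on_obj G B \<in> ethic_le0 \<iota> E R \<inter> ethic_ge0 \<iota> E R"
      if "B \<in> Obj (D_plus E') \<inter> (ethic_le0 \<iota>' E' R' \<inter> ethic_ge0 \<iota>' E' R')" for B
      using that Ext_G G_obj by (auto simp: ethic_le0_def ethic_ge0_def)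
  qed
  then show ?thesis
    using le0 ge0 by (auto simp: is_equivalence_def)
qed

end
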